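(* Let $[\Lambda,q,r,\beta]$ and $[\Lambda,q,r,\beta']$ be two skew-simple strata in $A=\mathrm{End}_F(V)$ which intertwine in $G$. Then they are conjugate by an element of $\mathrm U(\Lambda)=\tilde{\mathrm U}(\Lambda)\cap G$, i.e. there is $g\in\mathrm U(\Lambda)$ with $[\Lambda,q,r,g\beta g^{-1}]$ equivalent to $[\Lambda,q,r,\beta']$.
   Context: $F$ nonarchimedean local field of odd residual characteristic, $\rho$ an automorphism of $F$ with $\rho^2=\mathrm{id}$, $\epsilon=\pm1$; $(V,h)$ finite-dimensional $\epsilon$-hermitian space ($h$ nondegenerate biadditive, $h(v_1x,v_2y)=\rho(x)\epsilon\rho(h(v_2,v_1))y$), $A=\mathrm{End}_F(V)$, $\sigma$ the adjoint anti-involution ($h(av,w)=h(v,\sigma(a)w)$), $G$ the isometry group. Lattice sequences $\Lambda$: decreasing maps $\mathbb Z\to$ full-rank $o_F$-lattices with $\Lambda_s\pi=\Lambda_{s+e}$; $M^{\#}=\{v:h(v,M)\subseteq\mathfrak p_F\}$; self-dual if $(\Lambda_s)^{\#}=\Lambda_{u-s}$ for some $u$. $\mathfrak a_n(\Lambda)=\{a:a\Lambda_s\subseteq\Lambda_{s+n}\forall s\}$, $\tilde{\mathrm U}(\Lambda)=\mathfrak a_0(\Lambda)^\times$, $\nu_\Lambda(a)=\sup\{n:a\in\mathfrak a_n\}$; normalizing: $\nu_\Lambda(g^{-1})=-\nu_\Lambda(g)$. Stratum $[\Lambda,q,r,\beta]$, $q\ge r\ge0$, $\beta\in\mathfrak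 a_{-q}$; equivalence: $\beta+\mathfrak a_{-r-j}=\beta'+\mathfrak a_{-r-j}$ $\forall j\ge0$; intertwining in $G$: some $g\in G$ with $g(\beta+\mathfrak a_{-r})g^{-1}\cap(\beta'+\mathfrak a_{-r})\ne\emptyset$. Zero: $\beta=0,q=r$; pure: $F[\beta]$ a field, $F[\beta]^\times$ normalizes $\Lambda$, $\nu_\Lambda(\beta)=-q<-r$; simple: zero or pure with $[F[\beta]:F]$ minimal among equivalent pure strata. Skew-simple: simple with $\sigma(\beta)=-\beta$ and $\Lambda$ self-dual. *)

theory Defs
  imports "HOL-Analysis.Analysis"
begin

text \<open>A field is given with a normalized discrete valuation val (only its values on
nonzero elements matter).  pin val n x means x lies in the fractional ideal p_F^n.\<close>

definition pin :: "('k::field \<Rightarrow> int) \<Rightarrow> int \<Rightarrow> 'k \<Rightarrow> bool" where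
  "pin val n x \<longleftrightarrow> x = 0 \<or> n \<le> val x"

definition ring_of_integers :: "('k::field \<Rightarrow> int) \<Rightarrow> 'k set" where
  "ring_of_integers val = {x. pin val 0 x}"

definition max_ideal :: "('k::field \<Rightarrow> int) \<Rightarrow> 'k set" where
  "max_ideal val = {x. pin val 1 x}"

definition discrete_valuation :: "('k::field \<Rightarrow> int) \<Rightarrow> bool" where
  "discrete_valuation val \<longleftrightarrow>
     (\<forall>x y. x \<noteq> 0 \<longrightarrow> y \<noteq> 0 \<longrightarrow> val (x * y) = val x + val y) \<and>
     (\<forall>x y. x \<noteq> 0 \<longrightarrow> y \<noteq> 0 \<longrightarrow> x + y \<noteq> 0 \<longrightarrow> min (val x) (val y) \<le> val (x + y)) \<and>
     (\<exists>w. w \<noteq> 0 \<and> val w = 1)"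

definition complete_wrt :: "('k::field \<Rightarrow> int) \<Rightarrow> bool" where
  "complete_wrt val \<longleftrightarrow>
     (\<forall>s :: nat \<Rightarrow> 'k.
        (\<forall>n. \<exists>N. \<forall>i\<ge>N. \<forall>j\<ge>N. pin val n (s i - s j)) \<longrightarrow>
        (\<exists>L. \<forall>n. \<exists>N. \<forall>i\<ge>N. pin val n (s i - L)))"

definition residue_field :: "('k::field \<Rightarrow> int) \<Rightarrow> 'k set set" where
  "residue_field val = ring_of_integers val //
     {(x, y). x \<in> ring_of_integers val \<and> y \<in> ring_of_integers val \<and> x - y \<in> max_ideal val}"

definition nonarch_local_field_odd :: "('k::field \<Rightarrow> int) \<Rightarrow> bool" where
  "nonarch_local_field_odd val \<longleftrightarrow>
     discrete_valuation val \<and> complete_wrt val \<and> finite (residue_field val) \<and>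
     (2::'k) \<notin> max_ideal val"

text \<open>rho: a (continuous, i.e. valuation preserving) field automorphism with rho^2 = id.\<close>
definition field_involution :: "('k::field \<Rightarrow> int) \<Rightarrow> ('k \<Rightarrow> 'k) \<Rightarrow> bool" where
  "field_involution val \<rho> \<longleftrightarrow>
     (\<forall>x y. \<rho> (x + y) = \<rho> x + \<rho> y) \<and> (\<forall>x y. \<rho> (x * y) = \<rho> x * \<rho> y) \<and>
     \<rho> 1 = 1 \<and> (\<forall>x. \<rho> (\<rho> x) = x) \<and> (\<forall>x. x \<noteq> 0 \<longrightarrow> val (\<rho> x) = val x)"

section \<open>epsilon-hermitian spaces; V = F^n, A = End_F(V) = n x n matrices\<close>

definition eps_hermitian ::
  "('k::field \<Rightarrow> 'k) \<Rightarrow> 'k \<Rightarrow> ('k^'n \<Rightarrow> 'k^'n \<Rightarrow> 'k) \<Rightarrow> bool" where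
  "eps_hermitian \<rho> \<epsilon> h \<longleftrightarrow>
     (\<epsilon> = 1 \<or> \<epsilon> = -1) \<and>
     (\<forall>v v' w. h (v + v') w = h v w + h v' w) \<and>
     (\<forall>v w w'. h v (w + w') = h v w + h v w') \<and>
     (\<forall>v w x y. h (x *s v) (y *s w) = \<rho> x * \<epsilon> * \<rho> (h w v) * y) \<and>
     (\<forall>v. (\<forall>w. h v w = 0) \<longrightarrow> v = 0)"

definition isom_group :: "('k::field^'n \<Rightarrow> 'k^'n \<Rightarrow> 'k) \<Rightarrow> ('k^'n^'n) set" where
  "isom_group h = {g. (\<exists>g'. g ** g' = mat 1 \<and> g' ** g = mat 1) \<and>
                       (\<forall>v w. h (g *v v) (g *v w) = h v w)}"

text \<open>sigma(b) = -b, written via the defining property of the adjoint anti-involution.\<close>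
definition skew :: "('k::field^'n \<Rightarrow> 'k^'n \<Rightarrow> 'k) \<Rightarrow> 'k^'n^'n \<Rightarrow> bool" where
  "skew h b \<longleftrightarrow> (\<forall>v w. h (b *v v) w = h v ((- b) *v w))"

definition full_lattice :: "('k::field \<Rightarrow> int) \<Rightarrow> ('k^'n) set \<Rightarrow> bool" where
  "full_lattice val L \<longleftrightarrow>
     (\<exists>S. finite S \<and> L = {(\<Sum>s\<in>S. c s *s s) | c. \<forall>s\<in>S. c s \<in> ring_of_integers val}) \<and>
     (\<forall>v. \<exists>x. x \<noteq> 0 \<and> x *s v \<in> L)"

definition lattice_seq :: "('k::field \<Rightarrow> int) \<Rightarrow> (int \<Rightarrow> ('k^'n) set) \<Rightarrow> bool" where
  "lattice_seq val \<Lambda> \<longleftrightarrow>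
     (\<forall>s. full_lattice val (\<Lambda> s)) \<and> (\<forall>s. \<Lambda> (s + 1) \<subseteq> \<Lambda> s) \<and>
     (\<exists>e::int. e > 0 \<and> (\<forall>\<pi>. \<pi> \<noteq> 0 \<and> val \<pi> = 1 \<longrightarrow>
                          (\<forall>s. (\<lambda>v. \<pi> *s v) ` \<Lambda> s = \<Lambda> (s + e))))"

definition dual_lattice ::
  "('k::field \<Rightarrow> int) \<Rightarrow> ('k^'n \<Rightarrow> 'k^'n \<Rightarrow> 'k) \<Rightarrow> ('k^'n) set \<Rightarrow> ('k^'n) set" where
  "dual_lattice val h M = {v. \<forall>w\<in>M. h v w \<in> max_ideal val}"

definition self_dual ::
  "('k::field \<Rightarrow> int) \<Rightarrow> ('k^'n \<Rightarrow> 'k^'n \<Rightarrow> 'k) \<Rightarrow> (int \<Rightarrow> ('k^'n) set) \<Rightarrow> bool" where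
  "self_dual val h \<Lambda> \<longleftrightarrow> (\<exists>u::int. \<forall>s. dual_lattice val h (\<Lambda> s) = \<Lambda> (u - s))"

definition filt :: "(int \<Rightarrow> ('k::field^'n) set) \<Rightarrow> int \<Rightarrow> ('k^'n^'n) set" where
  "filt \<Lambda> n = {a. \<forall>s. (\<lambda>v. a *v v) ` \<Lambda> s \<subseteq> \<Lambda> (s + n)}"

definition Ut :: "(int \<Rightarrow> ('k::field^'n) set) \<Rightarrow> ('k^'n^'n) set" where
  "Ut \<Lambda> = {g. g \<in> filt \<Lambda> 0 \<and> (\<exists>g'. g' \<in> filt \<Lambda> 0 \<and> g ** g' = mat 1 \<and> g' ** g = mat 1)}"

definition U :: "('k::field^'n \<Rightarrow> 'k^'n \<Rightarrow> 'k) \<Rightarrow> (int \<Rightarrow> ('k^'n) set) \<Rightarrow> ('k^'n^'n) set" where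
  "U h \<Lambda> = Ut \<Lambda> \<inter> isom_group h"

primrec mpow :: "'k::field^'n^'n \<Rightarrow> nat \<Rightarrow> 'k^'n^'n" where
  "mpow b 0 = mat 1"
| "mpow b (Suc m) = b ** mpow b m"

definition smult_mat :: "'k::field \<Rightarrow> 'k^'n^'n \<Rightarrow> 'k^'n^'n" where
  "smult_mat c a = (\<chi> i j. c * a $ i $ j)"

definition Fbeta :: "'k::field^'n^'n \<Rightarrow> ('k^'n^'n) set" where
  "Fbeta b = {(\<Sum>i<m. smult_mat (c i) (mpow b i)) | c m. True}"

definition Fbeta_is_field :: "'k::field^'n^'n \<Rightarrow> bool" where
  "Fbeta_is_field b \<longleftrightarrow> (\<forall>x\<in>Fbeta b. x \<noteq> 0 \<longrightarrow> (\<exists>y\<in>Fbeta b. x ** y = mat 1))"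

text \<open>[F[beta]:F] = degree of the minimal polynomial of beta = dim_F F[beta].\<close>
definition deg_Fbeta :: "'k::field^'n^'n \<Rightarrow> nat" where
  "deg_Fbeta b = (LEAST m. \<exists>c. mpow b m = (\<Sum>i<m. smult_mat (c i) (mpow b i)))"

definition stratum :: "(int \<Rightarrow> ('k::field^'n) set) \<Rightarrow> int \<Rightarrow> int \<Rightarrow> 'k^'n^'n \<Rightarrow> bool" where
  "stratum \<Lambda> q r b \<longleftrightarrow> q \<ge> r \<and> r \<ge> 0 \<and> b \<in> filt \<Lambda> (- q)"

definition strata_equiv :: "(int \<Rightarrow> ('k::field^'n) set) \<Rightarrow> int \<Rightarrow> int \<Rightarrow> 'k^'n^'n \<Rightarrow> 'k^'n^'n \<Rightarrow> bool" where
  "strata_equiv \<Lambda> q r b b' \<longleftrightarrow>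
     (\<forall>j::int. j \<ge> 0 \<longrightarrow> (\<lambda>x. b + x) ` filt \<Lambda> (- r - j) = (\<lambda>x. b' + x) ` filt \<Lambda> (- r - j))"

definition zero_stratum :: "(int \<Rightarrow> ('k::field^'n) set) \<Rightarrow> int \<Rightarrow> int \<Rightarrow> 'k^'n^'n \<Rightarrow> bool" where
  "zero_stratum \<Lambda> q r b \<longleftrightarrow> stratum \<Lambda> q r b \<and> b = 0 \<and> q = r"

text \<open>nu_Lambda(b) = -q is expressed as b \<in> a_{-q} and b \<notin> a_{-q+1}.\<close>
definition pure_stratum :: "(int \<Rightarrow> ('k::field^'n) set) \<Rightarrow> int \<Rightarrow> int \<Rightarrow> 'k^'n^'n \<Rightarrow> bool" where
  "pure_stratum \<Lambda> q r b \<longleftrightarrow> stratum \<Lambda> q r b \<and> Fbeta_is_field b \<and>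
     (\<forall>x\<in>Fbeta b. x \<noteq> 0 \<longrightarrow> (\<exists>k::int. \<forall>s. (\<lambda>v. x *v v) ` \<Lambda> s = \<Lambda> (s + k))) \<and>
     b \<in> filt \<Lambda> (- q) \<and> b \<notin> filt \<Lambda> (- q + 1) \<and> - q < - r"

definition simple_stratum :: "(int \<Rightarrow> ('k::field^'n) set) \<Rightarrow> int \<Rightarrow> int \<Rightarrow> 'k^'n^'n \<Rightarrow> bool" where
  "simple_stratum \<Lambda> q r b \<longleftrightarrow> zero_stratum \<Lambda> q r b \<or>
     (pure_stratum \<Lambda> q r b \<and>
      (\<forall>b'. pure_stratum \<Lambda> q r b' \<longrightarrow> strata_equiv \<Lambda> q r b b' \<longrightarrow> deg_Fbeta b \<le> deg_Fbeta b'))"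

definition skew_simple_stratum ::
  "('k::field \<Rightarrow> int) \<Rightarrow> ('k^'n \<Rightarrow> 'k^'n \<Rightarrow> 'k) \<Rightarrow> (int \<Rightarrow> ('k^'n) set) \<Rightarrow> int \<Rightarrow> int \<Rightarrow> 'k^'n^'n \<Rightarrow> bool" where
  "skew_simple_stratum val h \<Lambda> q r b \<longleftrightarrow>
     lattice_seq val \<Lambda> \<and> simple_stratum \<Lambda> q r b \<and> skew h b \<and> self_dual val h \<Lambda>"

text \<open>Intertwining in G: g (b + a_{-r}) g^{-1} meets b' + a_{-r}, i.e. g x = y g.\<close>
definition intertwine_in_G ::
  "('k::field^'n \<Rightarrow> 'k^'n \<Rightarrow> 'k) \<Rightarrow> (int \<Rightarrow> ('k^'n) set) \<Rightarrow> int \<Rightarrow> 'k^'n^'n \<Rightarrow> 'k^'n^'n \<Rightarrow> bool" where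
  "intertwine_in_G h \<Lambda> r b b' \<longleftrightarrow>
     (\<exists>g\<in>isom_group h. \<exists>x\<in>(\<lambda>a. b + a) ` filt \<Lambda> (- r). \<exists>y\<in>(\<lambda>a. b' + a) ` filt \<Lambda> (- r).
        g ** x = y ** g)"

end

theory Submission
  imports Defs "HOL-Computational_Algebra.Polynomial"
begin

text \<open>Let \<open>b\<close> be simple of degree \<open>d\<close> and let \<open>w f\<close> be the shift of the lattice sequence by \<open>f(b)\<close>.
  Minimality of \<open>d\<close> forces \<open>f(y) \<equiv> f(b)\<close> modulo higher filtration for every \<open>y \<in> b + a_{-r}\<close> and every
  \<open>f\<close> of degree less than \<open>d\<close>: a key polynomial \<open>f0\<close> of least degree violating this would, by a bound on
  the Bezoutian of \<open>f0\<close>, be the minimal polynomial of a pure element of \<open>b + a_{-r}\<close> of smaller degree.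
  So \<open>y\<close> alone determines the valued field \<open>F[b]\<close> approximately. If \<open>g\<close> intertwines the strata, choose
  skew elements with \<open>g x = y g\<close>; comparing growth rates of powers, \<open>x\<close> carries the same approximate field
  structure on \<open>\<Lambda>\<close> and on \<open>\<Lambda>' = g\<^sup>-\<^sup>1 \<Lambda>\<close>. The residual hermitian spaces of \<open>\<Lambda>\<close> and \<open>\<Lambda>'\<close> are Witt
  equivalent, because the diagonal of \<open>\<Lambda> s \<inter> \<Lambda>' s\<close> is a Lagrangian in their difference; being of equal size
  they are isometric over the residual field structure. An approximately equivariant lift of this
  isometry is turned into an exact isometry by a Newton iteration for \<open>(adj U U)\<close> to the power \<open>- 1/2\<close>.\<close>

section \<open>Valuations, matrices and polynomials in a matrix\<close>

text \<open>The obstacle is that the intertwining element relates only points of the two cosets.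
  Such points need not generate fields, and \<open>g\<close> need not preserve the lattice sequence,
  so neither \<open>F[b]\<close> nor its minimal polynomial can be transported; what survives is the
  weight of each polynomial of small degree. All error terms are governed by the largest weight
  \<open>om\<close> of a monic polynomial of degree \<open>d - 1\<close>: reducing
  \<open>X f\<close> modulo \<open>P\<close> subtracts the top coefficient of \<open>f\<close> times
  \<open>P\<close>, and \<open>om\<close> controls that coefficient. Hence \<open>P(x)\<close> in
  depth \<open>om + n\<close> lets multiplication by \<open>x\<close> be replaced by multiplication
  by \<open>X\<close> modulo \<open>P\<close> with an error in depth \<open>n\<close>; the Bezoutian
  bound supplies this depth for \<open>n = - r\<close>. Witt cancellation is done on lattices: a
  Lagrangian with a nontrivial kernel is replaced by neighbouring Lagrangians with a smaller one.
  Odd residual characteristic enters through the integral element 1/2, in taking skew parts, in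
  making a hyperbolic partner isotropic and in the Newton step.\<close>

lemma discrete_valuation_mult:
  "discrete_valuation val \<Longrightarrow> x \<noteq> 0 \<Longrightarrow> y \<noteq> 0 \<Longrightarrow> val (x * y) = val x + val y"
  by (simp add: discrete_valuation_def)

lemma discrete_valuation_one: "discrete_valuation val \<Longrightarrow> val 1 = 0"
  using discrete_valuation_mult[of val 1 1] by simp

lemma discrete_valuation_uminus:
  assumes "discrete_valuation val" "x \<noteq> 0"
  shows "val (- x) = val x"
proof -
  have "val ((-1) * (-1)) = val (-1) + val (-1)"
    by (rule discrete_valuation_mult[OF assms(1)]) auto
  then have "val (-1) = 0"
    by (simp add: discrete_valuation_one[OF assms(1)])
  then show ?thesis
    using discrete_valuation_mult[OF assms(1), of "-1" x] assms(2) by simp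
qed

lemma discrete_valuation_inverse:
  assumes "discrete_valuation val" "x \<noteq> 0"
  shows "val (inverse x) = - val x"
  using discrete_valuation_mult[OF assms, of "inverse x"] discrete_valuation_one[OF assms(1)] assms(2)
  by simp

lemma discrete_valuation_power_int_ex:
  assumes dv: "discrete_valuation val"
  shows "\<exists>c. c \<noteq> 0 \<and> val c = n"
proof -
  obtain w where w: "w \<noteq> 0" "val w = 1"
    using dv by (auto simp: discrete_valuation_def)
  have pos: "\<exists>c. c \<noteq> 0 \<and> val c = int m" for m
  proof (induction m)
    case 0
    show ?case using discrete_valuation_one[OF dv] by (intro exI[of _ 1]) simp
  next
    case (Suc m)
    then obtain c where "c \<noteq> 0" "val c = int m" by blast
    then show ?case
      using w discrete_valuation_mult[OF dv, of c w] by (intro exI[of _ "c * w"]) simp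
  qed
  show ?thesis
  proof (cases "n \<ge> 0")
    case True
    then show ?thesis using pos[of "nat n"] by simp
  next
    case False
    then obtain c where "c \<noteq> 0" "val c = - n" using pos[of "nat (- n)"] by auto
    then show ?thesis
      using discrete_valuation_inverse[OF dv, of c] by (intro exI[of _ "inverse c"]) simp
  qed
qed

lemma pin_zero [simp]: "pin val n 0"
  by (simp add: pin_def)

lemma pin_add: "discrete_valuation val \<Longrightarrow> pin val n x \<Longrightarrow> pin val n y \<Longrightarrow> pin val n (x + y)"
  unfolding pin_def discrete_valuation_def
  by (metis (no_types, lifting) add.left_neutral add.right_neutral min_def order_trans)

lemma pin_mult: "discrete_valuation val \<Longrightarrow> pin val n x \<Longrightarrow> pin val m y \<Longrightarrow> pin val (n + m) (x * y)"
  unfolding pin_def using discrete_valuation_mult by (metis add_mono mult_eq_0_iff)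

lemma pin_uminus: "discrete_valuation val \<Longrightarrow> pin val n (- x) \<longleftrightarrow> pin val n x"
  unfolding pin_def using discrete_valuation_uminus by (metis neg_equal_0_iff_equal)

lemma pin_diff: "discrete_valuation val \<Longrightarrow> pin val n x \<Longrightarrow> pin val n y \<Longrightarrow> pin val n (x - y)"
  using pin_add[of val n x "- y"] pin_uminus by fastforce

lemma pin_mono: "pin val n x \<Longrightarrow> m \<le> n \<Longrightarrow> pin val m x"
  by (auto simp: pin_def)

lemma pin_one: "discrete_valuation val \<Longrightarrow> pin val n 1 \<longleftrightarrow> n \<le> 0"
  by (simp add: pin_def discrete_valuation_one)

lemma pin_sum:
  assumes "discrete_valuation val" "\<And>i. i \<in> I \<Longrightarrow> pin val n (f i)"
  shows "pin val n (sum f I)"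
  using assms(2) by (induction I rule: infinite_finite_induct) (auto intro: pin_add[OF assms(1)])

context vector_space
begin

text \<open>Extend a basis of \<open>W\<close> by \<open>v\<close> and read off the coordinate along
  \<open>v\<close>. The setting is an arbitrary vector space because pairs of vectors are treated
  later as well as vectors.\<close>

lemma separating_functional:
  assumes W: "subspace W" and v: "v \<notin> W"
  shows "\<exists>\<phi>. Vector_Spaces.linear scale (*) \<phi> \<and> \<phi> v = 1 \<and> (\<forall>w\<in>W. \<phi> w = 0)"
proof -
  interpret vp: vector_space_pair scale "(*) :: 'a \<Rightarrow> 'a \<Rightarrow> 'a" ..
  obtain B where B: "B \<subseteq> W" "independent B" "W \<subseteq> span B"
    using maximal_independent_subset[of W] by blast
  have sp: "span B = W"
    using B W span_minimal by blast
  then have "independent (insert v B)"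
    using B v by (simp add: independent_insert)
  then obtain \<phi> where \<phi>: "Vector_Spaces.linear scale (*) \<phi>" "\<forall>x\<in>insert v B. \<phi> x = (if x = v then 1 else 0)"
    using vp.linear_independent_extend[of "insert v B" "\<lambda>x. if x = v then 1 else 0"] by blast
  have "v \<notin> B" using B(1) v by blast
  have "\<phi> w = 0" if "w \<in> span B" for w
    using vp.linear_eq_0_on_span[OF \<phi>(1) _ that] \<phi>(2) \<open>v \<notin> B\<close> by fastforce
  then show ?thesis using \<phi> sp by auto
qed

end

section \<open>Matrix arithmetic and evaluation of polynomials at a matrix\<close>

lemma matrix_mult_ring:
  fixes A B C :: "'k::field^'n^'n"
  shows "(A + B) ** C = A ** C + B ** C" "A ** (B + C) = A ** B + A ** C"
    "(A - B) ** C = A ** C - B ** C" "A ** (B - C) = A ** B - A ** C"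
    "(- A) ** C = - (A ** C)" "A ** (- C) = - (A ** C)"
    "0 ** C = 0" "A ** 0 = 0" "A ** (B ** C) = A ** B ** C"
    "mat 1 ** A = A" "A ** mat 1 = A"
proof -
  have z: "0 ** C = 0" "A ** 0 = 0" for A C :: "'k^'n^'n"
    by (simp_all add: matrix_eq flip: matrix_vector_mul_assoc)
  show d: "(A + B) ** C = A ** C + B ** C" "A ** (B + C) = A ** B + A ** C"
    "(A - B) ** C = A ** C - B ** C" "A ** (B - C) = A ** B - A ** C"
    for A B C :: "'k^'n^'n"
    by (simp_all add: matrix_eq matrix_vector_right_distrib matrix_vector_mult_add_rdistrib
        matrix_vector_mult_diff_distrib matrix_vector_mult_diff_rdistrib flip: matrix_vector_mul_assoc)
  show "(- A) ** C = - (A ** C)" "A ** (- C) = - (A ** C)"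
    using d(3)[of 0 A C] d(4)[of A 0 C] z by simp_all
qed (simp_all add: matrix_eq matrix_mul_assoc flip: matrix_vector_mul_assoc)

lemma matrix_vector_ring:
  fixes A B :: "'k::field^'n^'n"
  shows "(A + B) *v v = A *v v + B *v v" "A *v (v + w) = A *v v + A *v w"
    "(A - B) *v v = A *v v - B *v v" "A *v (v - w) = A *v v - A *v w"
    "(A ** B) *v v = A *v (B *v v)" "A *v (c *s v) = c *s (A *v v)"
    "(- A) *v v = - (A *v v)" "A *v (- v) = - (A *v v)"
proof -
  show d: "(A - B) *v v = A *v v - B *v v" "A *v (v - w) = A *v v - A *v w" for A B :: "'k^'n^'n" and v w
    by (simp_all add: matrix_vector_mult_diff_distrib matrix_vector_mult_diff_rdistrib)
  show "(- A) *v v = - (A *v v)" "A *v (- v) = - (A *v v)"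
    using d(1)[of 0 A v] d(2)[of A 0 v] by simp_all
qed (simp_all add: matrix_vector_right_distrib matrix_vector_mult_add_rdistrib matrix_vector_mul_assoc
    vector_scalar_commute)

lemma mat_mult_vector: "mat c *v v = c *s (v::'k::field^'n)"
  by (simp add: vec_eq_iff matrix_vector_mult_def mat_def if_distrib if_distribR sum.delta' cong: if_cong)

lemma mat_commutes: "mat c ** A = A ** mat c" for A :: "'k::field^'n^'n"
  by (simp add: matrix_eq mat_mult_vector matrix_vector_ring(6) flip: matrix_vector_mul_assoc)

lemma mat_ring: "mat (a + b) = (mat a + mat b :: 'k::field^'n^'n)" "mat (a * b) = (mat a ** mat b :: 'k^'n^'n)"
  "mat 0 = (0 :: 'k^'n^'n)" "mat (- a) = (- mat a :: 'k^'n^'n)"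
  by (simp_all add: matrix_eq mat_mult_vector matrix_vector_ring vec.scale_left_distrib)

lemma smult_mat_eq: "smult_mat c a = mat c ** (a :: 'k::field^'n^'n)"
proof -
  have "smult_mat c a *v v = c *s (a *v v)" for v
    by (simp add: vec_eq_iff smult_mat_def matrix_vector_mult_def sum_distrib_left mult.assoc)
  then show ?thesis
    by (simp add: matrix_eq mat_mult_vector flip: matrix_vector_mul_assoc)
qed

text \<open>Horner evaluation at a matrix: a constant \<open>c\<close> becomes the scalar matrix
  \<open>mat c\<close>, and the values at \<open>b\<close> make up \<open>Fbeta b\<close>.\<close>

definition pev :: "'k::field poly \<Rightarrow> 'k^'n^'n \<Rightarrow> 'k^'n^'n" where
  "pev f a = fold_coeffs (\<lambda>c y. mat c + a ** y) f 0"

lemma pev_0 [simp]: "pev 0 a = 0"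
  by (simp add: pev_def)

lemma pev_pCons [simp]: "pev (pCons c f) a = mat c + a ** pev f a"
  by (cases "c = 0 \<and> f = 0") (auto simp: pev_def mat_ring matrix_mult_ring)

lemma pev_add: "pev (f + g) a = pev f a + pev g a"
  by (induction f g rule: poly_induct2) (simp_all add: mat_ring matrix_mult_ring)

lemma pev_smult: "pev (smult c f) a = mat c ** pev f a"
  by (induction f) (simp_all add: mat_ring matrix_mult_ring, metis mat_commutes)

lemma pev_uminus: "pev (- f) a = - pev f a"
  using pev_smult[of "-1" f a] by (simp add: mat_ring matrix_mult_ring)

lemma pev_diff: "pev (f - g) a = pev f a - pev g a"
  using pev_add[of f "- g" a] by (simp add: pev_uminus)

lemma pev_mult: "pev (f * g) a = pev f a ** pev g a"
  by (induction f) (simp_all add: pev_add pev_smult matrix_mult_ring)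

lemma pev_one [simp]: "pev 1 a = mat 1"
  by (simp add: one_pCons matrix_mult_ring)

lemma pev_const: "pev [:c:] a = mat c"
  by (simp add: matrix_mult_ring)

lemma pev_X: "pev [:0, 1:] a = a"
  by (simp add: mat_ring matrix_mult_ring)

lemma pev_commute: "pev f a ** pev g a = pev g a ** pev f a"
  by (metis mult.commute pev_mult)

lemma pev_sum: "pev (sum f I) a = (\<Sum>i\<in>I. pev (f i) a)"
  by (induction I rule: infinite_finite_induct) (simp_all add: pev_add)

lemma pev_monom: "pev (monom c i) a = mat c ** mpow a i"
proof (induction i)
  case (Suc i)
  then show ?case
    by (simp add: monom_Suc mat_ring matrix_mult_ring mat_commutes[of c a])
qed (simp add: matrix_mult_ring monom_0)

lemma pev_as_sum: "degree f < m \<Longrightarrow> pev f a = (\<Sum>i<m. smult_mat (coeff f i) (mpow a i))"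
  by (subst poly_as_sum_of_monoms'[of f "m - 1", symmetric])
     (auto simp: pev_sum pev_monom smult_mat_eq lessThan_Suc_atMost[symmetric])

lemma pev_conj:
  fixes g x y :: "'k::field^'n^'n"
  shows "g ** x = y ** g \<Longrightarrow> g ** pev f x = pev f y ** g"
proof (induction f)
  case (pCons c f)
  have "g ** (x ** pev f x) = (g ** x) ** pev f x" by (simp add: matrix_mult_ring)
  also have "\<dots> = y ** (g ** pev f x)" by (simp add: pCons.prems matrix_mult_ring)
  also have "g ** pev f x = pev f y ** g" using pCons by blast
  also have "y ** (pev f y ** g) = y ** pev f y ** g" by (simp add: matrix_mult_ring)
  finally show ?case by (simp add: matrix_mult_ring mat_commutes)
qed (simp add: matrix_mult_ring)

lemma Fbeta_eq: "Fbeta b = range (\<lambda>f. pev f b)"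
proof -
  have "pev f b \<in> Fbeta b" for f
    using pev_as_sum[of f "Suc (degree f)" b] unfolding Fbeta_def by blast
  moreover have "(\<Sum>i<m. smult_mat (c i) (mpow b i)) = pev (\<Sum>i<m. monom (c i) i) b" for c and m :: nat
    by (simp add: pev_sum pev_monom smult_mat_eq)
  ultimately show ?thesis
    unfolding Fbeta_def by (auto simp only: image_iff)
qed

lemma independent_family_bound:
  fixes v :: "nat \<Rightarrow> 'k::field^'n"
  assumes z: "\<And>c i. (\<Sum>i<m. c i *s v i) = 0 \<Longrightarrow> i < m \<Longrightarrow> c i = 0"
  shows "m \<le> vec.dim (UNIV :: ('k^'n) set)"
proof -
  have inj: "inj_on v {..<m}"
  proof (rule inj_onI, rule ccontr)
    fix i j assume ij: "i \<in> {..<m}" "j \<in> {..<m}" "v i = v j" "i \<noteq> j"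
    \<comment> \<open>Equal vectors at two indices would give the relation with coefficients 1 and
      -1.\<close>
    have "(\<Sum>k<m. (if k = i then 1 else if k = j then -1 else 0) *s v k)
        = (\<Sum>k<m. (if k = i then v i else 0) - (if k = j then v i else 0))"
      by (rule sum.cong) (use ij in auto)
    also have "\<dots> = 0" using ij by (simp add: sum_subtractf)
    finally show False using z[of "\<lambda>k. if k = i then 1 else if k = j then -1 else 0" i] ij by simp
  qed
  have "vec.independent (v ` {..<m})"
  proof (rule vec.independent_if_scalars_zero)
    fix f u assume f: "(\<Sum>u\<in>v ` {..<m}. f u *s u) = 0" and u: "u \<in> v ` {..<m}"
    have "(\<Sum>i<m. f (v i) *s v i) = 0" using f by (simp add: sum.reindex[OF inj])
    then show "f u = 0" using z[of "\<lambda>i. f (v i)"] u by auto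
  qed simp
  then have "card (v ` {..<m}) \<le> vec.dim (UNIV :: ('k^'n) set)"
    by (rule vec.independent_card_le_dim[rotated]) simp
  then show ?thesis by (simp add: card_image[OF inj])
qed

section \<open>Lattice sequences and the filtration they induce\<close>

text \<open>The period \<open>e\<close> is a parameter so that two sequences can share it. Finite
  generation is replaced by two of its consequences: the members exhaust the space
  (\<open>L_exh\<close>), and every linear functional is small on deep members
  (\<open>L_bdd\<close>). All of this passes to preimages under an invertible matrix.\<close>

locale latseq =
  fixes val :: "'k::field \<Rightarrow> int" and e :: int and \<Lambda> :: "int \<Rightarrow> ('k^'n) set"
  assumes dv: "discrete_valuation val" and e_pos: "0 < e"
    and L_zero: "0 \<in> \<Lambda> s"
    and L_add: "v \<in> \<Lambda> s \<Longrightarrow> w \<in> \<Lambda> s \<Longrightarrow> v + w \<in> \<Lambda> s"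
    and L_step: "\<Lambda> (s + 1) \<subseteq> \<Lambda> s"
    and L_scale: "c \<noteq> 0 \<Longrightarrow> c *s v \<in> \<Lambda> (s + e * val c) \<longleftrightarrow> v \<in> \<Lambda> s"
    and L_exh: "\<exists>s. v \<in> \<Lambda> s"
    and L_bdd: "Vector_Spaces.linear (*s) (*) \<phi> \<Longrightarrow> \<exists>N. \<forall>v\<in>\<Lambda> N. pin val 1 (\<phi> v)"
begin

lemma L_anti: "s \<le> t \<Longrightarrow> \<Lambda> t \<subseteq> \<Lambda> s"
proof -
  have "\<Lambda> (s + int n) \<subseteq> \<Lambda> s" for n
  proof (induction n)
    case (Suc n)
    then show ?case using L_step[of "s + int n"] by (auto simp: algebra_simps)
  qed simp
  from this[of "nat (t - s)"] show "s \<le> t \<Longrightarrow> \<Lambda> t \<subseteq> \<Lambda> s" by simp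
qed

lemma L_mono: "v \<in> \<Lambda> t \<Longrightarrow> s \<le> t \<Longrightarrow> v \<in> \<Lambda> s"
  using L_anti by blast

lemma L_int: "pin val 0 c \<Longrightarrow> v \<in> \<Lambda> s \<Longrightarrow> c *s v \<in> \<Lambda> s"
  using L_scale[of c v s] L_anti[of s "s + e * val c"] e_pos L_zero
  by (cases "c = 0") (auto simp: pin_def)

lemma L_uminus: "v \<in> \<Lambda> s \<Longrightarrow> - v \<in> \<Lambda> s"
  using L_int[of "-1" v s] pin_uminus[OF dv, of 0 1] pin_one[OF dv, of 0] by simp

lemma L_diff: "v \<in> \<Lambda> s \<Longrightarrow> w \<in> \<Lambda> s \<Longrightarrow> v - w \<in> \<Lambda> s"
  using L_add[of v s "- w"] L_uminus by simp

lemma L_add_cancel: "w \<in> \<Lambda> s \<Longrightarrow> v + w \<in> \<Lambda> s \<longleftrightarrow> v \<in> \<Lambda> s"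
  using L_add L_diff by fastforce

lemma L_sum: "(\<And>i. i \<in> I \<Longrightarrow> f i \<in> \<Lambda> s) \<Longrightarrow> sum f I \<in> \<Lambda> s"
  by (induction I rule: infinite_finite_induct) (auto intro: L_zero L_add)

text \<open>A functional that is 1 at \<open>v\<close> and 0 on \<open>W\<close> is constantly 1 on
  the coset of \<open>v\<close>, whereas it takes values in the maximal ideal on a deep
  lattice.\<close>

lemma L_bdd_away:
  assumes W: "vec.subspace W" and v: "v \<notin> W"
  shows "\<exists>N. \<forall>w\<in>W. v + w \<notin> \<Lambda> N"
proof -
  obtain \<phi> where \<phi>: "Vector_Spaces.linear (*s) (*) \<phi>" "\<phi> v = 1" "\<forall>w\<in>W. \<phi> w = 0"
    using vec.separating_functional[OF W v] by blast
  interpret l: Vector_Spaces.linear "(*s)" "(*)" \<phi> by (rule \<phi>(1))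
  obtain N where N: "\<forall>v\<in>\<Lambda> N. pin val 1 (\<phi> v)"
    using L_bdd[OF \<phi>(1)] by blast
  have "\<phi> (v + w) = 1" if "w \<in> W" for w
    using \<phi>(2,3) that by (simp add: l.add)
  then show ?thesis
    using N pin_one[OF dv, of 1] by fastforce
qed

lemma L_separated: "v \<noteq> 0 \<Longrightarrow> \<exists>N. v \<notin> \<Lambda> N"
  using L_bdd_away[of "{0}" v] by auto

lemma L_separated_eq: "(\<And>N. v \<in> \<Lambda> N) \<Longrightarrow> v = 0"
  using L_separated by blast

text \<open>Best approximation by \<open>W\<close>: the levels met by the coset of \<open>v\<close>
  are bounded by \<open>L_bdd_away\<close>, and being integers they attain their maximum.\<close>

lemma L_max_level:
  assumes W: "vec.subspace W" and v: "v \<notin> W"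
  shows "\<exists>s. \<exists>w\<in>W. v + w \<in> \<Lambda> s \<and> (\<forall>w'\<in>W. v + w' \<notin> \<Lambda> (s + 1))"
proof -
  obtain N where N: "\<And>w. w \<in> W \<Longrightarrow> v + w \<notin> \<Lambda> N"
    using L_bdd_away[OF W v] by blast
  obtain s0 where s0: "v \<in> \<Lambda> s0" using L_exh by blast
  have z: "0 \<in> W" using W by (simp add: vec.subspace_0)
  define m where "m = (LEAST m::nat. \<forall>w\<in>W. v + w \<notin> \<Lambda> (s0 + int m))"
  have "s0 \<le> N"
    using N[OF z] s0 L_anti[of N s0] by fastforce
  then have ex: "\<forall>w\<in>W. v + w \<notin> \<Lambda> (s0 + int (nat (N - s0)))"
    using N by auto
  then have m: "\<forall>w\<in>W. v + w \<notin> \<Lambda> (s0 + int m)"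
    unfolding m_def by (rule LeastI)
  then have "m \<noteq> 0" using s0 z by (metis add.right_neutral int_ops(1))
  then obtain k where k: "m = Suc k" by (cases m) auto
  then have "k < m" by simp
  then have "\<not> (\<forall>w\<in>W. v + w \<notin> \<Lambda> (s0 + int k))"
    unfolding m_def by (rule not_less_Least)
  then obtain w where w: "w \<in> W" "v + w \<in> \<Lambda> (s0 + int k)" by blast
  have eq: "s0 + int k + 1 = s0 + int m" using k by simp
  have "\<forall>w\<in>W. v + w \<notin> \<Lambda> (s0 + int k + 1)" unfolding eq by (rule m)
  then show ?thesis using w by blast
qed

lemma filt_iff: "a \<in> filt \<Lambda> n \<longleftrightarrow> (\<forall>s v. v \<in> \<Lambda> s \<longrightarrow> a *v v \<in> \<Lambda> (s + n))"
  by (auto simp: filt_def)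

lemma filtD: "a \<in> filt \<Lambda> n \<Longrightarrow> v \<in> \<Lambda> s \<Longrightarrow> t = s + n \<Longrightarrow> a *v v \<in> \<Lambda> t"
  by (auto simp: filt_iff)

lemma filt_mono: "a \<in> filt \<Lambda> n \<Longrightarrow> m \<le> n \<Longrightarrow> a \<in> filt \<Lambda> m"
  unfolding filt_iff using L_mono by (meson add_left_mono)

lemma filt_add: "a \<in> filt \<Lambda> n \<Longrightarrow> b \<in> filt \<Lambda> n \<Longrightarrow> a + b \<in> filt \<Lambda> n"
  unfolding filt_iff by (auto simp: matrix_vector_ring intro: L_add)

lemma filt_diff: "a \<in> filt \<Lambda> n \<Longrightarrow> b \<in> filt \<Lambda> n \<Longrightarrow> a - b \<in> filt \<Lambda> n"
  unfolding filt_iff by (auto simp: matrix_vector_ring intro: L_diff)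

lemma filt_uminus: "a \<in> filt \<Lambda> n \<Longrightarrow> - a \<in> filt \<Lambda> n"
  unfolding filt_iff by (auto simp: matrix_vector_ring intro: L_uminus)

lemma filt_zero: "0 \<in> filt \<Lambda> n"
  unfolding filt_iff by (auto intro: L_zero)

lemma filt_sum: "(\<And>i. i \<in> I \<Longrightarrow> f i \<in> filt \<Lambda> n) \<Longrightarrow> sum f I \<in> filt \<Lambda> n"
  by (induction I rule: infinite_finite_induct) (auto intro: filt_zero filt_add)

lemma filt_mult: "a \<in> filt \<Lambda> n \<Longrightarrow> b \<in> filt \<Lambda> m \<Longrightarrow> a ** b \<in> filt \<Lambda> (n + m)"
  unfolding filt_iff by (auto simp: matrix_vector_ring) (metis add.assoc add.commute)

lemma filt_mult_le: "a \<in> filt \<Lambda> n \<Longrightarrow> b \<in> filt \<Lambda> m \<Longrightarrow> k \<le> n + m \<Longrightarrow> a ** b \<in> filt \<Lambda> k"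
  using filt_mult filt_mono by blast

lemma filt_mat: "c \<noteq> 0 \<Longrightarrow> mat c \<in> filt \<Lambda> (e * val c)"
  unfolding filt_iff by (simp add: mat_mult_vector L_scale)

lemma filt_mat_int: "pin val 0 c \<Longrightarrow> mat c \<in> filt \<Lambda> 0"
  unfolding filt_iff by (simp add: mat_mult_vector L_int)

lemma filt_one: "mat 1 \<in> filt \<Lambda> 0"
  unfolding filt_iff by simp

lemma filt_diff_trans: "a - b \<in> filt \<Lambda> n \<Longrightarrow> b - c \<in> filt \<Lambda> n \<Longrightarrow> a - c \<in> filt \<Lambda> n"
  using filt_add[of "a - b" n "b - c"] by simp

lemma filt_diff_sym: "a - b \<in> filt \<Lambda> n \<Longrightarrow> b - a \<in> filt \<Lambda> n"
  using filt_uminus[of "a - b" n] by simp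

lemma filt_congr: "a - b \<in> filt \<Lambda> n \<Longrightarrow> a \<in> filt \<Lambda> n \<longleftrightarrow> b \<in> filt \<Lambda> n"
  using filt_diff[of a n "a - b"] filt_add[of "a - b" n b] by auto

lemma filt_separated: "(\<And>n. a \<in> filt \<Lambda> n) \<Longrightarrow> a = 0"
proof -
  assume a: "\<And>n. a \<in> filt \<Lambda> n"
  have "a *v v = 0" for v
  proof (rule L_separated_eq)
    fix N
    obtain s where "v \<in> \<Lambda> s" using L_exh by blast
    then show "a *v v \<in> \<Lambda> N" using a[of "N - s"] filtD by fastforce
  qed
  then show "a = 0" by (simp add: matrix_eq)
qed

text \<open>Normalizing elements of valuation \<open>n\<close>: by \<open>sh_iff_image\<close>, each
  lattice is mapped onto the one \<open>n\<close> steps further. The inverse is built into the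
  condition so that products and inverses are formal.\<close>

definition sh :: "int \<Rightarrow> 'k^'n^'n \<Rightarrow> bool" where
  "sh n a \<longleftrightarrow> a \<in> filt \<Lambda> n \<and> (\<exists>a'\<in>filt \<Lambda> (- n). a ** a' = mat 1 \<and> a' ** a = mat 1)"

lemma sh_filt: "sh n a \<Longrightarrow> a \<in> filt \<Lambda> n"
  by (simp add: sh_def)

lemma sh_inv:
  assumes "sh n a"
  obtains a' where "sh (- n) a'" "a ** a' = mat 1" "a' ** a = mat 1"
  using assms unfolding sh_def by fastforce

lemma sh_mult:
  assumes "sh n a" "sh m b"
  shows "sh (n + m) (a ** b)"
proof -
  obtain a' where a': "a' \<in> filt \<Lambda> (- n)" "a ** a' = mat 1" "a' ** a = mat 1"
    using assms(1) unfolding sh_def by auto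
  obtain b' where b': "b' \<in> filt \<Lambda> (- m)" "b ** b' = mat 1" "b' ** b = mat 1"
    using assms(2) unfolding sh_def by auto
  have "a ** b ** (b' ** a') = a ** (b ** b') ** a'" "b' ** a' ** (a ** b) = b' ** (a' ** a) ** b"
    by (simp_all add: matrix_mult_ring)
  then have "a ** b ** (b' ** a') = mat 1" "b' ** a' ** (a ** b) = mat 1"
    using a' b' by (simp_all add: matrix_mult_ring)
  moreover have "b' ** a' \<in> filt \<Lambda> (- (n + m))"
    by (rule filt_mult_le[OF b'(1) a'(1)]) simp
  ultimately show ?thesis
    using filt_mult[OF sh_filt[OF assms(1)] sh_filt[OF assms(2)]] unfolding sh_def by blast
qed

lemma sh_one: "sh 0 (mat 1)"
  unfolding sh_def using filt_one by (auto simp: matrix_mult_ring intro!: bexI[of _ "mat 1"])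

lemma sh_mat: "c \<noteq> 0 \<Longrightarrow> sh (e * val c) (mat c)"
  unfolding sh_def
  using filt_mat[of c] filt_mat[of "inverse c"] discrete_valuation_inverse[OF dv, of c]
  by (auto intro!: bexI[of _ "mat (inverse c)"] simp flip: mat_ring(2))

lemma sh_filt_cancel:
  assumes "sh n a" "a ** b \<in> filt \<Lambda> m"
  shows "b \<in> filt \<Lambda> (m - n)"
proof -
  obtain a' where a': "a' \<in> filt \<Lambda> (- n)" "a' ** a = mat 1"
    using assms(1) unfolding sh_def by auto
  have "a' ** (a ** b) = (a' ** a) ** b" by (rule matrix_mul_assoc)
  then have "a' ** (a ** b) = b" using a' by (simp add: matrix_mult_ring)
  then show ?thesis using filt_mult[OF a'(1) assms(2)] by simp
qed

lemma sh_cancel: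
  assumes "sh n a" "a *v v \<in> \<Lambda> s"
  shows "v \<in> \<Lambda> (s - n)"
proof -
  obtain a' where a': "a' \<in> filt \<Lambda> (- n)" "a' ** a = mat 1"
    using assms(1) unfolding sh_def by auto
  have "a' *v (a *v v) = v" using a' by (simp flip: matrix_vector_ring(5))
  then show ?thesis using filtD[OF a'(1) assms(2)] by simp
qed

lemma nontrivial_jump: "\<exists>s v. v \<in> \<Lambda> s \<and> v \<notin> \<Lambda> (s + 1)"
proof -
  obtain v :: "'k^'n" where "v \<notin> {0}"
    by (metis axis_eq_0_iff singletonD zero_neq_one)
  then show ?thesis
    using L_max_level[of "{0}" v] by auto
qed

lemma sh_le: "sh n a \<Longrightarrow> a \<in> filt \<Lambda> m \<Longrightarrow> m \<le> n"
proof (rule ccontr)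
  assume a: "sh n a" "a \<in> filt \<Lambda> m" and "\<not> m \<le> n"
  obtain s v where v: "v \<in> \<Lambda> s" "v \<notin> \<Lambda> (s + 1)" using nontrivial_jump by blast
  have "v \<in> \<Lambda> (s + m - n)" using sh_cancel[OF a(1) filtD[OF a(2) v(1) refl]] .
  then show False using v(2) L_mono[of v "s + m - n" "s + 1"] \<open>\<not> m \<le> n\<close> by simp
qed

lemma sh_unique: "sh n a \<Longrightarrow> sh m a \<Longrightarrow> n = m"
  using sh_le sh_filt by (meson antisym)

lemma sh_nonzero: "sh n a \<Longrightarrow> a \<noteq> 0"
  using sh_le[of n 0 "n + 1"] filt_zero by auto

text \<open>Separatedness makes \<open>mat 1 + m\<close> injective, hence invertible in finite
  dimension. The inverse is bounded by iterating \<open>y = v - m y\<close>, so no geometric series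
  has to be summed.\<close>

lemma unipotent_inverse:
  assumes m: "m \<in> filt \<Lambda> 1"
  shows "sh 0 (mat 1 + m)"
proof -
  have ker: "v = 0" if "(mat 1 + m) *v v = 0" for v
  proof (rule L_separated_eq)
    fix N
    obtain s where s: "v \<in> \<Lambda> s" using L_exh by blast
    have eq: "v = - (m *v v)" using that by (simp add: matrix_vector_ring eq_neg_iff_add_eq_0)
    have "v \<in> \<Lambda> (s + int k)" for k
    proof (induction k)
      case (Suc k)
      then have "- (m *v v) \<in> \<Lambda> (s + int (Suc k))" by (intro L_uminus filtD[OF m Suc]) simp
      then show ?case by (metis eq)
    qed (simp add: s)
    from this[of "nat (N - s)"] show "v \<in> \<Lambda> N" by (rule L_mono) simp
  qed
  have "\<exists>b. b ** (mat 1 + m) = mat 1"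
    unfolding matrix_left_invertible_ker using ker by blast
  then obtain b where b: "b ** (mat 1 + m) = mat 1" ..
  then have b': "(mat 1 + m) ** b = mat 1" by (rule matrix_left_right_inverse[THEN iffD1])
  have "b *v v \<in> \<Lambda> s" if v: "v \<in> \<Lambda> s" for v s
  proof -
    define y where "y = b *v v"
    obtain t where t: "y \<in> \<Lambda> t" using L_exh by blast
    have eq: "y = v - m *v y"
    proof -
      have "(mat 1 + m) *v y = v" unfolding y_def using b' by (simp flip: matrix_vector_ring(5))
      then show ?thesis by (simp add: matrix_vector_ring algebra_simps)
    qed
    \<comment> \<open>Each use of \<open>y = v - m y\<close> raises the known level of
      \<open>y\<close> by one, until the level \<open>s\<close> of \<open>v\<close> caps it.\<close>
    have "y \<in> \<Lambda> (min s (t + int k))" for k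
    proof (induction k)
      case 0
      show ?case using L_mono[OF t] by simp
    next
      case (Suc k)
      have "m *v y \<in> \<Lambda> (min s (t + int (Suc k)))"
        using filtD[OF m Suc refl] by (rule L_mono) auto
      moreover have "v \<in> \<Lambda> (min s (t + int (Suc k)))" using v by (rule L_mono) simp
      ultimately have "v - m *v y \<in> \<Lambda> (min s (t + int (Suc k)))" by (rule L_diff[rotated])
      then show ?case by (metis eq)
    qed
    from this[of "nat (s - t)"] show ?thesis unfolding y_def by (rule L_mono) auto
  qed
  then have "b \<in> filt \<Lambda> 0" by (simp add: filt_iff)
  moreover have "mat 1 + m \<in> filt \<Lambda> 0" using filt_add[OF filt_one filt_mono[OF m]] by simp
  ultimately show ?thesis unfolding sh_def using b b' by auto
qed

lemma sh_perturb:
  assumes "sh n a" "b - a \<in> filt \<Lambda> (n + 1)"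
  shows "sh n b"
proof -
  obtain a' where a': "sh (- n) a'" "a ** a' = mat 1" using sh_inv[OF assms(1)] by blast
  have "a' ** (b - a) \<in> filt \<Lambda> 1"
    using filt_mult[OF sh_filt[OF a'(1)] assms(2)] by simp
  then have "sh 0 (mat 1 + a' ** (b - a))" by (rule unipotent_inverse)
  from sh_mult[OF assms(1) this] have "sh n (a ** (mat 1 + a' ** (b - a)))" by simp
  moreover have "a ** (mat 1 + a' ** (b - a)) = a + (a ** a') ** (b - a)"
    by (simp add: matrix_mult_ring)
  ultimately show ?thesis using a'(2) by (simp add: matrix_mult_ring)
qed

lemma sh_iff_image: "sh n a \<longleftrightarrow> (\<exists>a'. a ** a' = mat 1) \<and> (\<forall>s. (\<lambda>v. a *v v) ` \<Lambda> s = \<Lambda> (s + n))"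
proof
  assume a: "sh n a"
  obtain a' where a': "sh (- n) a'" "a ** a' = mat 1" using sh_inv[OF a] by blast
  have "v \<in> (\<lambda>v. a *v v) ` \<Lambda> s" if "v \<in> \<Lambda> (s + n)" for v s
    using filtD[OF sh_filt[OF a'(1)] that, of s] a'(2)
    by (intro image_eqI[of _ _ "a' *v v"]) (simp_all flip: matrix_vector_ring(5))
  then show "(\<exists>a'. a ** a' = mat 1) \<and> (\<forall>s. (\<lambda>v. a *v v) ` \<Lambda> s = \<Lambda> (s + n))"
    using a' filtD[OF sh_filt[OF a]] by blast
next
  assume a: "(\<exists>a'. a ** a' = mat 1) \<and> (\<forall>s. (\<lambda>v. a *v v) ` \<Lambda> s = \<Lambda> (s + n))"
  then obtain a' where a': "a ** a' = mat 1" by blast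
  then have a'': "a' ** a = mat 1" by (rule matrix_left_right_inverse[THEN iffD1])
  have "a' *v v \<in> \<Lambda> (s + - n)" if "v \<in> \<Lambda> s" for v s
  proof -
    have "v \<in> (\<lambda>v. a *v v) ` \<Lambda> (s - n)" using a that by simp
    then obtain u where "u \<in> \<Lambda> (s - n)" "v = a *v u" by blast
    then show ?thesis using a'' by (simp flip: matrix_vector_ring(5))
  qed
  moreover have "a \<in> filt \<Lambda> n" using a by (auto simp: filt_def)
  ultimately show "sh n a" unfolding sh_def using a' a'' by (auto simp: filt_iff)
qed

end

section \<open>Approximate field structures on a lattice sequence\<close>

text \<open>The polynomials of degree less than \<open>degree P\<close>, evaluated at \<open>x\<close>, behave up to higher filtration
  terms like the elements of the valued field \<open>F[X]/P\<close> with valuation \<open>w\<close>.\<close>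

locale apx = latseq val e \<Lambda>
  for val :: "'k::field \<Rightarrow> int" and e and \<Lambda> :: "int \<Rightarrow> ('k^'n) set" +
  fixes x :: "'k^'n^'n" and P :: "'k poly" and w :: "'k poly \<Rightarrow> int"
  assumes P_monic: "lead_coeff P = 1" and P_deg: "0 < degree P"
    and x_sh: "f \<noteq> 0 \<Longrightarrow> degree f < degree P \<Longrightarrow> sh (w f) (pev f x)"
    and x_mult: "f \<noteq> 0 \<Longrightarrow> g \<noteq> 0 \<Longrightarrow> degree f < degree P \<Longrightarrow> degree g < degree P \<Longrightarrow>
      pev f x ** pev g x - pev ((f * g) mod P) x \<in> filt \<Lambda> (w f + w g + 1)"
begin

lemma P_nonzero: "P \<noteq> 0"
  using P_deg by auto

lemma mod_deg: "degree (h mod P) < degree P"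
  using degree_mod_less[OF P_nonzero, of h] P_deg by auto

lemma w_le_iff: "degree f < degree P \<Longrightarrow> pev f x \<in> filt \<Lambda> n \<longleftrightarrow> f = 0 \<or> n \<le> w f"
  using x_sh[of f] by (cases "f = 0") (auto intro: filt_zero filt_mono[OF sh_filt] dest: sh_le)

lemma w_eqI: "degree f < degree P \<Longrightarrow> sh n (pev f x) \<Longrightarrow> f \<noteq> 0 \<and> w f = n"
  using x_sh[of f] sh_unique sh_nonzero by (metis pev_0)

lemma mult_mod:
  assumes "f \<noteq> 0" "g \<noteq> 0" "degree f < degree P" "degree g < degree P"
  shows "(f * g) mod P \<noteq> 0" "w ((f * g) mod P) = w f + w g"
proof -
  have "sh (w f + w g) (pev ((f * g) mod P) x)"
    by (rule sh_perturb[OF sh_mult[OF x_sh[OF assms(1,3)] x_sh[OF assms(2,4)]] filt_diff_sym[OF x_mult[OF assms]]])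
  from w_eqI[OF mod_deg this] show "(f * g) mod P \<noteq> 0" "w ((f * g) mod P) = w f + w g"
    by simp_all
qed

lemma w_one: "w 1 = 0"
  using w_eqI[of 1 0] P_deg sh_one by simp

lemma w_smult: "c \<noteq> 0 \<Longrightarrow> f \<noteq> 0 \<Longrightarrow> degree f < degree P \<Longrightarrow> w (smult c f) = e * val c + w f"
  using w_eqI[of "smult c f"] sh_mult[OF sh_mat[of c] x_sh[of f]] by (auto simp: pev_smult)

text \<open>Euclidean descent on the degree. The remainder of \<open>P\<close> by \<open>f\<close>
  cannot vanish, because products of nonzero polynomials of small degree stay nonzero modulo
  \<open>P\<close>; an inverse of the remainder then yields one of \<open>f\<close>. Additivity of
  \<open>w\<close> forces the weight of the inverse.\<close>

lemma field_inverse: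
  assumes "f \<noteq> 0" "degree f < degree P"
  shows "\<exists>f'. f' \<noteq> 0 \<and> degree f' < degree P \<and> (f * f') mod P = 1 \<and> w f' = - w f"
proof -
  have "\<exists>f'. (f * f') mod P = 1" using assms
  proof (induction "degree f" arbitrary: f rule: less_induct)
    case less
    show ?case
    proof (cases "degree f = 0")
      case True
      then obtain c where c: "f = [:c:]" using degree_eq_zeroE by blast
      then have "f * [:inverse c:] = 1" using less.prems by (simp add: one_pCons)
      then show ?thesis using P_deg by (intro exI[of _ "[:inverse c:]"]) (simp add: mod_poly_less)
    next
      case False
      define q r where "q = P div f" and "r = P mod f"
      have P: "P = q * f + r" by (simp add: q_def r_def)
      have "degree q < degree P"
        using False less.prems by (simp add: q_def degree_div_less)
      have "r \<noteq> 0"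
      proof
        assume "r = 0"
        then have "q \<noteq> 0" "(q * f) mod P = 0" using P P_nonzero by auto
        then show False using mult_mod(1)[of q f] less.prems \<open>degree q < degree P\<close> by simp
      qed
      have "degree r < degree f"
        using degree_mod_less[OF less.prems(1), of P] \<open>r \<noteq> 0\<close> by (simp add: r_def)
      then obtain r' where r': "(r * r') mod P = 1"
        using less.hyps[of r] \<open>r \<noteq> 0\<close> less.prems by auto
      have "f * (- (q * r')) = r * r' - P * r'" unfolding P by (simp add: algebra_simps)
      then have "(f * (- (q * r'))) mod P = (r * r' - P * r') mod P" by simp
      also have "\<dots> = 1" using r' by (simp add: poly_mod_diff_left)
      finally show ?thesis by blast
    qed
  qed
  then obtain f' where f': "(f * f') mod P = 1" by blast
  define g where "g = f' mod P"
  have g: "(f * g) mod P = 1" using f' by (simp add: g_def mod_mult_right_eq)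
  have "g \<noteq> 0" using g P_deg by auto
  have gd: "degree g < degree P" by (simp add: g_def mod_deg)
  have "w ((f * g) mod P) = w f + w g" using mult_mod assms \<open>g \<noteq> 0\<close> gd by blast
  then have "w g = - w f" using g w_one by simp
  then show ?thesis using g \<open>g \<noteq> 0\<close> gd by blast
qed

section \<open>Splitting bases over an approximate field\<close>

definition comb :: "nat \<Rightarrow> (nat \<Rightarrow> 'k^'n) \<Rightarrow> (nat \<Rightarrow> 'k poly) \<Rightarrow> 'k^'n" where
  "comb m v F = (\<Sum>i<m. pev (F i) x *v v i)"

text \<open>Orthogonality for the norm given by the lattice sequence: a combination can lie no
  deeper than the levels \<open>w (F i) + l i\<close> of its nonzero terms allow, so there is no
  cancellation between terms.\<close>

definition split :: "nat \<Rightarrow> (nat \<Rightarrow> 'k^'n) \<Rightarrow> (nat \<Rightarrow> int) \<Rightarrow> bool" where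
  "split m v l \<longleftrightarrow> (\<forall>i<m. v i \<in> \<Lambda> (l i)) \<and>
     (\<forall>F s. (\<forall>i<m. degree (F i) < degree P) \<longrightarrow> comb m v F \<in> \<Lambda> s \<longrightarrow>
            (\<forall>i<m. F i = 0 \<or> s \<le> w (F i) + l i))"

lemma splitD:
  assumes "split m v l" "\<And>i. i < m \<Longrightarrow> degree (F i) < degree P" "comb m v F \<in> \<Lambda> s" "i < m"
  shows "F i = 0 \<or> s \<le> w (F i) + l i"
  using assms unfolding split_def by blast

lemma comb_add: "comb m v (\<lambda>i. F i + G i) = comb m v F + comb m v G"
  by (simp add: comb_def pev_add matrix_vector_ring sum.distrib)

lemma comb_diff: "comb m v (\<lambda>i. F i - G i) = comb m v F - comb m v G"
  by (simp add: comb_def pev_diff matrix_vector_ring sum_subtractf)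

lemma comb_smult: "comb m v (\<lambda>i. smult c (F i)) = c *s comb m v F"
  by (simp add: comb_def pev_smult matrix_vector_ring mat_mult_vector vec.scale_sum_right)

lemma split_zero:
  assumes "split m v l" "\<And>i. i < m \<Longrightarrow> degree (F i) < degree P" "comb m v F = 0" "i < m"
  shows "F i = 0"
proof -
  have "F i = 0 \<or> w (F i) + l i + 1 \<le> w (F i) + l i"
    by (rule splitD[OF assms(1,2)]) (use assms L_zero in auto)
  then show ?thesis by simp
qed

lemma split_unique:
  assumes "split m v l" "\<And>i. i < m \<Longrightarrow> degree (F i) < degree P" "\<And>i. i < m \<Longrightarrow> degree (G i) < degree P"
    "comb m v F = comb m v G" "i < m"
  shows "F i = G i"
  using split_zero[OF assms(1), of "\<lambda>i. F i - G i"] assms by (simp add: comb_diff degree_diff_less)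

text \<open>Constant polynomials as coefficients show that the vectors are linearly independent over
  the base field.\<close>

lemma split_bound:
  assumes "split m v l"
  shows "m \<le> vec.dim (UNIV :: ('k^'n) set)"
proof -
  have z: "c i = 0" if "(\<Sum>i<m. c i *s v i) = 0" "i < m" for c i
    using split_zero[OF assms, of "\<lambda>i. [:c i:]" i] that P_deg
    by (simp add: comb_def pev_const mat_mult_vector del: pev_pCons)
  then show ?thesis using independent_family_bound by blast
qed

text \<open>Change \<open>u\<close> by the span \<open>W\<close> of the family to a vector
  \<open>u'\<close> of maximal level \<open>s0\<close>. Since \<open>W\<close> is a subspace over
  the base field and need not be stable under \<open>x\<close>, cancellation against
  \<open>pev G x *v u'\<close> is excluded by multiplying with the approximate inverse of
  \<open>G\<close>: this would yield a vector of the coset of \<open>u'\<close> beyond level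
  \<open>s0\<close>.\<close>

lemma split_extend:
  assumes sp: "split m v l" and u: "\<And>F. (\<forall>i<m. degree (F i) < degree P) \<Longrightarrow> u \<noteq> comb m v F"
  shows "\<exists>v' l'. split (Suc m) v' l'"
proof -
  define W where "W = {comb m v F |F. \<forall>i<m. degree (F i) < degree P}"
  have W: "vec.subspace W"
  proof (rule vec.subspaceI)
    show "0 \<in> W" unfolding W_def using P_deg by (auto simp: comb_def intro!: exI[of _ "\<lambda>_. 0"])
    show "a + b \<in> W" if ab: "a \<in> W" "b \<in> W" for a b
    proof -
      obtain F G where "a = comb m v F" "b = comb m v G"
        "\<forall>i<m. degree (F i) < degree P" "\<forall>i<m. degree (G i) < degree P"
        using ab unfolding W_def by blast
      then show ?thesis
        unfolding W_def by (auto simp: comb_add degree_add_less intro!: exI[of _ "\<lambda>i. F i + G i"])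
    qed
    show "c *s a \<in> W" if a: "a \<in> W" for c a
    proof -
      obtain F where F: "a = comb m v F" "\<forall>i<m. degree (F i) < degree P"
        using a unfolding W_def by blast
      have "\<forall>i<m. degree (smult c (F i)) < degree P"
        using F(2) by (auto intro: le_less_trans[OF degree_smult_le])
      then show ?thesis
        unfolding W_def F(1) comb_smult[symmetric] by blast
    qed
  qed
  have uW: "u \<notin> W" using u unfolding W_def by blast
  obtain s0 where "\<exists>w\<in>W. u + w \<in> \<Lambda> s0" and max: "\<forall>w'\<in>W. u + w' \<notin> \<Lambda> (s0 + 1)"
    using L_max_level[OF W uW] by auto
  then obtain w0 where w0: "w0 \<in> W" "u + w0 \<in> \<Lambda> s0" by auto
  define u' where "u' = u + w0"
  have max': "u' + w' \<notin> \<Lambda> (s0 + 1)" if "w' \<in> W" for w'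
    using bspec[OF max, of "w0 + w'"] that w0 W by (simp add: u'_def vec.subspace_add add.assoc)
  have key: "s \<le> w G + s0"
    if F: "\<forall>i<m. degree (F i) < degree P" and G: "degree G < degree P" "G \<noteq> 0"
      and c: "comb m v F + pev G x *v u' \<in> \<Lambda> s" for F G s
  proof (rule ccontr)
    assume "\<not> s \<le> w G + s0"
    then have s: "w G + s0 + 1 \<le> s" by simp
    have Gu: "pev G x *v u' \<in> \<Lambda> (w G + s0)"
      by (rule filtD[OF sh_filt[OF x_sh[OF G(2,1)]]]) (use w0 u'_def in auto)
    have "comb m v F \<in> \<Lambda> (w G + s0)"
      using L_mono[OF c, of "w G + s0"] s Gu L_add_cancel by simp
    then have wF: "F i = 0 \<or> w G + s0 \<le> w (F i) + l i" if "i < m" for i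
      using splitD[OF sp _ _ that] F by blast
    obtain G' where G': "G' \<noteq> 0" "degree G' < degree P" "(G * G') mod P = 1" "w G' = - w G"
      using field_inverse[OF G(2,1)] by blast
    have "pev G' x *v (comb m v F + pev G x *v u') \<in> \<Lambda> (s0 + 1)"
      using filtD[OF sh_filt[OF x_sh[OF G'(1,2)]] L_mono[OF c s]] G'(4) by simp
    moreover have "pev G' x *v comb m v F - comb m v (\<lambda>i. (G' * F i) mod P) \<in> \<Lambda> (s0 + 1)"
    proof -
      \<comment> \<open>The deviation from the exact product law gains one level at each
        \<open>v i\<close>, which is just enough to land in
        \<open>\<Lambda> (s0 + 1)\<close>.\<close>
      have "pev G' x *v (pev (F i) x *v v i) - pev ((G' * F i) mod P) x *v v i \<in> \<Lambda> (s0 + 1)"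
        if i: "i < m" for i
      proof (cases "F i = 0")
        case False
        have "pev G' x ** pev (F i) x - pev ((G' * F i) mod P) x \<in> filt \<Lambda> (w G' + w (F i) + 1)"
          using x_mult[OF G'(1) False G'(2)] F i by blast
        moreover have "v i \<in> \<Lambda> (l i)" using sp i unfolding split_def by blast
        ultimately have "(pev G' x ** pev (F i) x - pev ((G' * F i) mod P) x) *v v i
            \<in> \<Lambda> (l i + (w G' + w (F i) + 1))"
          using filtD by blast
        then show ?thesis
          using wF[OF i] False G'(4) by (auto simp: matrix_vector_ring elim!: L_mono)
      qed (simp add: L_zero)
      then have "(\<Sum>i<m. pev G' x *v (pev (F i) x *v v i) - pev ((G' * F i) mod P) x *v v i) \<in> \<Lambda> (s0 + 1)"
        by (intro L_sum) auto
      then show ?thesis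
        by (simp add: comb_def sum_subtractf vec.sum)
    qed
    moreover have "pev G' x *v (pev G x *v u') - u' \<in> \<Lambda> (s0 + 1)"
    proof -
      have "pev G' x ** pev G x - pev ((G' * G) mod P) x \<in> filt \<Lambda> (w G' + w G + 1)"
        by (rule x_mult) (use G G' in auto)
      then have "pev G' x ** pev G x - mat 1 \<in> filt \<Lambda> 1" using G' by (simp add: mult.commute)
      from filtD[OF this w0(2) refl] show ?thesis by (simp add: u'_def[symmetric] matrix_vector_ring)
    qed
    ultimately have "pev G' x *v (comb m v F + pev G x *v u')
        - (pev G' x *v comb m v F - comb m v (\<lambda>i. (G' * F i) mod P))
        - (pev G' x *v (pev G x *v u') - u') \<in> \<Lambda> (s0 + 1)"
      by (rule L_diff[OF L_diff])
    then have "u' + comb m v (\<lambda>i. (G' * F i) mod P) \<in> \<Lambda> (s0 + 1)"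
      by (simp add: matrix_vector_ring algebra_simps)
    moreover have "comb m v (\<lambda>i. (G' * F i) mod P) \<in> W"
      unfolding W_def using mod_deg by blast
    ultimately show False using max' by blast
  qed
  define v' where "v' = v(m := u')"
  define l' where "l' = l(m := s0)"
  have comb': "comb (Suc m) v' F = comb m v F + pev (F m) x *v u'" for F
    by (simp add: comb_def v'_def)
  have "F i = 0 \<or> s \<le> w (F i) + l' i"
    if F: "\<forall>i<Suc m. degree (F i) < degree P" and c: "comb (Suc m) v' F \<in> \<Lambda> s" and i: "i < Suc m" for F s i
  proof -
    have Fm: "F m = 0 \<or> s \<le> w (F m) + s0"
      using key[of F "F m" s] F c by (auto simp: comb')
    have "pev (F m) x *v u' \<in> \<Lambda> s"
    proof (cases "F m = 0")
      case False
      have "pev (F m) x *v u' \<in> \<Lambda> (w (F m) + s0)"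
        by (rule filtD[OF sh_filt[OF x_sh[OF False]]]) (use F w0 u'_def in auto)
      then show ?thesis using Fm False L_mono by blast
    qed (simp add: L_zero)
    then have "comb m v F \<in> \<Lambda> s" using c L_add_cancel by (simp add: comb')
    then have "F i = 0 \<or> s \<le> w (F i) + l i" if "i < m" for i
      using splitD[OF sp _ _ that] F by simp
    then show ?thesis using Fm i by (auto simp: l'_def less_Suc_eq)
  qed
  moreover have "v' i \<in> \<Lambda> (l' i)" if "i < Suc m" for i
    using that sp w0 by (auto simp: v'_def l'_def split_def u'_def less_Suc_eq)
  ultimately have "split (Suc m) v' l'" unfolding split_def by blast
  then show ?thesis by blast
qed

lemma split_basis:
  obtains m v l where "split m v l" "\<And>u. \<exists>F. (\<forall>i. degree (F i) < degree P) \<and> u = comb m v F"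
proof -
  define Q where "Q m \<longleftrightarrow> (\<exists>v l. split m v l)" for m
  have "Q 0" unfolding Q_def split_def by simp
  have b: "m \<le> vec.dim (UNIV :: ('k^'n) set)" if "Q m" for m
    using that split_bound unfolding Q_def by blast
  have "\<exists>m. Q m \<and> \<not> Q (Suc m)"
  proof (rule ccontr)
    assume "\<not> ?thesis"
    then have "Q m" for m by (induction m) (use \<open>Q 0\<close> in auto)
    then show False using b[of "Suc (vec.dim (UNIV :: ('k^'n) set))"] by simp
  qed
  then obtain m v l where sp: "split m v l" and nsp: "\<not> Q (Suc m)" unfolding Q_def by blast
  have "\<exists>F. (\<forall>i. degree (F i) < degree P) \<and> u = comb m v F" for u
  proof -
    obtain F where F: "\<forall>i<m. degree (F i) < degree P" "u = comb m v F"
      using split_extend[OF sp, of u] nsp unfolding Q_def by blast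
    then have "u = comb m v (\<lambda>i. if i < m then F i else 0)" by (simp add: comb_def)
    then show ?thesis using F P_deg by (intro exI[of _ "\<lambda>i. if i < m then F i else 0"]) auto
  qed
  then show ?thesis using that sp by blast
qed

text \<open>Coordinates in a splitting family are unique, so a linear map may be prescribed on each
  summand separately.\<close>

lemma split_linear_map:
  fixes \<Phi> :: "nat \<Rightarrow> 'k poly \<Rightarrow> 'k^'n"
  assumes sp: "split m v l" and span: "\<And>u. \<exists>F. (\<forall>i. degree (F i) < degree P) \<and> u = comb m v F"
    and add: "\<And>i f g. \<Phi> i (f + g) = \<Phi> i f + \<Phi> i g"
    and smult: "\<And>i c f. \<Phi> i (smult c f) = c *s \<Phi> i f"
  shows "\<exists>T. \<forall>F. (\<forall>i<m. degree (F i) < degree P) \<longrightarrow> T *v comb m v F = (\<Sum>i<m. \<Phi> i (F i))"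
proof -
  define C where "C u = (SOME F. (\<forall>i. degree (F i) < degree P) \<and> u = comb m v F)" for u
  have C: "\<forall>i. degree (C u i) < degree P" "u = comb m v (C u)" for u
    using someI_ex[OF span[of u]] unfolding C_def by blast+
  define t where "t u = (\<Sum>i<m. \<Phi> i (C u i))" for u
  have t: "t (comb m v F) = (\<Sum>i<m. \<Phi> i (F i))" if "\<forall>i<m. degree (F i) < degree P" for F
    unfolding t_def
    by (rule sum.cong) (use split_unique[OF sp, of "C (comb m v F)" F] C that in auto)
  have "Vector_Spaces.linear (*s) (*s) t"
  proof (rule Vector_Spaces.linear.intro[OF _ _ module_hom.intro[OF _ _ module_hom_axioms.intro]])
    show "t (a + b) = t a + t b" for a b
      using t[of "\<lambda>i. C a i + C b i"] C[of a] C[of b]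
      by (simp add: comb_add degree_add_less t_def add sum.distrib)
    show "t (c *s a) = c *s t a" for c a
    proof -
      have "t (comb m v (\<lambda>i. smult c (C a i))) = (\<Sum>i<m. \<Phi> i (smult c (C a i)))"
        by (rule t) (use C(1)[of a] in \<open>auto intro: le_less_trans[OF degree_smult_le]\<close>)
      then show ?thesis
        using C(2)[of a] by (simp add: comb_smult smult vec.scale_sum_right t_def[of a])
    qed
  qed (unfold_locales)
  then have "matrix t *v u = t u" for u by (rule matrix_works)
  then show ?thesis using t by (intro exI[of _ "matrix t"]) simp
qed

end

text \<open>A noncommutative divided difference. As \<open>x\<close> and \<open>y\<close> need not
  commute, each factor \<open>y - x\<close> keeps a power of \<open>y\<close> on its left and a
  truncation of \<open>f\<close> at \<open>x\<close> on its right; this is the Bezoutian of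
  \<open>f\<close> in operator form.\<close>

lemma horner_difference:
  fixes x y :: "'k::field^'n^'n"
  assumes "degree f \<le> m"
  shows "pev f y - pev f x = (\<Sum>j<m. mpow y j ** (y - x) ** pev (poly_shift (Suc j) f) x)"
  using assms
proof (induction f arbitrary: m)
  case (pCons c g)
  have sh: "poly_shift (Suc j) (pCons c g) = poly_shift j g" for j
    by (simp add: poly_eq_iff coeff_poly_shift)
  show ?case
  proof (cases "g = 0")
    case True
    then have "poly_shift (Suc j) [:c:] = 0" for j using sh by simp
    then show ?thesis using True by (simp add: matrix_mult_ring)
  next
    case False
    then obtain m' where m: "m = Suc m'" "degree g \<le> m'"
      using pCons.prems by (cases m) auto
    have "pev (pCons c g) y - pev (pCons c g) x = (y - x) ** pev g x + y ** (pev g y - pev g x)"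
      by (simp add: matrix_mult_ring algebra_simps)
    also have "y ** (pev g y - pev g x)
        = (\<Sum>j<m'. mpow y (Suc j) ** (y - x) ** pev (poly_shift (Suc j) g) x)"
      unfolding pCons.IH[OF m(2)] by (induction m') (simp_all add: matrix_mult_ring)
    also have "(y - x) ** pev g x + \<dots> = (\<Sum>j<m. mpow y j ** (y - x) ** pev (poly_shift j g) x)"
      unfolding m(1) sum.lessThan_Suc_shift by (simp add: matrix_mult_ring)
    finally show ?thesis by (simp only: sh)
  qed
qed (simp add: matrix_mult_ring)

text \<open>For the linear form that takes the coefficient at \<open>k - 1\<close> of the remainder
  modulo \<open>P\<close>, the shifted polynomials \<open>poly_shift (Suc j) P\<close> are the basis
  dual to the powers of \<open>X\<close>.\<close>

lemma coeff_mod_poly_shift: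
  fixes P a :: "'k::field poly"
  assumes monic: "lead_coeff P = 1" and k: "degree P = k" and a: "degree a < k" and j: "j < k"
  shows "coeff ((a * poly_shift (Suc j) P) mod P) (k - 1) = coeff a j"
proof -
  define h where "h = poly_shift (Suc j) P"
  define \<tau> where "\<tau> f = coeff (f mod P) (k - 1)" for f
  have add: "\<tau> (\<Sum>i\<in>I. f i) = (\<Sum>i\<in>I. \<tau> (f i))" for f :: "nat \<Rightarrow> 'k poly" and I
    unfolding \<tau>_def by (induction I rule: infinite_finite_induct) (simp_all add: poly_mod_add_left)
  have small: "\<tau> f = coeff f (k - 1)" if "degree f < k" for f
    using that unfolding \<tau>_def by (simp add: mod_poly_less k)
  have ch: "coeff h i = coeff P (i + Suc j)" for i by (simp add: h_def coeff_poly_shift)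
  have mon: "\<tau> (monom c i * h) = (if i = j then c else 0)" if i: "i < k" for c i
  proof (cases "i \<le> j")
    case True
    have "degree (monom c i * h) \<le> k - 1"
    proof (rule degree_le, intro allI impI)
      fix l assume l: "k - 1 < l"
      then have "k < l - i + Suc j" using True i by linarith
      then show "coeff (monom c i * h) l = 0"
        using l i k by (auto simp: coeff_monom_mult ch intro: coeff_eq_0)
    qed
    then have "\<tau> (monom c i * h) = coeff (monom c i * h) (k - 1)" using j by (intro small) auto
    also have "\<dots> = c * coeff P (k - 1 - i + Suc j)" using i by (simp add: coeff_monom_mult ch)
    also have "\<dots> = (if i = j then c else 0)"
    proof (cases "i = j")
      case True
      then have "k - 1 - i + Suc j = k" using i by simp
      then show ?thesis using True monic k by simp
    next
      case False
      then have "degree P < k - 1 - i + Suc j" using i \<open>i \<le> j\<close> k by simp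
      then show ?thesis using False by (simp only: coeff_eq_0) simp
    qed
    finally show ?thesis .
  next
    case False
    \<comment> \<open>For \<open>i > j\<close> the product is a multiple of \<open>P\<close> minus a
      multiple of the lower part of \<open>P\<close>. The latter has degree at most
      \<open>i - 1\<close>, hence no coefficient at \<open>k - 1\<close>.\<close>
    have "monom 1 (Suc j) * h = P - poly_cutoff (Suc j) P"
      by (auto simp: poly_eq_iff coeff_monom_mult ch coeff_poly_cutoff)
    moreover have "monom c i = monom c (i - Suc j) * monom 1 (Suc j)"
      using False by (simp add: mult_monom)
    ultimately have "monom c i * h = monom c (i - Suc j) * P - monom c (i - Suc j) * poly_cutoff (Suc j) P"
      by (simp add: mult.assoc right_diff_distrib)
    then have "\<tau> (monom c i * h) = \<tau> (- (monom c (i - Suc j) * poly_cutoff (Suc j) P))"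
      unfolding \<tau>_def by (simp add: poly_mod_diff_left poly_mod_minus_left)
    also have "\<dots> = 0"
    proof -
      have "degree (monom c (i - Suc j) * poly_cutoff (Suc j) P) \<le> i - 1"
      proof (rule degree_le, intro allI impI)
        fix l assume "i - 1 < l"
        then show "coeff (monom c (i - Suc j) * poly_cutoff (Suc j) P) l = 0"
          using False by (auto simp: coeff_monom_mult coeff_poly_cutoff)
      qed
      then have "degree (- (monom c (i - Suc j) * poly_cutoff (Suc j) P)) < k - 1"
        using False i by (simp only: degree_minus)
      then show ?thesis by (subst small) (auto intro: coeff_eq_0 simp only: degree_minus)
    qed
    finally show ?thesis using False by simp
  qed
  have "a * h = (\<Sum>i\<le>k - 1. monom (coeff a i) i * h)"
    using a by (subst poly_as_sum_of_monoms'[of a "k - 1", symmetric]) (auto simp: sum_distrib_right)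
  then have "\<tau> (a * h) = (\<Sum>i\<le>k - 1. \<tau> (monom (coeff a i) i * h))" by (simp only: add)
  also have "\<dots> = (\<Sum>i\<le>k - 1. if i = j then coeff a i else 0)"
    by (rule sum.cong) (use mon j in auto)
  also have "\<dots> = coeff a j" using j by simp
  finally show ?thesis by (simp add: \<tau>_def h_def)
qed

context apx
begin

lemma mult_X_mod:
  assumes "degree F < degree P"
  shows "(pCons 0 F) mod P = pCons 0 F - smult (coeff F (degree P - 1)) P"
proof -
  define D where "D = pCons 0 F - smult (coeff F (degree P - 1)) P"
  have "degree D \<le> degree P - 1"
  proof (rule degree_le, intro allI impI)
    fix i assume i: "degree P - 1 < i"
    show "coeff D i = 0"
    proof (cases "i = degree P")
      case True
      have "coeff (pCons 0 F) (degree P) = coeff F (degree P - 1)"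
        using P_deg by (cases "degree P") simp_all
      then show ?thesis using True P_monic by (simp add: D_def)
    next
      case False
      then have "coeff P i = 0" "coeff F (i - 1) = 0" using i assms by (auto intro!: coeff_eq_0)
      then show ?thesis using i by (cases i) (simp_all add: D_def)
    qed
  qed
  then have "D mod P = D" using P_deg by (intro mod_poly_less) linarith
  then have "(pCons 0 F) mod P = D"
    by (simp add: D_def poly_mod_diff_left mod_smult_left)
  then show ?thesis by (simp add: D_def)
qed

text \<open>Dividing by the top coefficient gives a monic polynomial of degree
  \<open>degree P - 1\<close>. In this way \<open>om\<close> turns into a lower bound for the
  valuation of that coefficient.\<close>

lemma top_coeff_bound:
  assumes om: "\<And>g. lead_coeff g = 1 \<Longrightarrow> degree g = degree P - 1 \<Longrightarrow> w g \<le> om"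
    and F: "degree F < degree P" and c: "coeff F (degree P - 1) \<noteq> 0"
  shows "F \<noteq> 0" "w F \<le> e * val (coeff F (degree P - 1)) + om"
proof -
  define c where "c = coeff F (degree P - 1)"
  show F0: "F \<noteq> 0" using c by auto
  have "degree P - 1 \<le> degree F" using c by (rule le_degree)
  then have dF: "degree F = degree P - 1" using F by linarith
  define g where "g = smult (inverse c) F"
  have g: "lead_coeff g = 1" "degree g = degree P - 1" "F = smult c g" "g \<noteq> 0" "c \<noteq> 0"
    using c dF F0 by (auto simp: g_def c_def)
  have "w F = e * val c + w g"
    unfolding g(3) by (rule w_smult[OF g(5,4)]) (use g(2) P_deg in simp)
  then show "w F \<le> e * val (coeff F (degree P - 1)) + om" using om[OF g(1,2)] by (simp add: c_def)
qed

text \<open>The matrix \<open>\<gamma>\<close> acts on the coordinates of a splitting basis as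
  multiplication by \<open>X\<close> modulo \<open>P\<close>, so it satisfies \<open>P\<close>
  exactly. It differs from \<open>x\<close> by multiples of \<open>pev P x\<close> whose
  coefficients are the top coefficients of the coordinates, and \<open>om\<close> bounds these well
  enough to leave depth \<open>n\<close>.\<close>

lemma approximant:
  assumes om: "\<And>g. lead_coeff g = 1 \<Longrightarrow> degree g = degree P - 1 \<Longrightarrow> w g \<le> om"
    and Px: "pev P x \<in> filt \<Lambda> (om + n)"
  shows "\<exists>\<gamma>. \<gamma> - x \<in> filt \<Lambda> n \<and> pev P \<gamma> = 0 \<and>
    (\<forall>f. f \<noteq> 0 \<longrightarrow> degree f < degree P \<longrightarrow> sh (w f) (pev f \<gamma>))"
proof -
  obtain m v l where sp: "split m v l" and span: "\<And>u. \<exists>F. (\<forall>i. degree (F i) < degree P) \<and> u = comb m v F"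
    using split_basis by metis
  have v: "v i \<in> \<Lambda> (l i)" if "i < m" for i using sp that by (simp add: split_def)
  have "\<exists>\<gamma>. \<forall>F. (\<forall>i<m. degree (F i) < degree P) \<longrightarrow>
      \<gamma> *v comb m v F = (\<Sum>i<m. pev ((pCons 0 (F i)) mod P) x *v v i)"
  proof (rule split_linear_map[OF sp span, of "\<lambda>i F. pev ((pCons 0 F) mod P) x *v v i"])
    show "pev (pCons 0 (f + g) mod P) x *v v i = pev (pCons 0 f mod P) x *v v i + pev (pCons 0 g mod P) x *v v i" for i f g
    proof -
      have "pCons 0 (f + g) = pCons 0 f + pCons 0 g" by simp
      then show ?thesis by (simp only: poly_mod_add_left pev_add matrix_vector_ring)
    qed
    show "pev (pCons 0 (smult c f) mod P) x *v v i = c *s (pev (pCons 0 f mod P) x *v v i)" for i c f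
    proof -
      have "pCons 0 (smult c f) = smult c (pCons 0 f)" by simp
      then show ?thesis by (simp only: mod_smult_left pev_smult matrix_vector_ring mat_mult_vector)
    qed
  qed
  then obtain \<gamma> where \<gamma>: "\<And>F. (\<forall>i<m. degree (F i) < degree P) \<Longrightarrow>
      \<gamma> *v comb m v F = (\<Sum>i<m. pev ((pCons 0 (F i)) mod P) x *v v i)"
    by blast
  have act: "pev G \<gamma> *v comb m v F = comb m v (\<lambda>i. (G * F i) mod P)"
    if F: "\<forall>i<m. degree (F i) < degree P" for G F
  proof (induction G)
    case (pCons c G)
    have "pev (pCons c G) \<gamma> *v comb m v F = c *s comb m v F + \<gamma> *v comb m v (\<lambda>i. (G * F i) mod P)"
      by (simp add: matrix_vector_ring mat_mult_vector pCons.IH)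
    also have "\<gamma> *v comb m v (\<lambda>i. (G * F i) mod P) = comb m v (\<lambda>i. (pCons 0 ((G * F i) mod P)) mod P)"
      by (subst \<gamma>) (simp_all add: mod_deg comb_def)
    also have "c *s comb m v F + comb m v (\<lambda>i. (pCons 0 ((G * F i) mod P)) mod P)
      = comb m v (\<lambda>i. smult c (F i) + (pCons 0 ((G * F i) mod P)) mod P)"
      by (simp add: comb_add comb_smult)
    also have "\<dots> = comb m v (\<lambda>i. (pCons c G * F i) mod P)"
      unfolding comb_def
    proof (rule sum.cong[OF refl])
      fix i assume i: "i \<in> {..<m}"
      have "smult c (F i) mod P = smult c (F i)"
        using F i by (intro mod_poly_less) (auto intro: le_less_trans[OF degree_smult_le])
      moreover have "(pCons 0 ((G * F i) mod P)) mod P = (pCons 0 (G * F i)) mod P"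
      proof -
        have "pCons 0 f = [:0, 1:] * f" for f :: "'k poly" by simp
        then show ?thesis by (metis mod_mult_right_eq)
      qed
      ultimately have "smult c (F i) + (pCons 0 ((G * F i) mod P)) mod P = (pCons c G * F i) mod P"
        by (simp add: poly_mod_add_left)
      then show "pev (smult c (F i) + (pCons 0 ((G * F i) mod P)) mod P) x *v v i
        = pev ((pCons c G * F i) mod P) x *v v i" by simp
    qed
    finally show ?case .
  qed (simp add: comb_def)
  have P0: "pev P \<gamma> = 0"
  proof -
    have "pev P \<gamma> *v u = 0" for u
    proof -
      obtain F where F: "\<forall>i. degree (F i) < degree P" "u = comb m v F" using span by blast
      then have "pev P \<gamma> *v u = comb m v (\<lambda>i. (P * F i) mod P)" by (simp add: act)
      then show ?thesis by (simp add: comb_def)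
    qed
    then show ?thesis by (simp add: matrix_eq)
  qed
  have fil: "pev f \<gamma> \<in> filt \<Lambda> (w f)" if f: "f \<noteq> 0" "degree f < degree P" for f
    unfolding filt_iff
  proof (intro allI impI)
    fix s u assume u: "u \<in> \<Lambda> s"
    obtain F where F: "\<forall>i. degree (F i) < degree P" "u = comb m v F" using span by blast
    have "pev ((f * F i) mod P) x *v v i \<in> \<Lambda> (s + w f)" if i: "i < m" for i
    proof (cases "F i = 0")
      case False
      have "s \<le> w (F i) + l i"
        using splitD[OF sp, of F s i] F u i False by auto
      moreover have "pev ((f * F i) mod P) x *v v i \<in> \<Lambda> (l i + (w f + w (F i)))"
        using filtD[OF sh_filt[OF x_sh[OF mult_mod(1)[OF f(1) False f(2)] mod_deg]] v[OF i] refl]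
          mult_mod(2)[OF f(1) False f(2)] F by simp
      ultimately show ?thesis by (auto elim!: L_mono)
    qed (simp add: L_zero)
    then show "pev f \<gamma> *v u \<in> \<Lambda> (s + w f)"
      using F by (simp add: act) (auto simp: comb_def intro!: L_sum)
  qed
  have shf: "sh (w f) (pev f \<gamma>)" if f: "f \<noteq> 0" "degree f < degree P" for f
  proof -
    obtain f' where f': "f' \<noteq> 0" "degree f' < degree P" "(f * f') mod P = 1" "w f' = - w f"
      using field_inverse[OF f] by blast
    \<comment> \<open>Since \<open>P\<close> kills \<open>\<gamma>\<close>, an inverse modulo
      \<open>P\<close> becomes an exact inverse.\<close>
    have "(f * f') = P * ((f * f') div P) + 1" using f'(3) mult_div_mod_eq[of P "f * f'"] by simp
    then have "pev (f * f') \<gamma> = pev (P * ((f * f') div P) + 1) \<gamma>" by simp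
    then have "pev f \<gamma> ** pev f' \<gamma> = mat 1"
      by (simp add: pev_mult pev_add P0 matrix_mult_ring)
    then show ?thesis
      using fil[OF f] fil[OF f'(1,2)] f'(4) unfolding sh_def
      by (intro conjI bexI[of _ "pev f' \<gamma>"]) (simp_all add: pev_commute)
  qed
  have "\<gamma> - x \<in> filt \<Lambda> n"
    unfolding filt_iff
  proof (intro allI impI)
    fix s u assume u: "u \<in> \<Lambda> s"
    obtain F where F: "\<forall>i. degree (F i) < degree P" "u = comb m v F" using span by blast
    have "x *v u = (\<Sum>i<m. pev (pCons 0 (F i)) x *v v i)"
      by (simp add: F(2) comb_def vec.sum mat_ring matrix_vector_ring)
    then have "(\<gamma> - x) *v u = (\<Sum>i<m. pev ((pCons 0 (F i)) mod P - pCons 0 (F i)) x *v v i)"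
      using F \<gamma>[of F] by (simp add: matrix_vector_ring pev_diff sum_subtractf del: pev_pCons)
    moreover have "pev ((pCons 0 (F i)) mod P - pCons 0 (F i)) x *v v i \<in> \<Lambda> (s + n)" if i: "i < m" for i
    proof -
      define c where "c = coeff (F i) (degree P - 1)"
      have eq: "(pCons 0 (F i)) mod P - pCons 0 (F i) = smult (- c) P"
        using mult_X_mod[of "F i"] F by (simp add: c_def)
      show ?thesis
      proof (cases "c = 0")
        case False
        then have "F i \<noteq> 0" and wF: "w (F i) \<le> e * val c + om"
          using top_coeff_bound[OF om, of "F i"] F by (auto simp: c_def)
        have s: "s \<le> w (F i) + l i"
          using splitD[OF sp, of F s i] F u i \<open>F i \<noteq> 0\<close> by auto
        have "mat (- c) ** pev P x \<in> filt \<Lambda> (e * val c + (om + n))"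
          using filt_mult[OF filt_mat[of "- c"] Px] False discrete_valuation_uminus[OF dv False] by simp
        from filtD[OF this v[OF i] refl] show ?thesis
          unfolding eq pev_smult by (rule L_mono) (use s wF in simp)
      qed (simp add: eq L_zero)
    qed
    ultimately show "(\<gamma> - x) *v u \<in> \<Lambda> (s + n)" by (auto intro!: L_sum simp only: lessThan_iff)
  qed
  then show ?thesis using P0 shf by blast
qed

text \<open>The monic polynomials of maximal weight in each degree form an orthogonal basis: the top
  coordinate is bounded by comparing the whole combination, made monic, with the maximal one of its
  degree, and removing the top term lowers \<open>m\<close>.\<close>

lemma orthogonal_coordinates:
  assumes G: "\<And>i. i < degree P \<Longrightarrow> lead_coeff (G i) = 1 \<and> degree (G i) = i \<and>
      (\<forall>g. lead_coeff g = 1 \<longrightarrow> degree g = i \<longrightarrow> w g \<le> w (G i))"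
    and "m \<le> degree P" "i < m" "pev (\<Sum>i<m. smult (\<mu> i) (G i)) x \<in> filt \<Lambda> n"
  shows "\<mu> i = 0 \<or> n \<le> e * val (\<mu> i) + w (G i)"
  using assms(2-)
proof (induction m)
  case (Suc m)
  define a where "a = (\<Sum>i<Suc m. smult (\<mu> i) (G i))"
  have m: "m < degree P" using Suc.prems by simp
  have Gm: "G m \<noteq> 0" "degree (G m) = m" "coeff (G m) m = 1" using G[OF m] by auto
  have top: "\<mu> m = 0 \<or> n \<le> e * val (\<mu> m) + w (G m)"
  proof (cases "\<mu> m = 0")
    case False
    have rest: "degree (\<Sum>i<m. smult (\<mu> i) (G i)) < m \<or> (\<Sum>i<m. smult (\<mu> i) (G i)) = 0"
    proof (cases m)
      case (Suc m')
      have "degree (\<Sum>i<m. smult (\<mu> i) (G i)) \<le> m'"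
        using Suc G m by (intro degree_sum_le) (auto intro: order_trans[OF degree_smult_le])
      then show ?thesis using Suc by simp
    qed simp
    then have c0: "coeff (\<Sum>i<m. smult (\<mu> i) (G i)) j = 0" if "m \<le> j" for j
      using that by (auto intro: coeff_eq_0)
    have cm: "coeff a m = \<mu> m" using c0[of m] Gm by (simp add: a_def)
    have "degree a \<le> m"
    proof (rule degree_le, intro allI impI)
      fix j assume "m < j"
      then show "coeff a j = 0" using c0[of j] Gm by (simp add: a_def coeff_eq_0)
    qed
    then have da: "degree a = m" using cm False le_degree[of a m] by simp
    define g where "g = smult (inverse (\<mu> m)) a"
    have g: "lead_coeff g = 1" "degree g = m" "a = smult (\<mu> m) g" "g \<noteq> 0" "a \<noteq> 0"
      using False da cm by (auto simp: g_def)
    have "w a = e * val (\<mu> m) + w g"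
      unfolding g(3) by (rule w_smult[OF False g(4)]) (use g(2) m in simp)
    then have "w a \<le> e * val (\<mu> m) + w (G m)" using g G[OF m] by simp
    moreover have "n \<le> w a"
      using w_le_iff[of a n] da m g(5) Suc.prems(3) by (simp add: a_def)
    ultimately show ?thesis by simp
  qed simp
  have "mat (\<mu> m) ** pev (G m) x \<in> filt \<Lambda> n"
  proof (cases "\<mu> m = 0")
    case False
    have "mat (\<mu> m) ** pev (G m) x \<in> filt \<Lambda> (e * val (\<mu> m) + w (G m))"
      by (rule filt_mult[OF filt_mat[OF False] sh_filt[OF x_sh]]) (use Gm m in auto)
    then show ?thesis using top False filt_mono by blast
  qed (simp add: mat_ring matrix_mult_ring filt_zero)
  then have "pev a x - mat (\<mu> m) ** pev (G m) x \<in> filt \<Lambda> n"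
    using Suc.prems(3) filt_diff unfolding a_def by blast
  then have "pev (\<Sum>i<m. smult (\<mu> i) (G i)) x \<in> filt \<Lambda> n"
    by (simp add: a_def pev_add pev_smult)
  then show ?case using Suc.IH Suc.prems top by (cases "i = m") auto
qed simp

text \<open>Expand the divided difference of \<open>P\<close> in the orthogonal basis
  \<open>G\<close> on the left and its dual basis \<open>t\<close> on the right. Duality gives a
  nonzero \<open>t i\<close> weight at least \<open>w (G (k - 1)) - w (G i)\<close>, so all terms
  reach the same depth.\<close>

lemma bezoutian_bound:
  assumes G: "\<And>i. i < degree P \<Longrightarrow> lead_coeff (G i) = 1 \<and> degree (G i) = i \<and>
      (\<forall>g. lead_coeff g = 1 \<longrightarrow> degree g = i \<longrightarrow> w g \<le> w (G i))"
    and y: "\<And>f. f \<noteq> 0 \<Longrightarrow> degree f < degree P \<Longrightarrow> pev f y \<in> filt \<Lambda> (w f)"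
    and yx: "y - x \<in> filt \<Lambda> n"
  shows "pev P y - pev P x \<in> filt \<Lambda> (w (G (degree P - 1)) + n)"
proof -
  define k where "k = degree P"
  have kpos: "0 < k" using P_deg by (simp add: k_def)
  have coords: "\<exists>\<mu>. a = (\<Sum>i<m. smult (\<mu> i) (G i))" if "m \<le> k" "a = 0 \<or> degree a < m" for a m
    using that
  proof (induction m arbitrary: a)
    case (Suc m)
    have Gm: "lead_coeff (G m) = 1" "degree (G m) = m" using G[of m] Suc.prems by (auto simp: k_def)
    define c where "c = coeff a m"
    define a' where "a' = a - smult c (G m)"
    have "a' = 0 \<or> degree a' < m"
    proof (cases "a' = 0")
      case False
      have "coeff a' j = 0" if "m \<le> j" for j
      proof (cases "j = m")
        case True
        then show ?thesis using Gm by (simp add: a'_def c_def)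
      next
        case False
        then have "coeff a j = 0" "coeff (G m) j = 0"
          using that Suc.prems Gm by (auto intro!: coeff_eq_0)
        then show ?thesis by (simp add: a'_def)
      qed
      then show ?thesis using False by (metis leading_coeff_0_iff not_le)
    qed simp
    then obtain \<mu> where \<mu>: "a' = (\<Sum>i<m. smult (\<mu> i) (G i))"
      using Suc.IH[of a'] Suc.prems by auto
    have "a = (\<Sum>i<Suc m. smult ((\<mu>(m := c)) i) (G i))"
      using \<mu> by (simp add: a'_def algebra_simps)
    then show ?case by blast
  qed simp
  have "\<forall>j<k. \<exists>\<mu>. monom 1 j = (\<Sum>i<k. smult (\<mu> i) (G i))"
    using coords[of k] by (simp add: degree_monom_eq)
  then obtain lam where lam: "\<And>j. j < k \<Longrightarrow> monom 1 j = (\<Sum>i<k. smult (lam j i) (G i))"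
    by metis
  \<comment> \<open>\<open>lam\<close> expresses the powers of \<open>X\<close> in the basis
    \<open>G\<close>; its transpose carries the basis dual to the powers to the basis dual to
    \<open>G\<close>.\<close>
  define t where "t i = (\<Sum>j<k. smult (lam j i) (poly_shift (Suc j) P))" for i
  have dt: "degree (t i) < k" for i
  proof -
    have "degree (poly_shift (Suc j) P) \<le> k - 1" for j
      by (rule degree_le) (auto simp: coeff_poly_shift k_def intro: coeff_eq_0)
    then have "degree (t i) \<le> k - 1"
      unfolding t_def by (intro degree_sum_le) (auto intro: order_trans[OF degree_smult_le])
    then show ?thesis using kpos by simp
  qed
  have coord_t: "coeff ((a * t i) mod P) (k - 1) = (\<Sum>j<k. coeff a j * lam j i)" if "degree a < k" for a i
  proof -
    have "a * t i = (\<Sum>j<k. smult (lam j i) (a * poly_shift (Suc j) P))"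
      by (simp add: t_def sum_distrib_left)
    moreover have "(\<Sum>j\<in>J. f j) mod P = (\<Sum>j\<in>J. f j mod P)" for J and f :: "nat \<Rightarrow> 'k poly"
      by (induction J rule: infinite_finite_induct) (simp_all add: poly_mod_add_left)
    ultimately have "(a * t i) mod P = (\<Sum>j<k. smult (lam j i) ((a * poly_shift (Suc j) P) mod P))"
      by (simp add: mod_smult_left)
    then show ?thesis
      using that coeff_mod_poly_shift[OF P_monic, of k a]
      by (simp add: coeff_sum k_def mult.commute)
  qed
  have wt: "t i = 0 \<or> w (G (k - 1)) - w (G i) \<le> w (t i)" if i: "i < k" for i
  proof (cases "t i = 0")
    case False
    obtain t' where t': "t' \<noteq> 0" "degree t' < k" "(t i * t') mod P = 1" "w t' = - w (t i)"
      using field_inverse[OF False] dt by (auto simp: k_def)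
    have g: "G (k - 1) \<noteq> 0" "degree (G (k - 1)) = k - 1" "lead_coeff (G (k - 1)) = 1"
      using G[of "k - 1"] kpos by (auto simp: k_def)
    \<comment> \<open>\<open>a\<close> is the quotient of \<open>G (k - 1)\<close> by
      \<open>t i\<close>. Its coordinate along \<open>G i\<close> is the top coefficient of
      \<open>a * t i\<close> modulo \<open>P\<close>, which is 1, so orthogonality bounds
      \<open>w a\<close> by \<open>w (G i)\<close>.\<close>
    define a where "a = (t' * G (k - 1)) mod P"
    have a: "a \<noteq> 0" "w a = w (G (k - 1)) - w (t i)" "degree a < k"
      using mult_mod[of t' "G (k - 1)"] t' g kpos mod_deg by (auto simp: a_def k_def)
    have "(a * t i) mod P = (t i * ((t' * G (k - 1)) mod P)) mod P"
      by (simp add: a_def mult.commute)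
    also have "\<dots> = (t i * t' * G (k - 1)) mod P"
      by (simp only: mod_mult_right_eq mult.assoc)
    also have "\<dots> = (((t i * t') mod P) * G (k - 1)) mod P" by (simp only: mod_mult_left_eq)
    also have "\<dots> = G (k - 1)" using t'(3) g kpos by (simp add: mod_poly_less k_def)
    finally have one: "(\<Sum>j<k. coeff a j * lam j i) = 1" using coord_t[OF a(3), of i] g by simp
    have "a = (\<Sum>j\<le>k - 1. monom (coeff a j) j)"
      using a(3) by (subst poly_as_sum_of_monoms'[of a "k - 1"]) auto
    also have "{..k - 1} = {..<k}" using kpos by auto
    also have "(\<Sum>j<k. monom (coeff a j) j) = (\<Sum>j<k. smult (coeff a j) (\<Sum>i<k. smult (lam j i) (G i)))"
      by (rule sum.cong) (simp_all flip: lam add: smult_monom)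
    also have "\<dots> = (\<Sum>i<k. smult (\<Sum>j<k. coeff a j * lam j i) (G i))"
      by (rule poly_eqI)
         (simp add: coeff_sum sum_distrib_left sum_distrib_right mult.assoc, rule sum.swap)
    finally have "pev (\<Sum>i<k. smult (\<Sum>j<k. coeff a j * lam j i) (G i)) x \<in> filt \<Lambda> (w a)"
      using sh_filt[OF x_sh[OF a(1)]] a(3) by (simp add: k_def)
    from orthogonal_coordinates[OF G _ i this]
    have "w a \<le> w (G i)" using one discrete_valuation_one[OF dv] by (simp add: k_def)
    then show ?thesis using a by simp
  qed simp
  have "pev P y - pev P x = (\<Sum>j<k. mpow y j ** (y - x) ** pev (poly_shift (Suc j) P) x)"
    by (rule horner_difference) (simp add: k_def)
  also have "\<dots> = (\<Sum>j<k. (\<Sum>i<k. pev (G i) y ** (y - x) ** pev (smult (lam j i) (poly_shift (Suc j) P)) x))"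
  proof (rule sum.cong[OF refl])
    fix j assume j: "j \<in> {..<k}"
    have "mpow y j = pev (monom 1 j) y" by (simp add: pev_monom matrix_mult_ring)
    also have "\<dots> = (\<Sum>i<k. mat (lam j i) ** pev (G i) y)"
      using j lam by (simp add: pev_sum pev_smult)
    also have "\<dots> ** (y - x) ** pev (poly_shift (Suc j) P) x
      = (\<Sum>i<k. mat (lam j i) ** pev (G i) y ** (y - x) ** pev (poly_shift (Suc j) P) x)"
      by (induction k) (simp_all add: matrix_mult_ring)
    also have "\<dots> = (\<Sum>i<k. pev (G i) y ** (y - x) ** pev (smult (lam j i) (poly_shift (Suc j) P)) x)"
    proof (rule sum.cong[OF refl])
      fix i
      have "mat (lam j i) ** pev (G i) y ** (y - x) = pev (G i) y ** (y - x) ** mat (lam j i)"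
        by (simp add: mat_commutes flip: matrix_mul_assoc)
      then show "mat (lam j i) ** pev (G i) y ** (y - x) ** pev (poly_shift (Suc j) P) x
        = pev (G i) y ** (y - x) ** pev (smult (lam j i) (poly_shift (Suc j) P)) x"
        by (simp add: pev_smult matrix_mul_assoc)
    qed
    finally show "mpow y j ** (y - x) ** pev (poly_shift (Suc j) P) x
      = (\<Sum>i<k. pev (G i) y ** (y - x) ** pev (smult (lam j i) (poly_shift (Suc j) P)) x)" .
  qed
  also have "\<dots> = (\<Sum>i<k. (\<Sum>j<k. pev (G i) y ** (y - x) ** pev (smult (lam j i) (poly_shift (Suc j) P)) x))"
    by (rule sum.swap)
  also have "\<dots> = (\<Sum>i<k. pev (G i) y ** (y - x) ** pev (t i) x)"
  proof (rule sum.cong[OF refl])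
    have S: "(\<Sum>j\<in>J. A ** B j) = A ** (\<Sum>j\<in>J. B j)" for J :: "nat set" and A :: "'k^'n^'n" and B :: "nat \<Rightarrow> 'k^'n^'n"
      by (induction J rule: infinite_finite_induct) (simp_all add: matrix_mult_ring)
    show "(\<Sum>j<k. pev (G i) y ** (y - x) ** pev (smult (lam j i) (poly_shift (Suc j) P)) x)
      = pev (G i) y ** (y - x) ** pev (t i) x" for i
      by (simp add: S t_def pev_sum)
  qed
  finally have eq: "pev P y - pev P x = (\<Sum>i<k. pev (G i) y ** (y - x) ** pev (t i) x)" .
  show ?thesis
    unfolding eq
  proof (rule filt_sum)
    fix i assume "i \<in> {..<k}"
    then have i: "i < k" by simp
    have Gi: "G i \<noteq> 0" "degree (G i) < degree P" using G[of i] i by (auto simp: k_def)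
    show "pev (G i) y ** (y - x) ** pev (t i) x \<in> filt \<Lambda> (w (G (degree P - 1)) + n)"
    proof (cases "t i = 0")
      case False
      have "pev (t i) x \<in> filt \<Lambda> (w (t i))" using sh_filt[OF x_sh[OF False]] dt by (simp add: k_def)
      from filt_mult[OF filt_mult[OF y[OF Gi] yx] this] show ?thesis
        by (rule filt_mono) (use wt[OF i] False in \<open>simp add: k_def\<close>)
    qed (simp add: matrix_mult_ring filt_zero)
  qed
qed

end

section \<open>Elements near a simple element\<close>

locale pure_elt = latseq val e \<Lambda>
  for val :: "'k::field \<Rightarrow> int" and e and \<Lambda> :: "int \<Rightarrow> ('k^'n) set" +
  fixes b :: "'k^'n^'n" and P :: "'k poly"
  assumes minpoly_monic: "lead_coeff P = 1" and minpoly_deg: "0 < degree P" and minpoly_root: "pev P b = 0"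
    and b_sh: "f \<noteq> 0 \<Longrightarrow> degree f < degree P \<Longrightarrow> \<exists>n. sh n (pev f b)"
begin

definition w :: "'k poly \<Rightarrow> int" where
  "w f = (THE n. sh n (pev f b))"

lemma w_eq: "sh n (pev f b) \<Longrightarrow> w f = n"
  unfolding w_def using sh_unique by blast

lemma w_sh: "f \<noteq> 0 \<Longrightarrow> degree f < degree P \<Longrightarrow> sh (w f) (pev f b)"
  using b_sh w_eq by metis

lemma w_filt: "f \<noteq> 0 \<Longrightarrow> degree f < degree P \<Longrightarrow> pev f b \<in> filt \<Lambda> (w f)"
  by (rule sh_filt[OF w_sh])

lemma w_ge_iff: "degree f < degree P \<Longrightarrow> pev f b \<in> filt \<Lambda> n \<longleftrightarrow> f = 0 \<or> n \<le> w f"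
  using w_sh[of f] by (cases "f = 0") (auto intro: filt_zero filt_mono[OF sh_filt] dest: sh_le)

lemma exact_apx: "apx val e \<Lambda> b P w"
proof unfold_locales
  fix f g
  have "f * g = P * (f * g div P) + (f * g) mod P" by simp
  then have "pev (f * g) b = pev (P * (f * g div P) + (f * g) mod P) b" by simp
  then have "pev f b ** pev g b - pev (f * g mod P) b = 0"
    by (simp only: pev_mult pev_add minpoly_root matrix_mult_ring) simp
  then show "pev f b ** pev g b - pev (f * g mod P) b \<in> filt \<Lambda> (w f + w g + 1)"
    by (simp add: filt_zero)
qed (use minpoly_monic minpoly_deg w_sh in auto)

text \<open>Fix \<open>v\<close> of exact level \<open>s\<close>. The vector obtained from
  \<open>v\<close> by the \<open>i\<close>-th power of \<open>b\<close> lies outside the span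
  \<open>W\<close> of the lower ones, so its coset modulo \<open>W\<close> has bounded level; this
  bounds the weights of monic polynomials of degree \<open>i\<close>.\<close>

lemma max_monic:
  assumes i: "i < degree P"
  shows "\<exists>g. lead_coeff g = 1 \<and> degree g = i \<and> (\<forall>h. lead_coeff h = 1 \<longrightarrow> degree h = i \<longrightarrow> w h \<le> w g)"
proof -
  obtain s v where v: "v \<in> \<Lambda> s" "v \<notin> \<Lambda> (s + 1)" using nontrivial_jump by blast
  define W where "W = {pev f b *v v |f. f = 0 \<or> degree f < i}"
  have W: "vec.subspace W"
  proof (rule vec.subspaceI)
    show "0 \<in> W" unfolding W_def by (auto intro!: exI[of _ 0])
    show "a + c \<in> W" if ac: "a \<in> W" "c \<in> W" for a c
    proof -
      obtain f g where f: "a = pev f b *v v" "f = 0 \<or> degree f < i" and g: "c = pev g b *v v" "g = 0 \<or> degree g < i"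
        using ac unfolding W_def by auto
      have "f + g = 0 \<or> degree (f + g) < i" using f g degree_add_less by force
      moreover have "a + c = pev (f + g) b *v v" by (simp add: f(1) g(1) pev_add matrix_vector_ring)
      ultimately show ?thesis unfolding W_def by blast
    qed
    show "c *s a \<in> W" if a: "a \<in> W" for a c
    proof -
      obtain f where f: "a = pev f b *v v" "f = 0 \<or> degree f < i" using a unfolding W_def by auto
      have "smult c f = 0 \<or> degree (smult c f) < i" using f(2) by auto
      then show ?thesis unfolding W_def f(1)
        by (auto simp: pev_smult matrix_vector_ring mat_mult_vector intro!: exI[of _ "smult c f"])
    qed
  qed
  have monic_split: "\<exists>f. (f = 0 \<or> degree f < i) \<and> h = monom 1 i + f" if h: "lead_coeff h = 1" "degree h = i" for h :: "'k poly"
  proof -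
    define f where "f = h - monom 1 i"
    have "f = 0 \<or> degree f < i"
    proof (cases "f = 0")
      case False
      have "coeff f j = 0" if "i \<le> j" for j
        using that h by (cases "i = j") (auto simp: f_def coeff_eq_0)
      then show ?thesis using False by (metis leading_coeff_0_iff not_le)
    qed simp
    then show ?thesis by (auto simp: f_def intro!: exI[of _ f])
  qed
  have "pev (monom 1 i) b *v v \<notin> W"
  proof
    assume "pev (monom 1 i) b *v v \<in> W"
    then obtain f where f: "pev (monom 1 i) b *v v = pev f b *v v" "f = 0 \<or> degree f < i"
      unfolding W_def by auto
    define h where "h = monom 1 i - f"
    have "coeff h i = 1" using f(2) by (auto simp: h_def coeff_eq_0)
    then have "h \<noteq> 0" by auto
    have "degree h \<le> i"
      using f(2) unfolding h_def by (intro degree_diff_le) (auto simp: degree_monom_le)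
    then have "sh (w h) (pev h b)" using \<open>h \<noteq> 0\<close> i by (intro w_sh) auto
    moreover have "pev h b *v v \<in> \<Lambda> (s + 1 + w h)"
      using f(1) by (simp add: h_def pev_diff matrix_vector_ring L_zero)
    ultimately show False using sh_cancel[of "w h" "pev h b" v "s + 1 + w h"] v(2) by simp
  qed
  then obtain N where N: "\<forall>u\<in>W. pev (monom 1 i) b *v v + u \<notin> \<Lambda> N"
    using L_bdd_away[OF W] by auto
  have bound: "w h < N - s" if h: "lead_coeff h = 1" "degree h = i" for h
  proof (rule ccontr)
    assume "\<not> w h < N - s"
    obtain f where f: "f = 0 \<or> degree f < i" "h = monom 1 i + f" using monic_split[OF h] by auto
    have "h \<noteq> 0" using h by auto
    have "pev h b *v v \<in> \<Lambda> (s + w h)"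
      by (rule filtD[OF w_filt v(1) refl]) (use \<open>h \<noteq> 0\<close> h i in auto)
    then have "pev h b *v v \<in> \<Lambda> N" by (rule L_mono) (use \<open>\<not> w h < N - s\<close> in simp)
    moreover have "pev h b *v v = pev (monom 1 i) b *v v + pev f b *v v"
      by (simp add: f(2) pev_add matrix_vector_ring)
    moreover have "pev f b *v v \<in> W" unfolding W_def using f(1) by auto
    ultimately show False using N by auto
  qed
  define Q where "Q h \<longleftrightarrow> lead_coeff h = 1 \<and> degree h = i" for h :: "'k poly"
  have "Q (monom 1 i)" by (simp add: Q_def degree_monom_eq)
  then obtain g where g: "Q g" "\<forall>h. Q h \<longrightarrow> nat (N - s - w g) \<le> nat (N - s - w h)"
    using ex_has_least_nat[of Q "monom 1 i" "\<lambda>h. nat (N - s - w h)"] by auto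
  have "w h \<le> w g" if "Q h" for h
    using g(2) that bound[of h] by (auto simp: Q_def)
  then show ?thesis using g(1) by (auto simp: Q_def)
qed

text \<open>The minimality hypothesis says that no approximate field structure of smaller degree approximates
  \<open>b\<close> up to \<open>filt \<Lambda> n\<close>. By induction on the degree, the first polynomial \<open>f0\<close> violating the conclusion
  would be the modulus of such a structure.\<close>

lemma congruence_near:
  assumes min: "\<And>Q om. lead_coeff Q = 1 \<Longrightarrow> 0 < degree Q \<Longrightarrow> degree Q < degree P \<Longrightarrow> apx val e \<Lambda> b Q w \<Longrightarrow>
      (\<And>g. lead_coeff g = 1 \<Longrightarrow> degree g = degree Q - 1 \<Longrightarrow> w g \<le> om) \<Longrightarrow> pev Q b \<in> filt \<Lambda> (om + n) \<Longrightarrow> False"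
    and y: "y - b \<in> filt \<Lambda> n"
  shows "f \<noteq> 0 \<Longrightarrow> degree f < degree P \<Longrightarrow> pev f y - pev f b \<in> filt \<Lambda> (w f + 1)"
proof (induction "degree f" arbitrary: f rule: less_induct)
  case less
  define k where "k = degree f"
  have k: "k < degree P" using less.prems by (simp add: k_def)
  have IH: "pev g y - pev g b \<in> filt \<Lambda> (w g + 1)" if "g \<noteq> 0" "degree g < k" for g
    using less.hyps[of g] that k by (simp add: k_def)
  have shy: "sh (w g) (pev g y)" if "g \<noteq> 0" "degree g < k" for g
    by (rule sh_perturb[OF w_sh IH]) (use that k in auto)
  show ?case
  proof (cases "k = 0")
    case True
    then obtain c where "f = [:c:]" using degree_eq_zeroE[of f] by (auto simp: k_def)
    then show ?thesis by (simp add: matrix_mult_ring filt_zero)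
  next
    case False
    obtain f0 where f0: "lead_coeff f0 = 1" "degree f0 = k"
      and f0max: "\<And>h. lead_coeff h = 1 \<Longrightarrow> degree h = k \<Longrightarrow> w h \<le> w f0"
      using max_monic[OF k] by auto
    have "f0 \<noteq> 0" using f0 by auto
    have f0_good: "pev f0 y - pev f0 b \<in> filt \<Lambda> (w f0 + 1)"
    proof (rule ccontr)
      assume bad: "pev f0 y - pev f0 b \<notin> filt \<Lambda> (w f0 + 1)"
      \<comment> \<open>This makes \<open>f0\<close> the modulus of an approximate structure at
        \<open>b\<close>. If the product law failed, \<open>q * f0\<close> would have weight at most
        \<open>w a + w c\<close>; comparing \<open>a * c = q * f0 + r\<close> at \<open>y\<close>
        and at \<open>b\<close> and cancelling \<open>q\<close> would then show that
        \<open>f0\<close> satisfies the congruence after all.\<close>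
      have mult: "pev a b ** pev c b - pev ((a * c) mod f0) b \<in> filt \<Lambda> (w a + w c + 1)"
        if ac: "a \<noteq> 0" "c \<noteq> 0" "degree a < k" "degree c < k" for a c
      proof (rule ccontr)
        assume neg: "\<not> ?thesis"
        define q r where "q = (a * c) div f0" and "r = (a * c) mod f0"
        have qr: "a * c = q * f0 + r" by (simp add: q_def r_def)
        have eq: "pev a b ** pev c b - pev r b = pev q b ** pev f0 b"
          using arg_cong[OF qr, of "\<lambda>f. pev f b"] by (simp add: pev_mult pev_add)
        have "q \<noteq> 0" using neg eq by (auto simp: r_def matrix_mult_ring filt_zero)
        have "degree q < k"
        proof -
          have "degree r < k" using degree_mod_less[OF \<open>f0 \<noteq> 0\<close>, of "a * c"] f0(2) False by (auto simp: r_def)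
          have "degree (q * f0) = degree q + k" using \<open>q \<noteq> 0\<close> \<open>f0 \<noteq> 0\<close> f0 by (simp add: degree_mult_eq)
          moreover have "q * f0 = a * c - r" using qr by simp
          moreover have "degree (a * c - r) \<le> max (degree a + degree c) (degree r)"
            using degree_diff_le_max[of "a * c" r] degree_mult_le[of a c] by linarith
          ultimately show ?thesis using ac \<open>degree r < k\<close> by auto
        qed
        define o1 where "o1 = w q + w f0"
        have shq: "sh o1 (pev q b ** pev f0 b)"
          unfolding o1_def using \<open>q \<noteq> 0\<close> \<open>f0 \<noteq> 0\<close> f0 k \<open>degree q < k\<close> by (intro sh_mult w_sh) auto
        have le: "o1 \<le> w a + w c"
        proof (rule ccontr)
          assume "\<not> o1 \<le> w a + w c"
          then have "pev q b ** pev f0 b \<in> filt \<Lambda> (w a + w c + 1)" by (intro filt_mono[OF sh_filt[OF shq]]) simp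
          then show False using neg eq by (simp add: r_def)
        qed
        have A: "pev a y ** pev c y - pev a b ** pev c b \<in> filt \<Lambda> (w a + w c + 1)"
        proof -
          have "pev a y ** pev c y - pev a b ** pev c b
            = pev a y ** (pev c y - pev c b) + (pev a y - pev a b) ** pev c b"
            by (simp add: matrix_mult_ring)
          moreover have "pev a y ** (pev c y - pev c b) \<in> filt \<Lambda> (w a + w c + 1)"
            by (rule filt_mult_le[OF sh_filt[OF shy] IH]) (use ac in auto)
          moreover have "(pev a y - pev a b) ** pev c b \<in> filt \<Lambda> (w a + w c + 1)"
            by (rule filt_mult_le[OF IH w_filt]) (use ac k in auto)
          ultimately show ?thesis by (simp add: filt_add)
        qed
        have R: "pev r y - pev r b \<in> filt \<Lambda> (o1 + 1)"
        proof (cases "r = 0")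
          case False
          have dr: "degree r < k" using degree_mod_less[OF \<open>f0 \<noteq> 0\<close>, of "a * c"] f0(2) False by (auto simp: r_def)
          have "pev a b ** pev c b \<in> filt \<Lambda> o1"
            by (rule filt_mult_le[OF w_filt w_filt]) (use ac k le in auto)
          then have "pev a b ** pev c b - pev q b ** pev f0 b \<in> filt \<Lambda> o1"
            by (rule filt_diff) (rule sh_filt[OF shq])
          then have "pev r b \<in> filt \<Lambda> o1" using eq by (simp add: algebra_simps)
          then have "o1 \<le> w r" using w_ge_iff[of r o1] False dr k by auto
          then show ?thesis using IH[OF False dr] filt_mono by simp
        qed (simp add: filt_zero)
        have "pev q y ** (pev f0 y - pev f0 b) \<in> filt \<Lambda> (o1 + 1)"
        proof -
          have "pev q y ** pev f0 y = pev a y ** pev c y - pev r y"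
            using arg_cong[OF qr, of "\<lambda>f. pev f y"] by (simp add: pev_mult pev_add)
          then have "pev q y ** (pev f0 y - pev f0 b)
            = (pev a y ** pev c y - pev a b ** pev c b) - (pev r y - pev r b) - (pev q y - pev q b) ** pev f0 b"
            using eq by (simp add: matrix_mult_ring algebra_simps)
          moreover have "(pev q y - pev q b) ** pev f0 b \<in> filt \<Lambda> (o1 + 1)"
            by (rule filt_mult_le[OF IH w_filt]) (use \<open>q \<noteq> 0\<close> \<open>degree q < k\<close> \<open>f0 \<noteq> 0\<close> f0 k in \<open>auto simp: o1_def\<close>)
          moreover have "pev a y ** pev c y - pev a b ** pev c b \<in> filt \<Lambda> (o1 + 1)"
            using A by (rule filt_mono) (use le in simp)
          ultimately show ?thesis using R by (simp only: filt_diff)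
        qed
        from sh_filt_cancel[OF shy this] \<open>q \<noteq> 0\<close> \<open>degree q < k\<close>
        have "pev f0 y - pev f0 b \<in> filt \<Lambda> (w f0 + 1)" by (simp add: o1_def add.commute)
        then show False using bad by blast
      qed
      have A: "apx val e \<Lambda> b f0 w"
        by unfold_locales (use f0 False w_sh k mult in auto)
      have "\<forall>i<k. \<exists>g. lead_coeff g = 1 \<and> degree g = i \<and> (\<forall>h. lead_coeff h = 1 \<longrightarrow> degree h = i \<longrightarrow> w h \<le> w g)"
        using max_monic k by auto
      then obtain G where G: "\<And>i. i < k \<Longrightarrow> lead_coeff (G i) = 1 \<and> degree (G i) = i \<and>
          (\<forall>h. lead_coeff h = 1 \<longrightarrow> degree h = i \<longrightarrow> w h \<le> w (G i))"
        by metis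
      have G': "lead_coeff (G i) = 1 \<and> degree (G i) = i \<and>
          (\<forall>h. lead_coeff h = 1 \<longrightarrow> degree h = i \<longrightarrow> w h \<le> w (G i))" if "i < degree f0" for i
        using G that f0(2) by blast
      have "pev f0 y - pev f0 b \<in> filt \<Lambda> (w (G (degree f0 - 1)) + n)"
        by (rule apx.bezoutian_bound[OF A G' sh_filt[OF shy] y]) (use f0 in auto)
      \<comment> \<open>As the congruence fails, the Bezoutian depth
        \<open>w (G (k - 1)) + n\<close> is at most \<open>w f0\<close>; so \<open>pev f0 b\<close>
        is deep enough to contradict \<open>min\<close>.\<close>
      then have "\<not> w f0 + 1 \<le> w (G (k - 1)) + n"
        using bad f0(2) filt_mono[of "pev f0 y - pev f0 b" "w (G (k - 1)) + n" "w f0 + 1"] by auto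
      then have "pev f0 b \<in> filt \<Lambda> (w (G (k - 1)) + n)"
        using f0 k by (intro filt_mono[OF w_filt[OF \<open>f0 \<noteq> 0\<close>]]) auto
      then show False
        using min[OF f0(1) _ _ A, of "w (G (k - 1))"] f0(2) False k G[of "k - 1"] by auto
    qed
    \<comment> \<open>Maximality of \<open>w f0\<close> among the monic polynomials of degree
      \<open>k\<close> ensures that splitting off the multiple \<open>c\<close> of \<open>f0\<close>
      loses no weight in either summand.\<close>
    define c where "c = lead_coeff f"
    define h where "h = f - smult c f0"
    have "c \<noteq> 0" using less.prems by (simp add: c_def)
    have hz: "h = 0 \<or> degree h < k"
    proof (cases "h = 0")
      case hn: False
      have "coeff h j = 0" if "k \<le> j" for j
        using that f0 by (cases "k = j") (auto simp: h_def c_def k_def coeff_eq_0)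
      then show ?thesis using hn by (metis leading_coeff_0_iff not_le)
    qed simp
    define f1 where "f1 = smult (inverse c) f"
    have "w f1 \<le> w f0"
      using f0max[of f1] \<open>c \<noteq> 0\<close> by (simp add: f1_def c_def k_def)
    moreover have "w f = e * val c + w f1"
    proof -
      have "f = smult c f1" "f1 \<noteq> 0" "degree f1 < degree P" using \<open>c \<noteq> 0\<close> less.prems by (auto simp: f1_def)
      then show ?thesis using apx.w_smult[OF exact_apx \<open>c \<noteq> 0\<close>] by blast
    qed
    ultimately have le: "w f \<le> e * val c + w f0" by simp
    have 1: "mat c ** (pev f0 y - pev f0 b) \<in> filt \<Lambda> (w f + 1)"
      by (rule filt_mult_le[OF filt_mat[OF \<open>c \<noteq> 0\<close>] f0_good]) (use le in simp)
    have 2: "pev h y - pev h b \<in> filt \<Lambda> (w f + 1)"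
    proof (cases "h = 0")
      case hn: False
      have "mat c ** pev f0 b \<in> filt \<Lambda> (w f)"
        by (rule filt_mult_le[OF filt_mat[OF \<open>c \<noteq> 0\<close>] w_filt]) (use le \<open>f0 \<noteq> 0\<close> f0 k in auto)
      then have "pev h b \<in> filt \<Lambda> (w f)"
        using filt_diff[OF w_filt[OF less.prems]] by (simp add: h_def pev_diff pev_smult)
      then have "w f \<le> w h" using w_ge_iff[of h "w f"] hn hz k by auto
      then show ?thesis using IH[OF hn] hz hn filt_mono by auto
    qed (simp add: filt_zero)
    have "pev f y - pev f b = mat c ** (pev f0 y - pev f0 b) + (pev h y - pev h b)"
      by (simp add: h_def pev_diff pev_smult matrix_mult_ring)
    then show ?thesis using filt_add[OF 1 2] by simp
  qed
qed

end

section \<open>Comparison of lattice sequences\<close>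

lemma latseq_of_lattice_seq:
  fixes \<Lambda> :: "int \<Rightarrow> ('k::field^'n) set"
  assumes dv: "discrete_valuation val" and L: "lattice_seq val \<Lambda>"
  shows "\<exists>e. latseq val e \<Lambda>"
proof -
  obtain e where e: "e > 0"
    and pi': "\<forall>\<pi>. \<pi> \<noteq> 0 \<and> val \<pi> = 1 \<longrightarrow> (\<forall>s. (\<lambda>v. \<pi> *s v) ` \<Lambda> s = \<Lambda> (s + e))"
    using L by (auto simp only: lattice_seq_def)
  have pi: "(\<lambda>v. \<pi> *s v) ` \<Lambda> s = \<Lambda> (s + e)" if "\<pi> \<noteq> 0" "val \<pi> = 1" for \<pi> s
    using pi' that by simp
  have step: "\<Lambda> (s + 1) \<subseteq> \<Lambda> s" and full: "full_lattice val (\<Lambda> s)" for s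
    using L by (simp_all only: lattice_seq_def)
  have zero: "0 \<in> \<Lambda> s" for s
  proof -
    obtain S where S: "\<Lambda> s = {(\<Sum>s\<in>S. c s *s s) | c. \<forall>s\<in>S. c s \<in> ring_of_integers val}"
      using full[of s] unfolding full_lattice_def by blast
    show ?thesis unfolding S by (auto simp: ring_of_integers_def intro!: exI[of _ "\<lambda>_. 0"])
  qed
  have add: "v + u \<in> \<Lambda> s" if vu: "v \<in> \<Lambda> s" "u \<in> \<Lambda> s" for v u s
  proof -
    obtain S where S: "\<Lambda> s = {(\<Sum>s\<in>S. c s *s s) | c. \<forall>s\<in>S. c s \<in> ring_of_integers val}"
      using full[of s] unfolding full_lattice_def by blast
    obtain c d where c: "v = (\<Sum>s\<in>S. c s *s s)" "\<forall>s\<in>S. c s \<in> ring_of_integers val"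
      and d: "u = (\<Sum>s\<in>S. d s *s s)" "\<forall>s\<in>S. d s \<in> ring_of_integers val"
      using vu unfolding S by blast
    have "v + u = (\<Sum>s\<in>S. (c s + d s) *s s)" by (simp add: c d vec.scale_left_distrib sum.distrib)
    moreover have "\<forall>s\<in>S. c s + d s \<in> ring_of_integers val"
      using c d pin_add[OF dv] by (simp add: ring_of_integers_def)
    ultimately show ?thesis unfolding S by (auto intro!: exI[of _ "\<lambda>s. c s + d s"])
  qed
  have unif: "\<pi> *s v \<in> \<Lambda> (s + e) \<longleftrightarrow> v \<in> \<Lambda> s" if p: "\<pi> \<noteq> 0" "val \<pi> = 1" for \<pi> v s
    using pi[OF p, of s, symmetric] p by (auto simp: image_iff)
  \<comment> \<open>A unit is the quotient of the two uniformizers \<open>\<pi> * c\<close> and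
    \<open>\<pi>\<close>.\<close>
  have unit: "c *s v \<in> \<Lambda> s \<longleftrightarrow> v \<in> \<Lambda> s" if c: "c \<noteq> 0" "val c = 0" for c v s
  proof -
    obtain \<pi> where p: "\<pi> \<noteq> 0" "val \<pi> = 1" using dv by (auto simp: discrete_valuation_def)
    have "(\<pi> * c) *s v \<in> \<Lambda> (s + e) \<longleftrightarrow> v \<in> \<Lambda> s"
      using unif[of "\<pi> * c"] p c discrete_valuation_mult[OF dv] by simp
    moreover have "\<pi> *s (c *s v) \<in> \<Lambda> (s + e) \<longleftrightarrow> c *s v \<in> \<Lambda> s" using unif[OF p] .
    ultimately show ?thesis by (simp add: vector_smult_assoc)
  qed
  have pos: "c *s v \<in> \<Lambda> (s + e * int n) \<longleftrightarrow> v \<in> \<Lambda> s" if "c \<noteq> 0" "val c = int n" for c v s n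
    using that
  proof (induction n arbitrary: c)
    case 0
    then show ?case using unit by simp
  next
    case (Suc n)
    obtain \<pi> where p: "\<pi> \<noteq> 0" "val \<pi> = 1" using dv by (auto simp: discrete_valuation_def)
    define d where "d = inverse \<pi> * c"
    have d: "d \<noteq> 0" "val d = int n" "c = \<pi> * d"
      using Suc.prems p discrete_valuation_mult[OF dv, of "inverse \<pi>" c] discrete_valuation_inverse[OF dv p(1)]
      by (auto simp: d_def)
    have "c *s v \<in> \<Lambda> (s + e * int (Suc n)) \<longleftrightarrow> \<pi> *s (d *s v) \<in> \<Lambda> ((s + e * int n) + e)"
      by (simp add: d(3) vector_smult_assoc algebra_simps)
    also have "\<dots> \<longleftrightarrow> v \<in> \<Lambda> s" by (simp only: unif[OF p] Suc.IH[OF d(1,2)])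
    finally show ?case .
  qed
  have scale: "c *s v \<in> \<Lambda> (s + e * val c) \<longleftrightarrow> v \<in> \<Lambda> s" if c: "c \<noteq> 0" for c v s
  proof (cases "val c \<ge> 0")
    case True
    then show ?thesis using pos[OF c, of "nat (val c)"] by simp
  next
    case False
    have "inverse c *s (c *s v) \<in> \<Lambda> ((s + e * val c) + e * int (nat (- val c))) \<longleftrightarrow> c *s v \<in> \<Lambda> (s + e * val c)"
      by (rule pos) (use c False discrete_valuation_inverse[OF dv c] in auto)
    then show ?thesis using c False by (simp add: vector_smult_assoc)
  qed
  have exh: "\<exists>s. v \<in> \<Lambda> s" for v
  proof -
    obtain x where x: "x \<noteq> 0" "x *s v \<in> \<Lambda> 0" using full[of 0] unfolding full_lattice_def by blast
    then show ?thesis using scale[of x v "- e * val x"] by auto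
  qed
  have bdd: "\<exists>N. \<forall>v\<in>\<Lambda> N. pin val 1 (\<phi> v)" if lin: "Vector_Spaces.linear (*s) (*) \<phi>" for \<phi> :: "'k^'n \<Rightarrow> 'k"
  proof -
    interpret l: Vector_Spaces.linear "(*s)" "(*)" \<phi> by (rule lin)
    obtain S where S: "finite S" "\<Lambda> 0 = {(\<Sum>s\<in>S. c s *s s) | c. \<forall>s\<in>S. c s \<in> ring_of_integers val}"
      using full[of 0] unfolding full_lattice_def by blast
    \<comment> \<open>The inserted 0 keeps the minimum meaningful for an empty generating
      set.\<close>
    define m where "m = Min (insert 0 ((\<lambda>s. val (\<phi> s)) ` S))"
    have m: "pin val m (\<phi> s)" if "s \<in> S" for s
      using that S(1) by (auto simp: pin_def m_def)
    have b0: "pin val m (\<phi> v)" if v: "v \<in> \<Lambda> 0" for v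
    proof -
      obtain c where c: "v = (\<Sum>s\<in>S. c s *s s)" "\<forall>s\<in>S. c s \<in> ring_of_integers val"
        using v unfolding S(2) by blast
      have "pin val (0 + m) (c s * \<phi> s)" if "s \<in> S" for s
        using c(2) m that by (intro pin_mult[OF dv]) (auto simp: ring_of_integers_def)
      then show ?thesis unfolding c(1) by (simp add: l.sum l.scale pin_sum[OF dv])
    qed
    obtain c where c: "c \<noteq> 0" "val c = 1 - m" using discrete_valuation_power_int_ex[OF dv] by blast
    have "pin val 1 (\<phi> v)" if v: "v \<in> \<Lambda> (e * (1 - m))" for v
    proof -
      define u where "u = inverse c *s v"
      have vu: "v = c *s u" using c by (simp add: u_def vector_smult_assoc)
      then have "u \<in> \<Lambda> 0" using v scale[OF c(1), of u 0] c(2) by simp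
      then have "pin val ((1 - m) + m) (c * \<phi> u)"
        by (intro pin_mult[OF dv] b0) (simp_all add: pin_def c)
      then show ?thesis by (simp add: vu l.scale)
    qed
    then show ?thesis by blast
  qed
  have "latseq val e \<Lambda>"
    by unfold_locales (use dv e zero add step scale exh bdd in auto)
  then show ?thesis by blast
qed

text \<open>The new sequence is the image of \<open>\<Lambda>\<close> under the inverse of
  \<open>g\<close>, written as a preimage.\<close>

lemma latseq_transport:
  fixes g gi :: "'k::field^'n^'n"
  assumes L: "latseq val e \<Lambda>" and g: "g ** gi = mat 1" "gi ** g = mat 1"
  shows "latseq val e (\<lambda>s. {v. g *v v \<in> \<Lambda> s})"
proof -
  interpret latseq val e \<Lambda> by (rule L)
  show ?thesis
  proof unfold_locales
    show "\<exists>N. \<forall>v\<in>{v. g *v v \<in> \<Lambda> N}. pin val 1 (\<phi> v)" if lin: "Vector_Spaces.linear (*s) (*) \<phi>" for \<phi> :: "'k^'n \<Rightarrow> 'k"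
    proof -
      interpret l: Vector_Spaces.linear "(*s)" "(*)" \<phi> by (rule lin)
      have "Vector_Spaces.linear (*s) (*) (\<lambda>v. \<phi> (gi *v v))"
        by unfold_locales (simp_all add: l.add l.scale matrix_vector_ring algebra_simps)
      from L_bdd[OF this] obtain N where N: "\<forall>v\<in>\<Lambda> N. pin val 1 (\<phi> (gi *v v))" by blast
      have "gi *v (g *v v) = v" for v using g(2) by (simp flip: matrix_vector_ring(5))
      then have "\<forall>v\<in>{v. g *v v \<in> \<Lambda> N}. pin val 1 (\<phi> v)" using N by force
      then show ?thesis by blast
    qed
    show "{v. g *v v \<in> \<Lambda> (s + 1)} \<subseteq> {v. g *v v \<in> \<Lambda> s}" for s using L_step[of s] by auto
  qed (use dv e_pos L_zero L_add L_scale L_exh in \<open>auto simp: matrix_vector_ring\<close>)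
qed

lemma filt_transport:
  fixes g gi x y :: "'k::field^'n^'n"
  assumes g: "g ** gi = mat 1" "gi ** g = mat 1" and xy: "g ** x = y ** g"
  shows "x \<in> filt (\<lambda>s. {v. g *v v \<in> \<Lambda> s}) n \<longleftrightarrow> y \<in> filt \<Lambda> n"
proof -
  have gx: "g *v (x *v v) = y *v (g *v v)" for v using xy by (simp flip: matrix_vector_ring(5))
  have ggi: "g *v (gi *v v) = v" for v using g by (simp flip: matrix_vector_ring(5))
  show ?thesis
  proof
    assume x: "x \<in> filt (\<lambda>s. {v. g *v v \<in> \<Lambda> s}) n"
    have "y *v v \<in> \<Lambda> (s + n)" if v: "v \<in> \<Lambda> s" for s v
    proof -
      have "gi *v v \<in> {v. g *v v \<in> \<Lambda> s}" using v by (simp add: ggi)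
      then have "x *v (gi *v v) \<in> {v. g *v v \<in> \<Lambda> (s + n)}" using x unfolding filt_def by blast
      then show ?thesis by (simp add: gx ggi)
    qed
    then show "y \<in> filt \<Lambda> n" by (auto simp: filt_def)
  next
    assume y: "y \<in> filt \<Lambda> n"
    have "y *v (g *v v) \<in> \<Lambda> (s + n)" if "g *v v \<in> \<Lambda> s" for s v
      using y that unfolding filt_def by blast
    then show "x \<in> filt (\<lambda>s. {v. g *v v \<in> \<Lambda> s}) n" by (auto simp: filt_def gx)
  qed
qed

lemma sh_transport:
  fixes g gi x y :: "'k::field^'n^'n"
  assumes L: "latseq val e \<Lambda>" and g: "g ** gi = mat 1" "gi ** g = mat 1" and xy: "g ** x = y ** g"
    and sh: "latseq.sh \<Lambda> n y"
  shows "latseq.sh (\<lambda>s. {v. g *v v \<in> \<Lambda> s}) n x"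
proof -
  interpret A: latseq val e \<Lambda> by (rule L)
  interpret B: latseq val e "\<lambda>s. {v. g *v v \<in> \<Lambda> s}" by (rule latseq_transport[OF L g])
  obtain y' where y': "y' \<in> filt \<Lambda> (- n)" "y ** y' = mat 1" "y' ** y = mat 1" and y: "y \<in> filt \<Lambda> n"
    using sh unfolding A.sh_def by blast
  define x' where "x' = gi ** y' ** g"
  have "g ** x' = (g ** gi) ** y' ** g" by (simp add: x'_def matrix_mult_ring)
  then have gx': "g ** x' = y' ** g" using g by (simp add: matrix_mult_ring)
  have x: "x = gi ** y ** g"
  proof -
    have "x = (gi ** g) ** x" using g by (simp add: matrix_mult_ring)
    also have "\<dots> = gi ** (g ** x)" by (simp add: matrix_mult_ring)
    also have "\<dots> = gi ** y ** g" unfolding xy by (simp add: matrix_mult_ring)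
    finally show ?thesis .
  qed
  have c: "gi ** (a ** (g ** (gi ** (c ** g)))) = mat 1" if "a ** c = mat 1" for a c :: "'k^'n^'n"
  proof -
    have "gi ** (a ** (g ** (gi ** (c ** g)))) = gi ** (a ** (g ** gi) ** c) ** g" by (simp add: matrix_mult_ring)
    also have "\<dots> = gi ** (a ** c) ** g" using g by (simp add: matrix_mult_ring)
    also have "\<dots> = mat 1" using g that by (simp add: matrix_mult_ring)
    finally show ?thesis .
  qed
  have "x ** x' = mat 1" "x' ** x = mat 1"
    using c[OF y'(2)] c[OF y'(3)] unfolding x x'_def by (simp_all add: matrix_mul_assoc)
  moreover have "x \<in> filt (\<lambda>s. {v. g *v v \<in> \<Lambda> s}) n" using filt_transport[OF g xy] y by blast
  moreover have "x' \<in> filt (\<lambda>s. {v. g *v v \<in> \<Lambda> s}) (- n)" using filt_transport[OF g gx'] y'(1) by blast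
  ultimately show ?thesis unfolding B.sh_def by blast
qed

text \<open>Together with \<open>axis_level\<close> this squeezes the sequence between multiples of
  the standard lattice, which makes any two sequences commensurable.\<close>

lemma (in latseq) coordinates_deep: "\<exists>N. \<forall>v\<in>\<Lambda> N. \<forall>i. pin val k (v $ i)"
proof -
  have lin: "Vector_Spaces.linear (*s) (*) (\<lambda>v::'k^'n. v $ i)" for i
    by unfold_locales (simp_all add: algebra_simps)
  have "\<forall>i. \<exists>N. \<forall>v\<in>\<Lambda> N. pin val 1 (v $ i)" using L_bdd[OF lin] by blast
  then obtain N where N: "\<And>i v. v \<in> \<Lambda> (N i) \<Longrightarrow> pin val 1 (v $ i)" by metis
  define N0 where "N0 = Max (range N)"
  have N0: "pin val 1 (v $ i)" if "v \<in> \<Lambda> N0" for i v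
    using N[of v i] L_mono[OF that, of "N i"] by (simp add: N0_def)
  obtain c where c: "c \<noteq> 0" "val c = k - 1" using discrete_valuation_power_int_ex[OF dv] by blast
  have "pin val k (v $ i)" if v: "v \<in> \<Lambda> (N0 + e * (k - 1))" for v i
  proof -
    have vu: "v = c *s (inverse c *s v)" using c by (simp add: vector_smult_assoc)
    have "inverse c *s v \<in> \<Lambda> N0" using L_scale[OF c(1), of "inverse c *s v" N0] v vu c(2) by simp
    then have "pin val ((k - 1) + 1) (c * (inverse c *s v) $ i)"
      by (intro pin_mult[OF dv] N0) (simp_all add: pin_def c)
    then show ?thesis using c(1) by (simp add: mult.assoc[symmetric])
  qed
  then show ?thesis by blast
qed

lemma (in latseq) axis_level: "\<exists>M. \<forall>j. axis j 1 \<in> \<Lambda> M"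
proof -
  have "\<forall>j. \<exists>s. axis j 1 \<in> \<Lambda> s" using L_exh by blast
  then obtain M where M: "\<And>j::'n. axis j 1 \<in> \<Lambda> (M j)" by metis
  have "axis j 1 \<in> \<Lambda> (Min (range M))" for j :: 'n
    using M[of j] by (rule L_mono) simp
  then show ?thesis by blast
qed

text \<open>Any two lattice sequences are commensurable, so the growth rate of the powers of \<open>T\<close> can be
  measured with either of them.\<close>

lemma spectral_comparison:
  fixes \<Lambda> \<Lambda>' :: "int \<Rightarrow> ('k::field^'n) set"
  assumes L: "latseq val e \<Lambda>" and L': "latseq val e \<Lambda>'"
    and T: "T \<in> filt \<Lambda> n" and T': "latseq.sh \<Lambda>' n' T"
  shows "n \<le> n'"
proof (rule ccontr)
  assume "\<not> n \<le> n'"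
  then have nn: "n' + 1 \<le> n" by simp
  interpret A: latseq val e \<Lambda> by (rule L)
  interpret B: latseq val e \<Lambda>' by (rule L')
  obtain N0 where N0: "\<And>v i. v \<in> \<Lambda> N0 \<Longrightarrow> pin val 0 (v $ i)" using A.coordinates_deep by blast
  obtain M0 where M0: "\<And>j::'n. axis j 1 \<in> \<Lambda>' M0" using B.axis_level by blast
  have incl: "v \<in> \<Lambda>' M0" if "v \<in> \<Lambda> N0" for v
  proof -
    have "v = (\<Sum>i\<in>UNIV. (v $ i) *s axis i 1)" by (simp add: basis_expansion)
    moreover have "(\<Sum>i\<in>UNIV. (v $ i) *s axis i 1) \<in> \<Lambda>' M0"
      by (intro B.L_sum B.L_int N0[OF that] M0)
    ultimately show ?thesis by simp
  qed
  have incl': "v \<in> \<Lambda>' (M0 + e * j)" if v: "v \<in> \<Lambda> (N0 + e * j)" for v j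
  proof -
    obtain c where c: "c \<noteq> 0" "val c = j" using discrete_valuation_power_int_ex[OF A.dv] by blast
    have vu: "v = c *s (inverse c *s v)" using c by (simp add: vector_smult_assoc)
    have "inverse c *s v \<in> \<Lambda> N0" using A.L_scale[OF c(1), of "inverse c *s v" N0] v vu c(2) by simp
    then have "inverse c *s v \<in> \<Lambda>' M0" by (rule incl)
    then show ?thesis using B.L_scale[OF c(1), of "inverse c *s v" M0] vu c(2) by simp
  qed
  obtain t v where v: "v \<in> \<Lambda>' t" "v \<notin> \<Lambda>' (t + 1)" using B.nontrivial_jump by blast
  obtain s where s: "v \<in> \<Lambda> s" using A.L_exh by blast
  \<comment> \<open>Chosen so that \<open>N0 + e * j0 \<le> s\<close>: this gives \<open>v\<close> a
    level of the form to which \<open>incl'\<close> applies.\<close>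
  define j0 where "j0 = - (\<bar>s\<bar> + \<bar>N0\<bar>)"
  have "e * j0 \<le> j0" using A.e_pos mult_right_mono_neg[of 1 e j0] by (simp add: j0_def)
  then have "N0 + e * j0 \<le> s" by (simp add: j0_def)
  then have v0: "v \<in> \<Lambda> (N0 + e * j0)" using A.L_mono[OF s] by blast
  have p: "mpow T k \<in> filt \<Lambda> (int k * n)" "B.sh (int k * n') (mpow T k)" for k
  proof (induction k)
    case 0
    show "mpow T 0 \<in> filt \<Lambda> (int 0 * n)" "B.sh (int 0 * n') (mpow T 0)"
      by (simp_all add: A.filt_one B.sh_one)
  next
    case (Suc k)
    show "mpow T (Suc k) \<in> filt \<Lambda> (int (Suc k) * n)" "B.sh (int (Suc k) * n') (mpow T (Suc k))"
      using A.filt_mult[OF T Suc(1)] B.sh_mult[OF T' Suc(2)] by (simp_all add: algebra_simps)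
  qed
  \<comment> \<open>High powers of \<open>T\<close> would push \<open>v\<close> deeper by unbounded
    multiples of \<open>n - n'\<close>, against its exact level \<open>t\<close>.\<close>
  have main: "M0 + e * j0 + e * int m * (n - n') \<le> t" for m
  proof (rule ccontr)
    assume "\<not> ?thesis"
    then have gt: "t + 1 \<le> M0 + e * j0 + e * int m * (n - n')" by simp
    \<comment> \<open>Exponents that are multiples of \<open>e\<close> shift levels by multiples of
      the period, so that \<open>incl'\<close> applies again.\<close>
    define k where "k = nat e * m"
    have k: "int k = e * int m" using A.e_pos by (simp add: k_def)
    have "mpow T k *v v \<in> \<Lambda> (N0 + e * (j0 + int m * n))"
      by (rule A.filtD[OF p(1) v0]) (simp add: k algebra_simps)
    then have "mpow T k *v v \<in> \<Lambda>' (M0 + e * (j0 + int m * n))" by (rule incl')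
    then have "v \<in> \<Lambda>' (M0 + e * (j0 + int m * n) - int k * n')" by (rule B.sh_cancel[OF p(2)])
    then have "v \<in> \<Lambda>' (t + 1)" by (rule B.L_mono) (use gt in \<open>simp add: k algebra_simps\<close>)
    then show False using v(2) by blast
  qed
  define m where "m = nat (t - M0 - e * j0 + 1)"
  have "int m \<le> e * int m * (n - n')"
  proof -
    have "1 \<le> e * (n - n')" using A.e_pos nn by (simp add: int_one_le_iff_zero_less)
    then have "int m * 1 \<le> int m * (e * (n - n'))" by (intro mult_left_mono) auto
    then show ?thesis by (simp add: mult_ac)
  qed
  moreover have "t - M0 - e * j0 + 1 \<le> int m" by (simp add: m_def)
  ultimately show False using main[of m] by linarith
qed

section \<open>Simple strata and their approximations\<close>

lemma minimal_relation:
  fixes a :: "'k::field^'n^'n"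
  assumes f: "f \<noteq> 0" "pev f a = 0"
  shows "\<exists>c. mpow a (degree f) = (\<Sum>i<degree f. smult_mat (c i) (mpow a i))"
proof -
  define m where "m = degree f"
  define h where "h = monom 1 m - smult (inverse (lead_coeff f)) f"
  have hc: "coeff h i = 0" if "m \<le> i" for i
    using that f(1) by (cases "i = m") (auto simp: h_def m_def coeff_eq_0)
  have "mpow a m = pev h a"
    by (simp add: h_def pev_diff pev_smult f(2) matrix_mult_ring pev_monom)
  also have "\<dots> = (\<Sum>i<m. smult_mat (coeff h i) (mpow a i))"
  proof (cases "h = 0")
    case True
    then show ?thesis by (simp add: smult_mat_eq mat_ring matrix_mult_ring)
  next
    case False
    then have "degree h < m" using hc by (metis leading_coeff_0_iff not_le)
    then show ?thesis by (rule pev_as_sum)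
  qed
  finally show ?thesis unfolding m_def by blast
qed

lemma deg_Fbeta_le: "f \<noteq> 0 \<Longrightarrow> pev f a = 0 \<Longrightarrow> deg_Fbeta a \<le> degree f"
  unfolding deg_Fbeta_def by (rule Least_le) (rule minimal_relation)

lemma Fbeta_field_inverse:
  assumes "Fbeta_is_field b" "pev f b \<noteq> 0"
  shows "\<exists>g. pev f b ** pev g b = mat 1"
  using assms unfolding Fbeta_is_field_def Fbeta_eq by auto

text \<open>Sufficiently many powers of \<open>b\<close> applied to one nonzero vector are
  dependent; since \<open>Fbeta b\<close> is a field, a polynomial value that kills a nonzero vector
  is zero.\<close>

lemma annihilating_polynomial:
  fixes b :: "'k::field^'n^'n"
  assumes fld: "Fbeta_is_field b"
  shows "\<exists>f. f \<noteq> 0 \<and> pev f b = 0"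
proof -
  obtain v :: "'k^'n" where v: "v \<noteq> 0" by (metis axis_eq_0_iff zero_neq_one)
  define m where "m = Suc (vec.dim (UNIV :: ('k^'n) set))"
  have "\<not> (\<forall>c i. (\<Sum>i<m. c i *s (mpow b i *v v)) = 0 \<longrightarrow> i < m \<longrightarrow> c i = 0)"
    using independent_family_bound[where m = m and v = "\<lambda>i. mpow b i *v v"] by (auto simp: m_def)
  then obtain c i where c: "(\<Sum>i<m. c i *s (mpow b i *v v)) = 0" "i < m" "c i \<noteq> 0" by auto
  define f where "f = (\<Sum>i<m. monom (c i) i)"
  have "coeff f i = c i" using c(2) by (simp add: f_def coeff_sum)
  then have "f \<noteq> 0" using c(3) by auto
  have "pev f b *v v = (\<Sum>i<m. c i *s (mpow b i *v v))"
  proof -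
    have "(\<Sum>i\<in>I. A i) *v v = (\<Sum>i\<in>I. A i *v v)" for A :: "nat \<Rightarrow> 'k^'n^'n" and I
      by (induction I rule: infinite_finite_induct) (simp_all add: matrix_vector_ring)
    then show ?thesis by (simp add: f_def pev_sum pev_monom matrix_vector_ring mat_mult_vector)
  qed
  then have z: "pev f b *v v = 0" using c by simp
  have "pev f b = 0"
  proof (rule ccontr)
    assume "pev f b \<noteq> 0"
    then obtain g where "pev f b ** pev g b = mat 1" using Fbeta_field_inverse[OF fld] by blast
    then have "pev g b ** pev f b = mat 1" by (simp add: pev_commute)
    then have "pev g b *v (pev f b *v v) = v" by (simp flip: matrix_vector_ring(5))
    then show False using z v by simp
  qed
  then show ?thesis using \<open>f \<noteq> 0\<close> by blast
qed

lemma pure_elt_of_pure_stratum: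
  fixes \<Lambda> :: "int \<Rightarrow> ('k::field^'n) set"
  assumes L: "latseq val e \<Lambda>" and pure: "pure_stratum \<Lambda> q r b"
  shows "\<exists>P. pure_elt val e \<Lambda> b P \<and> degree P = deg_Fbeta b"
proof -
  interpret latseq val e \<Lambda> by (rule L)
  have fld: "Fbeta_is_field b"
    and norm: "\<And>x. x \<in> Fbeta b \<Longrightarrow> x \<noteq> 0 \<Longrightarrow> \<exists>k::int. \<forall>s. (\<lambda>v. x *v v) ` \<Lambda> s = \<Lambda> (s + k)"
    using pure unfolding pure_stratum_def by blast+
  define d where "d = deg_Fbeta b"
  have "\<exists>m c. mpow b m = (\<Sum>i<m. smult_mat (c i) (mpow b i))"
    using annihilating_polynomial[OF fld] minimal_relation by blast
  then have "\<exists>c. mpow b d = (\<Sum>i<d. smult_mat (c i) (mpow b i))"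
    unfolding d_def deg_Fbeta_def by (rule LeastI_ex)
  then obtain c where c: "mpow b d = (\<Sum>i<d. smult_mat (c i) (mpow b i))" by blast
  define P where "P = monom 1 d - (\<Sum>i<d. monom (c i) i)"
  have cP: "coeff P i = (if i = d then 1 else if i < d then - c i else 0)" for i
    by (simp add: P_def coeff_sum)
  have dP: "degree P = d"
    by (rule antisym[OF degree_le le_degree]) (auto simp: cP)
  have monic: "lead_coeff P = 1" by (simp add: dP cP)
  have root: "pev P b = 0"
    using c by (simp add: P_def pev_diff pev_sum pev_monom smult_mat_eq matrix_mult_ring)
  have dpos: "0 < d"
  proof (rule ccontr)
    assume "\<not> 0 < d"
    then have "mat 1 = (0 :: 'k^'n^'n)" using c by simp
    then have "mat 1 *v v = 0" for v :: "'k^'n" by simp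
    then have "v = 0" for v :: "'k^'n" by simp
    then show False by (metis axis_eq_0_iff zero_neq_one)
  qed
  have "pure_elt val e \<Lambda> b P"
  proof unfold_locales
    fix f :: "'k poly" assume f: "f \<noteq> 0" "degree f < degree P"
    have nz: "pev f b \<noteq> 0" using deg_Fbeta_le[OF f(1), of b] f(2) dP by (auto simp: d_def)
    obtain g where g: "pev f b ** pev g b = mat 1" using Fbeta_field_inverse[OF fld nz] by blast
    obtain k where "\<forall>s. (\<lambda>v. pev f b *v v) ` \<Lambda> s = \<Lambda> (s + k)"
      using norm[of "pev f b"] nz by (auto simp: Fbeta_eq)
    then have "sh k (pev f b)" using g sh_iff_image by blast
    then show "\<exists>n. sh n (pev f b)" by blast
  qed (use monic dP dpos root in auto)
  then show ?thesis using dP d_def by blast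
qed

lemma (in latseq) strata_equiv_iff: "strata_equiv \<Lambda> q r a c \<longleftrightarrow> a - c \<in> filt \<Lambda> (- r)"
proof
  assume "strata_equiv \<Lambda> q r a c"
  then have "(\<lambda>x. a + x) ` filt \<Lambda> (- r - 0) = (\<lambda>x. c + x) ` filt \<Lambda> (- r - 0)"
    unfolding strata_equiv_def by blast
  then have "(\<lambda>x. a + x) ` filt \<Lambda> (- r) = (\<lambda>x. c + x) ` filt \<Lambda> (- r)" by simp
  moreover have "a \<in> (\<lambda>x. a + x) ` filt \<Lambda> (- r)" by (rule image_eqI[of _ _ 0]) (simp_all add: filt_zero)
  ultimately obtain x where "a = c + x" "x \<in> filt \<Lambda> (- r)" by blast
  then show "a - c \<in> filt \<Lambda> (- r)" by simp
next
  assume ac: "a - c \<in> filt \<Lambda> (- r)"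
  have sub: "(\<lambda>x. a + x) ` filt \<Lambda> (- r - j) \<subseteq> (\<lambda>x. c + x) ` filt \<Lambda> (- r - j)"
    if ac: "a - c \<in> filt \<Lambda> (- r)" and j: "j \<ge> 0" for a c j
  proof
    fix y assume "y \<in> (\<lambda>x. a + x) ` filt \<Lambda> (- r - j)"
    then obtain x where x: "y = a + x" "x \<in> filt \<Lambda> (- r - j)" by blast
    have "(a - c) + x \<in> filt \<Lambda> (- r - j)"
      using filt_mono[OF ac, of "- r - j"] j x(2) by (simp add: filt_add)
    moreover have "y = c + ((a - c) + x)" using x(1) by simp
    ultimately show "y \<in> (\<lambda>x. c + x) ` filt \<Lambda> (- r - j)" by blast
  qed
  show "strata_equiv \<Lambda> q r a c"
    unfolding strata_equiv_def using sub[OF ac] sub[OF filt_diff_sym[OF ac]] by blast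
qed

text \<open>The approximant turns \<open>Q\<close> into an honest pure element near
  \<open>b\<close>: it is a root of \<open>Q\<close>, and the inverses modulo \<open>Q\<close> and
  the weights pass to it exactly. The resulting stratum is equivalent to the given one and has
  degree at most that of \<open>Q\<close>.\<close>

lemma simple_stratum_minimal:
  fixes \<Lambda> :: "int \<Rightarrow> ('k::field^'n) set"
  assumes L: "latseq val e \<Lambda>" and pure: "pure_stratum \<Lambda> q r b"
    and simple: "\<And>b'. pure_stratum \<Lambda> q r b' \<Longrightarrow> strata_equiv \<Lambda> q r b b' \<Longrightarrow> deg_Fbeta b \<le> deg_Fbeta b'"
    and Q: "lead_coeff Q = 1" "degree Q < deg_Fbeta b" and A: "apx val e \<Lambda> b Q w"
    and om: "\<And>g. lead_coeff g = 1 \<Longrightarrow> degree g = degree Q - 1 \<Longrightarrow> w g \<le> om"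
    and Qb: "pev Q b \<in> filt \<Lambda> (om + - r)"
  shows False
proof -
  interpret A: apx val e \<Lambda> b Q w by (rule A)
  obtain \<gamma> where \<gamma>: "\<gamma> - b \<in> filt \<Lambda> (- r)" "pev Q \<gamma> = 0"
    and shg: "\<And>f. f \<noteq> 0 \<Longrightarrow> degree f < degree Q \<Longrightarrow> A.sh (w f) (pev f \<gamma>)"
    using A.approximant[OF om Qb] by blast
  have qr: "q \<ge> r" "r \<ge> 0" "- q < - r" and bq: "b \<in> filt \<Lambda> (- q)" "b \<notin> filt \<Lambda> (- q + 1)"
    using pure unfolding pure_stratum_def stratum_def by blast+
  have red: "pev f \<gamma> = pev (f mod Q) \<gamma>" for f
  proof -
    have "f = Q * (f div Q) + f mod Q" by simp
    then have "pev f \<gamma> = pev (Q * (f div Q) + f mod Q) \<gamma>" by simp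
    then show ?thesis by (simp only: pev_add pev_mult \<gamma>(2) matrix_mult_ring) simp
  qed
  have nz: "f mod Q \<noteq> 0" if "pev f \<gamma> \<noteq> 0" for f
    using that red[of f] by auto
  have "Fbeta_is_field \<gamma>"
    unfolding Fbeta_is_field_def
  proof (intro ballI impI)
    fix x assume "x \<in> Fbeta \<gamma>" "x \<noteq> 0"
    then obtain f where f: "x = pev f \<gamma>" "pev f \<gamma> \<noteq> 0" by (auto simp: Fbeta_eq)
    obtain g where g: "((f mod Q) * g) mod Q = 1" using A.field_inverse[OF nz[OF f(2)] A.mod_deg] by blast
    have "x ** pev g \<gamma> = pev ((f mod Q) * g) \<gamma>" by (simp add: f(1) red[of f] pev_mult)
    also have "\<dots> = mat 1" using red[of "(f mod Q) * g"] g by simp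
    finally show "\<exists>y\<in>Fbeta \<gamma>. x ** y = mat 1" by (auto simp: Fbeta_eq)
  qed
  moreover have "\<exists>k::int. \<forall>s. (\<lambda>v. x *v v) ` \<Lambda> s = \<Lambda> (s + k)" if x: "x \<in> Fbeta \<gamma>" "x \<noteq> 0" for x
  proof -
    obtain f where f: "x = pev f \<gamma>" "pev f \<gamma> \<noteq> 0" using x by (auto simp: Fbeta_eq)
    have "A.sh (w (f mod Q)) x" unfolding f(1) red[of f] by (rule shg[OF nz[OF f(2)] A.mod_deg])
    then show ?thesis unfolding A.sh_iff_image by blast
  qed
  \<comment> \<open>As \<open>- q < - r\<close>, a change in depth \<open>- r\<close> does not
    affect the exact valuation \<open>- q\<close>.\<close>
  moreover have "\<gamma> \<in> filt \<Lambda> (- q)" "\<gamma> \<notin> filt \<Lambda> (- q + 1)"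
    using A.filt_congr[OF A.filt_mono[OF \<gamma>(1)]] qr bq by auto
  ultimately have "pure_stratum \<Lambda> q r \<gamma>"
    unfolding pure_stratum_def stratum_def using qr by blast
  moreover have "strata_equiv \<Lambda> q r b \<gamma>"
    unfolding A.strata_equiv_iff by (rule A.filt_diff_sym[OF \<gamma>(1)])
  ultimately have "deg_Fbeta b \<le> deg_Fbeta \<gamma>" by (rule simple)
  also have "\<dots> \<le> degree Q" by (rule deg_Fbeta_le[OF A.P_nonzero \<gamma>(2)])
  finally show False using Q(2) by simp
qed

context pure_elt
begin

text \<open>The congruences carry the exact product law from \<open>b\<close> to \<open>y\<close>
  with a gain of one level. For \<open>P\<close>, whose value at \<open>b\<close> is 0, the
  Bezoutian bound gives the depth at \<open>y\<close>; the polynomial \<open>g\<close> records the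
  maximal weight in degree \<open>degree P - 1\<close>.\<close>

lemma near_apx:
  assumes kl: "\<And>f. f \<noteq> 0 \<Longrightarrow> degree f < degree P \<Longrightarrow> pev f y - pev f b \<in> filt \<Lambda> (w f + 1)"
    and y: "y - b \<in> filt \<Lambda> n"
  shows "apx val e \<Lambda> y P w"
    and "\<exists>g. lead_coeff g = 1 \<and> degree g = degree P - 1 \<and>
      (\<forall>h. lead_coeff h = 1 \<longrightarrow> degree h = degree P - 1 \<longrightarrow> w h \<le> w g) \<and> pev P y \<in> filt \<Lambda> (w g + n)"
proof -
  interpret B: apx val e \<Lambda> b P w by (rule exact_apx)
  have shy: "sh (w f) (pev f y)" if "f \<noteq> 0" "degree f < degree P" for f
    by (rule sh_perturb[OF w_sh kl]) (use that in auto)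
  show "apx val e \<Lambda> y P w"
  proof unfold_locales
    fix f g :: "'k poly" assume fg: "f \<noteq> 0" "g \<noteq> 0" "degree f < degree P" "degree g < degree P"
    define r where "r = (f * g) mod P"
    have r: "r \<noteq> 0" "w r = w f + w g" "degree r < degree P"
      using B.mult_mod[OF fg] B.mod_deg by (auto simp: r_def)
    have ex: "pev f b ** pev g b = pev r b"
    proof -
      have "f * g = P * (f * g div P) + r" by (simp add: r_def)
      then have "pev (f * g) b = pev (P * (f * g div P) + r) b" by simp
      then show ?thesis by (simp only: pev_mult pev_add minpoly_root matrix_mult_ring) simp
    qed
    have "pev f y ** pev g y - pev r y
      = pev f y ** (pev g y - pev g b) + (pev f y - pev f b) ** pev g b - (pev r y - pev r b)"
      using ex by (simp add: matrix_mult_ring)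
    moreover have "pev f y ** (pev g y - pev g b) \<in> filt \<Lambda> (w f + w g + 1)"
      by (rule filt_mult_le[OF sh_filt[OF shy] kl]) (use fg in auto)
    moreover have "(pev f y - pev f b) ** pev g b \<in> filt \<Lambda> (w f + w g + 1)"
      by (rule filt_mult_le[OF kl w_filt]) (use fg in auto)
    moreover have "pev r y - pev r b \<in> filt \<Lambda> (w f + w g + 1)"
      using kl[OF r(1,3)] r(2) by simp
    ultimately show "pev f y ** pev g y - pev ((f * g) mod P) y \<in> filt \<Lambda> (w f + w g + 1)"
      unfolding r_def[symmetric] by (simp only: filt_add filt_diff)
  qed (use minpoly_monic minpoly_deg shy in auto)
  have "\<forall>i<degree P. \<exists>g. lead_coeff g = 1 \<and> degree g = i \<and> (\<forall>h. lead_coeff h = 1 \<longrightarrow> degree h = i \<longrightarrow> w h \<le> w g)"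
    using max_monic by auto
  then obtain G where G: "\<And>i. i < degree P \<Longrightarrow> lead_coeff (G i) = 1 \<and> degree (G i) = i \<and>
      (\<forall>h. lead_coeff h = 1 \<longrightarrow> degree h = i \<longrightarrow> w h \<le> w (G i))"
    by metis
  have "pev P y - pev P b \<in> filt \<Lambda> (w (G (degree P - 1)) + n)"
    by (rule B.bezoutian_bound[OF G sh_filt[OF shy] y])
  then have "pev P y \<in> filt \<Lambda> (w (G (degree P - 1)) + n)" by (simp add: minpoly_root)
  then show "\<exists>g. lead_coeff g = 1 \<and> degree g = degree P - 1 \<and>
      (\<forall>h. lead_coeff h = 1 \<longrightarrow> degree h = degree P - 1 \<longrightarrow> w h \<le> w g) \<and> pev P y \<in> filt \<Lambda> (w g + n)"
    using G[of "degree P - 1"] minpoly_deg by (intro exI[of _ "G (degree P - 1)"]) auto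
qed

end

section \<open>Comparison of approximate field structures on two lattice sequences\<close>

lemma apx_transport:
  fixes g gi x y :: "'k::field^'n^'n"
  assumes A: "apx val e \<Lambda> y P w" and g: "g ** gi = mat 1" "gi ** g = mat 1" and xy: "g ** x = y ** g"
  shows "apx val e (\<lambda>s. {v. g *v v \<in> \<Lambda> s}) x P w"
proof -
  interpret A: apx val e \<Lambda> y P w by (rule A)
  have L: "latseq val e \<Lambda>" ..
  interpret B: latseq val e "\<lambda>s. {v. g *v v \<in> \<Lambda> s}" by (rule latseq_transport[OF L g])
  show ?thesis
  proof unfold_locales
    fix f h :: "'k poly" assume fh: "f \<noteq> 0" "h \<noteq> 0" "degree f < degree P" "degree h < degree P"
    have "g ** (pev f x ** pev h x - pev ((f * h) mod P) x) = (pev f y ** pev h y - pev ((f * h) mod P) y) ** g"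
      using pev_conj[OF xy, of "f * h - (f * h) mod P"] by (simp add: pev_diff pev_mult)
    then show "pev f x ** pev h x - pev ((f * h) mod P) x \<in> filt (\<lambda>s. {v. g *v v \<in> \<Lambda> s}) (w f + w h + 1)"
      using filt_transport[OF g] A.x_mult[OF fh] by blast
  qed (use A.P_monic A.P_deg sh_transport[OF L g pev_conj[OF xy] A.x_sh] in auto)
qed

text \<open>The weight of \<open>f\<close> is the growth rate of the powers of
  \<open>pev f x\<close>, which both lattice sequences measure alike.\<close>

lemma apx_shift_eq:
  fixes x :: "'k::field^'n^'n"
  assumes A: "apx val e \<Lambda> x P w" and A': "apx val e \<Lambda>' x P' w'"
    and f: "f \<noteq> 0" "degree f < degree P" "degree f < degree P'"
  shows "w f = w' f"
proof -
  interpret A: apx val e \<Lambda> x P w by (rule A)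
  interpret B: apx val e \<Lambda>' x P' w' by (rule A')
  have L: "latseq val e \<Lambda>" and L': "latseq val e \<Lambda>'" by unfold_locales
  show ?thesis
    using spectral_comparison[OF L L' A.sh_filt[OF A.x_sh[OF f(1,2)]] B.x_sh[OF f(1,3)]]
      spectral_comparison[OF L' L B.sh_filt[OF B.x_sh[OF f(1,3)]] A.x_sh[OF f(1,2)]] by simp
qed

text \<open>If \<open>P\<close> had smaller degree than \<open>P'\<close>, it would have a weight in
  the structure of \<open>P'\<close>. Growth comparison turns the depth at \<open>x\<close> of
  \<open>P\<close>, and of the multiples of \<open>P\<close> arising in divisions, into lower bounds
  for weights, hence into the same depths at \<open>b\<close>; then \<open>P\<close> contradicts the
  minimality of \<open>b\<close>.\<close>

lemma approximate_degree_le: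
  fixes x b :: "'k::field^'n^'n"
  assumes A: "apx val e \<Lambda> x P w" and A': "apx val e \<Lambda>' x P' w'"
    and om: "\<And>g. lead_coeff g = 1 \<Longrightarrow> degree g = degree P - 1 \<Longrightarrow> w g \<le> om"
    and Px: "pev P x \<in> filt \<Lambda> (om + n)"
    and E: "pure_elt val e \<Lambda>'' b P'" and w': "w' = pure_elt.w \<Lambda>'' b"
    and min: "\<And>Q om. lead_coeff Q = 1 \<Longrightarrow> 0 < degree Q \<Longrightarrow> degree Q < degree P' \<Longrightarrow> apx val e \<Lambda>'' b Q w' \<Longrightarrow>
      (\<And>g. lead_coeff g = 1 \<Longrightarrow> degree g = degree Q - 1 \<Longrightarrow> w' g \<le> om) \<Longrightarrow> pev Q b \<in> filt \<Lambda>'' (om + n) \<Longrightarrow> False"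
  shows "degree P' \<le> degree P"
proof (rule ccontr)
  assume "\<not> ?thesis"
  then have lt: "degree P < degree P'" by simp
  interpret A: apx val e \<Lambda> x P w by (rule A)
  interpret B: apx val e \<Lambda>' x P' w' by (rule A')
  interpret E: pure_elt val e \<Lambda>'' b P' by (rule E)
  have L: "latseq val e \<Lambda>" and L': "latseq val e \<Lambda>'" by unfold_locales
  have weq: "w' f = w f" if "f \<noteq> 0" "degree f < degree P" for f
    using apx_shift_eq[OF A A'] that lt by simp
  have shb: "E.sh (w' f) (pev f b)" if "f \<noteq> 0" "degree f < degree P'" for f
    unfolding w' using E.w_sh that by blast
  have "om + n \<le> w' P"
    by (rule spectral_comparison[OF L L' Px B.x_sh[OF A.P_nonzero lt]])
  then have Pb: "pev P b \<in> filt \<Lambda>'' (om + n)"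
    by (rule E.filt_mono[OF E.sh_filt[OF shb[OF A.P_nonzero lt]]])
  have "apx val e \<Lambda>'' b P w'"
  proof unfold_locales
    fix f g :: "'k poly" assume fg: "f \<noteq> 0" "g \<noteq> 0" "degree f < degree P" "degree g < degree P"
    define q r where "q = (f * g) div P" and "r = (f * g) mod P"
    have qr: "f * g = q * P + r" by (simp add: q_def r_def)
    have eq: "pev f z ** pev g z - pev r z = pev q z ** pev P z" for z :: "'k^'n^'n"
      using arg_cong[OF qr, of "\<lambda>f. pev f z"] by (simp add: pev_mult pev_add)
    have "pev q b ** pev P b \<in> filt \<Lambda>'' (w' f + w' g + 1)"
    proof (cases "q = 0")
      case False
      have "degree q < degree P"
      proof -
        have "degree (q * P) = degree q + degree P" using False A.P_nonzero by (simp add: degree_mult_eq)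
        moreover have "q * P = f * g - r" using qr by simp
        moreover have "degree (f * g - r) \<le> max (degree f + degree g) (degree r)"
          using degree_diff_le_max[of "f * g" r] degree_mult_le[of f g] by linarith
        moreover have "degree r < degree P" unfolding r_def by (rule A.mod_deg)
        ultimately show ?thesis using fg by auto
      qed
      then have dq: "degree q < degree P'" using lt by simp
      \<comment> \<open>The deviation from the product law at \<open>x\<close> is the value of
        \<open>q * P\<close>, so this product has large weight, and the same weight governs it at
        \<open>b\<close>.\<close>
      have "pev q x ** pev P x \<in> filt \<Lambda> (w f + w g + 1)"
        using A.x_mult[OF fg] eq[of x] by (simp add: r_def)
      then have "w f + w g + 1 \<le> w' q + w' P"
        by (rule spectral_comparison[OF L L' _ B.sh_mult[OF B.x_sh[OF False dq] B.x_sh[OF A.P_nonzero lt]]])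
      then show ?thesis
        using E.filt_mono[OF E.sh_filt[OF E.sh_mult[OF shb[OF False dq] shb[OF A.P_nonzero lt]]]]
          weq fg by simp
    qed (simp add: matrix_mult_ring E.filt_zero)
    then show "pev f b ** pev g b - pev ((f * g) mod P) b \<in> filt \<Lambda>'' (w' f + w' g + 1)"
      using eq[of b] by (simp add: r_def)
  qed (use A.P_monic A.P_deg shb lt in auto)
  then show False
  proof (rule min[OF A.P_monic A.P_deg lt _ _ Pb])
    fix g :: "'k poly" assume g: "lead_coeff g = 1" "degree g = degree P - 1"
    then have "g \<noteq> 0" by auto
    then show "w' g \<le> om" using om[OF g] weq[of g] g(2) A.P_deg by simp
  qed
qed

text \<open>Reductions modulo \<open>P\<close> and modulo \<open>P'\<close> differ by a polynomial
  \<open>t\<close> of degree below \<open>degree P\<close>. Were its weight too small, a deviation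
  known to be deep on \<open>\<Lambda>\<close> would be a normalizing element of that small weight
  on \<open>\<Lambda>'\<close>, against its growth rate. The same argument with
  \<open>t = P - P'\<close> gives the depth of \<open>pev P x\<close>.\<close>

lemma joint_apx:
  fixes x :: "'k::field^'n^'n"
  assumes A: "apx val e \<Lambda> x P w" and A': "apx val e \<Lambda>' x P' w'" and deg: "degree P' = degree P"
    and g: "lead_coeff g = 1" "degree g = degree P - 1"
    and Px: "pev P x \<in> filt \<Lambda> (w g + n)"
    and om': "\<And>h. lead_coeff h = 1 \<Longrightarrow> degree h = degree P' - 1 \<Longrightarrow> w' h \<le> om'"
    and P'x: "pev P' x \<in> filt \<Lambda>' (om' + n)"
  shows "apx val e \<Lambda>' x P w" and "pev P x \<in> filt \<Lambda>' (w g + n)"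
proof -
  interpret A: apx val e \<Lambda> x P w by (rule A)
  interpret B: apx val e \<Lambda>' x P' w' by (rule A')
  have L: "latseq val e \<Lambda>" and L': "latseq val e \<Lambda>'" by unfold_locales
  have weq: "w' f = w f" if "f \<noteq> 0" "degree f < degree P" for f
    using apx_shift_eq[OF A A'] that deg by simp
  have shB: "B.sh (w f) (pev f x)" if "f \<noteq> 0" "degree f < degree P" for f
    using B.x_sh[of f] that weq deg by simp
  show "apx val e \<Lambda>' x P w"
  proof unfold_locales
    fix f h :: "'k poly" assume fh: "f \<noteq> 0" "h \<noteq> 0" "degree f < degree P" "degree h < degree P"
    define t where "t = (f * h) mod P - (f * h) mod P'"
    define T where "T = pev ((f * h) mod P) x - pev f x ** pev h x"
    define k where "k = w f + w h"
    have dt: "degree t < degree P"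
      unfolding t_def using A.mod_deg[of "f * h"] B.mod_deg[of "f * h"] deg by (intro degree_diff_less) auto
    have T: "T - pev t x \<in> filt \<Lambda>' (k + 1)"
      using B.filt_uminus[OF B.x_mult[of f h]] fh deg weq
      by (simp add: T_def t_def k_def pev_diff)
    have TA: "T \<in> filt \<Lambda> (k + 1)"
      using A.filt_uminus[OF A.x_mult[OF fh]] by (simp add: T_def k_def)
    have "t = 0 \<or> k + 1 \<le> w t"
    proof (rule ccontr)
      assume neg: "\<not> ?thesis"
      then have "B.sh (w t) T"
        by (intro B.sh_perturb[OF shB B.filt_mono[OF T]]) (use dt in auto)
      from spectral_comparison[OF L L' TA this] neg show False by simp
    qed
    then have "pev t x \<in> filt \<Lambda>' (k + 1)"
      using shB[of t] dt by (cases "t = 0") (auto simp: B.filt_zero intro: B.filt_mono[OF B.sh_filt])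
    then have "- T \<in> filt \<Lambda>' (k + 1)" using B.filt_congr[OF T] B.filt_uminus by blast
    then show "pev f x ** pev h x - pev ((f * h) mod P) x \<in> filt \<Lambda>' (w f + w h + 1)"
      by (simp add: T_def k_def)
  qed (use A.P_monic A.P_deg shB in auto)
  define t where "t = P - P'"
  have dt: "degree t < degree P"
  proof -
    have "coeff t i = 0" if "degree P \<le> i" for i
      using that A.P_monic B.P_monic deg by (cases "i = degree P") (auto simp: t_def coeff_eq_0)
    then show ?thesis using A.P_deg by (metis degree_0 leading_coeff_0_iff not_le)
  qed
  have gn: "g \<noteq> 0" using g by auto
  have "w g \<le> om'" using om'[OF g(1)] g(2) deg weq[OF gn] A.P_deg by simp
  then have P'x': "pev P x - pev t x \<in> filt \<Lambda>' (w g + n)"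
    using B.filt_mono[OF P'x] by (simp add: t_def pev_diff)
  have "t = 0 \<or> w g + n \<le> w t"
  proof (rule ccontr)
    assume neg: "\<not> ?thesis"
    then have "B.sh (w t) (pev P x)"
      by (intro B.sh_perturb[OF shB B.filt_mono[OF P'x']]) (use dt in auto)
    from spectral_comparison[OF L L' Px this] neg show False by simp
  qed
  then have "pev t x \<in> filt \<Lambda>' (w g + n)"
    using shB[of t] dt by (cases "t = 0") (auto simp: B.filt_zero intro: B.filt_mono[OF B.sh_filt])
  then show "pev P x \<in> filt \<Lambda>' (w g + n)" using B.filt_congr[OF P'x'] by blast
qed

section \<open>Duality of lattices\<close>

text \<open>Duality is set up once, to serve both the hermitian space and its double. Hermitian
  symmetry is kept as equality of valuation bounds (\<open>H_sym\<close>), and nondegeneracy as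
  representability of functionals (\<open>H_rep\<close>).\<close>

locale dualspace = vector_space scale
  for scale :: "'k::field \<Rightarrow> 'v::ab_group_add \<Rightarrow> 'v" (infixr "\<cdot>" 75) +
  fixes val :: "'k \<Rightarrow> int" and \<rho> :: "'k \<Rightarrow> 'k" and H :: "'v \<Rightarrow> 'v \<Rightarrow> 'k"
  assumes dv: "discrete_valuation val" and rho_val: "x \<noteq> 0 \<Longrightarrow> \<rho> x \<noteq> 0 \<and> val (\<rho> x) = val x"
    and rho_zero: "\<rho> 0 = 0"
    and fin_dim: "\<exists>B. finite B \<and> span B = UNIV"
    and H_add_left: "H (v + v') z = H v z + H v' z" and H_add_right: "H v (z + z') = H v z + H v z'"
    and H_scale_left: "H (c \<cdot> v) z = \<rho> c * H v z" and H_scale_right: "H v (c \<cdot> z) = H v z * c"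
    and H_sym: "pin val n (H v z) \<longleftrightarrow> pin val n (H z v)"
    and H_rep: "Vector_Spaces.linear scale (*) \<phi> \<Longrightarrow> \<exists>v. \<forall>z. \<phi> z = H v z"
begin

lemma H_diff_left: "H (v - v') z = H v z - H v' z"
  using H_add_left[of "v - v'" v' z] by simp

lemma H_diff_right: "H v (z - z') = H v z - H v z'"
  using H_add_right[of v "z - z'" z'] by simp

lemma H_zero [simp]: "H 0 z = 0" "H v 0 = 0"
  using H_diff_left[of 0 0 z] H_diff_right[of v 0 0] by simp_all

lemma H_linear: "Vector_Spaces.linear scale (*) (H v)"
  by unfold_locales (simp_all add: H_add_right H_scale_right algebra_simps)

definition submod :: "'v set \<Rightarrow> bool" where
  "submod M \<longleftrightarrow> 0 \<in> M \<and> (\<forall>v\<in>M. \<forall>z\<in>M. v + z \<in> M) \<and> (\<forall>c. pin val 0 c \<longrightarrow> (\<forall>v\<in>M. c \<cdot> v \<in> M))"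

text \<open>Full lattices, with finite generation expressed as absorption of every vector together
  with boundedness under every functional.\<close>

definition lat :: "'v set \<Rightarrow> bool" where
  "lat M \<longleftrightarrow> submod M \<and> (\<forall>v. \<exists>c. c \<noteq> 0 \<and> c \<cdot> v \<in> M) \<and>
     (\<forall>\<phi>. Vector_Spaces.linear scale (*) \<phi> \<longrightarrow> (\<exists>N. \<forall>v\<in>M. pin val N (\<phi> v)))"

definition dual :: "'v set \<Rightarrow> 'v set" where
  "dual M = {v. \<forall>z\<in>M. pin val 1 (H v z)}"

definition plus_set :: "'v set \<Rightarrow> 'v set \<Rightarrow> 'v set" where
  "plus_set A B = {a + b |a b. a \<in> A \<and> b \<in> B}"

lemma submod_zero: "submod M \<Longrightarrow> 0 \<in> M" and submod_add: "submod M \<Longrightarrow> v \<in> M \<Longrightarrow> z \<in> M \<Longrightarrow> v + z \<in> M"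
  and submod_scale: "submod M \<Longrightarrow> pin val 0 c \<Longrightarrow> v \<in> M \<Longrightarrow> c \<cdot> v \<in> M"
  by (simp_all add: submod_def)

lemma submod_uminus: "submod M \<Longrightarrow> v \<in> M \<Longrightarrow> - v \<in> M"
  using submod_scale[of M "-1" v] pin_uminus[OF dv, of 0 1] pin_one[OF dv, of 0] by simp

lemma submod_diff: "submod M \<Longrightarrow> v \<in> M \<Longrightarrow> z \<in> M \<Longrightarrow> v - z \<in> M"
  using submod_add[of M v "- z"] submod_uminus by simp

text \<open>A nonarchimedean Hahn-Banach theorem: the functional is extended from the line of
  \<open>v\<close> by one dimension at a time along a finite spanning set.\<close>

lemma lat_separation:
  assumes M: "lat M" and v: "v \<notin> M"
  shows "\<exists>\<phi>. Vector_Spaces.linear scale (*) \<phi> \<and> \<phi> v = 1 \<and> (\<forall>m\<in>M. pin val 1 (\<phi> m))"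
proof -
  have sm: "submod M" and absb: "\<And>v. \<exists>c. c \<noteq> 0 \<and> c \<cdot> v \<in> M"
    and bd: "\<And>\<phi>. Vector_Spaces.linear scale (*) \<phi> \<Longrightarrow> \<exists>N. \<forall>v\<in>M. pin val N (\<phi> v)"
    using M by (auto simp: lat_def)
  have v0: "v \<notin> {0}" using v submod_zero[OF sm] by auto
  obtain B where B: "finite B" "span B = UNIV" using fin_dim by blast
  have "\<exists>\<phi>. Vector_Spaces.linear scale (*) \<phi> \<and> \<phi> v = 1 \<and> (\<forall>m\<in>M \<inter> span (insert v C). pin val 1 (\<phi> m))"
    if "finite C" for C
    using that
  proof (induction C)
    case empty
    obtain \<phi> where \<phi>: "Vector_Spaces.linear scale (*) \<phi>" "\<phi> v = 1"
      using separating_functional[OF _ v0] by auto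
    interpret l: Vector_Spaces.linear scale "(*)" \<phi> by (rule \<phi>(1))
    have "pin val 1 (\<phi> m)" if m: "m \<in> M" "m \<in> span {v}" for m
    proof -
      obtain c where c: "m = c \<cdot> v" using m(2) by (auto simp: span_singleton)
      have "pin val 1 c"
      proof (rule ccontr)
        assume neg: "\<not> pin val 1 c"
        then have c0: "c \<noteq> 0" "val c \<le> 0" by (auto simp: pin_def)
        then have "pin val 0 (inverse c)" using discrete_valuation_inverse[OF dv, of c] by (simp add: pin_def)
        then have "inverse c \<cdot> m \<in> M" using submod_scale[OF sm] m(1) by blast
        then show False using v c c0 by simp
      qed
      then show ?thesis using c \<phi>(2) by (simp add: l.scale)
    qed
    then show ?case using \<phi> by auto
  next
    case (insert x C)
    define W where "W = span (insert v C)"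
    have eqs: "span (insert v (insert x C)) = span (insert x (insert v C))" by (simp add: insert_commute)
    obtain \<phi> where \<phi>: "Vector_Spaces.linear scale (*) \<phi>" "\<phi> v = 1" "\<forall>m\<in>M \<inter> W. pin val 1 (\<phi> m)"
      using insert.IH by (auto simp: W_def)
    show ?case
    proof (cases "x \<in> W")
      case True
      then have "span (insert x (insert v C)) = W" unfolding W_def by (rule span_redundant)
      then show ?thesis using \<phi> eqs by auto
    next
      case False
      obtain \<psi> where \<psi>: "Vector_Spaces.linear scale (*) \<psi>" "\<psi> x = 1" "\<forall>z\<in>W. \<psi> z = 0"
        using separating_functional[OF _ False] by (auto simp: W_def)
      interpret l: Vector_Spaces.linear scale "(*)" \<phi> by (rule \<phi>(1))
      interpret p: Vector_Spaces.linear scale "(*)" \<psi> by (rule \<psi>(1))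
      have inW: "m - \<psi> m \<cdot> x \<in> W" if m: "m \<in> span (insert x (insert v C))" for m
      proof -
        obtain k where k: "m - k \<cdot> x \<in> W"
          using m by (auto simp: W_def span_insert)
        then have "\<psi> m = k" using \<psi>(2,3) by (force simp: p.diff p.scale)
        then show ?thesis using k by simp
      qed
      define X where "X = span (insert x (insert v C))"
      have X: "subspace X" by (simp add: X_def)
      have xX: "x \<in> X" by (simp add: X_def span_base)
      \<comment> \<open>Among the elements of \<open>M\<close> in the larger space,
        \<open>m0\<close> has the new coordinate \<open>\<psi>\<close> of least valuation. Making
        the extended functional vanish at \<open>m0\<close> keeps it small on \<open>M\<close>,
        because each element there differs from an integral multiple of \<open>m0\<close> by one of
        \<open>M \<inter> W\<close>.\<close>
      define Q where "Q m \<longleftrightarrow> m \<in> M \<and> m \<in> X \<and> \<psi> m \<noteq> 0" for m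
      obtain c where c: "c \<noteq> 0" "c \<cdot> x \<in> M" using absb by blast
      have Qc: "Q (c \<cdot> x)" using c \<psi>(2) X xX by (simp add: Q_def p.scale subspace_scale)
      obtain N where N: "\<forall>v\<in>M. pin val N (\<psi> v)" using bd[OF \<psi>(1)] by blast
      obtain m0 where m0: "Q m0" "\<forall>m. Q m \<longrightarrow> nat (val (\<psi> m0) - N) \<le> nat (val (\<psi> m) - N)"
        using ex_has_least_nat[of Q "c \<cdot> x" "\<lambda>m. nat (val (\<psi> m) - N)"] Qc by blast
      have least: "val (\<psi> m0) \<le> val (\<psi> m)" if "Q m" for m
      proof -
        have "N \<le> val (\<psi> m)" using N that by (auto simp: pin_def Q_def)
        moreover have "nat (val (\<psi> m0) - N) \<le> nat (val (\<psi> m) - N)" using m0(2) that by blast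
        ultimately show ?thesis by linarith
      qed
      have m0': "m0 \<in> M" "m0 \<in> X" "\<psi> m0 \<noteq> 0" using m0(1) by (auto simp: Q_def)
      define \<kappa> where "\<kappa> = - \<phi> m0 / \<psi> m0"
      define \<phi>' where "\<phi>' z = \<phi> z + \<kappa> * \<psi> z" for z
      have lin: "Vector_Spaces.linear scale (*) \<phi>'"
        by unfold_locales (simp_all add: \<phi>'_def l.add p.add l.scale p.scale algebra_simps)
      interpret l': Vector_Spaces.linear scale "(*)" \<phi>' by (rule lin)
      have z0: "\<phi>' m0 = 0" using m0'(3) by (simp add: \<phi>'_def \<kappa>_def)
      have "v \<in> W" by (simp add: W_def span_base)
      then have "\<phi>' v = 1" using \<phi>(2) \<psi>(3) by (simp add: \<phi>'_def)
      moreover have "pin val 1 (\<phi>' m)" if m: "m \<in> M" "m \<in> X" for m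
      proof -
        define a where "a = \<psi> m / \<psi> m0"
        have a: "pin val 0 a"
        proof (cases "\<psi> m = 0")
          case nz: False
          then have "val (\<psi> m0) \<le> val (\<psi> m)" using least m by (simp add: Q_def)
          moreover have "val a = val (\<psi> m) - val (\<psi> m0)"
            using discrete_valuation_mult[OF dv nz, of "inverse (\<psi> m0)"] discrete_valuation_inverse[OF dv m0'(3)] m0'(3)
            by (simp add: a_def divide_inverse)
          ultimately show ?thesis by (simp add: pin_def)
        qed (simp add: a_def)
        define z where "z = m - a \<cdot> m0"
        have "z \<in> M" unfolding z_def using sm submod_diff submod_scale a m m0' by blast
        moreover have "\<psi> z = 0" using m0'(3) by (simp add: z_def a_def p.diff p.scale)
        moreover have "z \<in> X" unfolding z_def using X m m0' by (simp add: subspace_diff subspace_scale)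
        ultimately have "z \<in> M \<inter> W" using inW[of z] by (simp add: X_def)
        then have "pin val 1 (\<phi>' z)" using \<phi>(3) \<psi>(3) by (simp add: \<phi>'_def)
        moreover have "\<phi>' m = \<phi>' z" using z0 by (simp add: z_def l'.diff l'.scale)
        ultimately show ?thesis by simp
      qed
      ultimately show ?thesis using lin eqs by (auto simp: X_def)
    qed
  qed
  note extended = this[OF B(1)]
  have "span (insert v B) = UNIV" using B(2) span_mono[of B "insert v B"] by auto
  then show ?thesis using extended by simp
qed

lemma dual_submod: "submod (dual M)"
  unfolding submod_def dual_def
proof (intro conjI ballI allI impI; clarsimp simp: H_add_left H_scale_left pin_add[OF dv])
  fix c v z assume c: "pin val 0 c" and v: "\<forall>z\<in>M. pin val 1 (H v z)" "z \<in> M"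
  have "pin val 0 (\<rho> c)" using c rho_val[of c] by (cases "c = 0") (auto simp: pin_def rho_zero)
  then show "pin val 1 (\<rho> c * H v z)" using pin_mult[OF dv, of 0 "\<rho> c" 1 "H v z"] v by simp
qed

lemma dual_anti: "A \<subseteq> B \<Longrightarrow> dual B \<subseteq> dual A"
  by (auto simp: dual_def)

lemma dual_dual:
  assumes "lat M"
  shows "dual (dual M) = M"
proof
  show "M \<subseteq> dual (dual M)" using H_sym by (auto simp: dual_def)
  show "dual (dual M) \<subseteq> M"
  proof (rule subsetI, rule ccontr)
    fix v assume v: "v \<in> dual (dual M)" "v \<notin> M"
    obtain \<phi> where \<phi>: "Vector_Spaces.linear scale (*) \<phi>" "\<phi> v = 1" "\<forall>m\<in>M. pin val 1 (\<phi> m)"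
      using lat_separation[OF assms v(2)] by blast
    obtain z where z: "\<forall>y. \<phi> y = H z y" using H_rep[OF \<phi>(1)] by blast
    have "z \<in> dual M" using \<phi>(3) z by (simp add: dual_def)
    then have "pin val 1 (H v z)" using v(1) by (simp add: dual_def)
    then have "pin val 1 (\<phi> v)" using H_sym z by simp
    then show False using \<phi>(2) pin_one[OF dv, of 1] by simp
  qed
qed

lemma lat_dual:
  assumes M: "lat M"
  shows "lat (dual M)"
  unfolding lat_def
proof (intro conjI allI impI dual_submod)
  fix v
  obtain N where N: "\<forall>z\<in>M. pin val N (H v z)" using M H_linear[of v] by (auto simp: lat_def)
  obtain c where c: "c \<noteq> 0" "val c = 1 - N" using discrete_valuation_power_int_ex[OF dv] by blast
  have "pin val 1 (\<rho> c * H v z)" if "z \<in> M" for z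
    using pin_mult[OF dv, of "1 - N" "\<rho> c" N "H v z"] N that rho_val[OF c(1)] c(2) by (simp add: pin_def)
  then show "\<exists>c. c \<noteq> 0 \<and> c \<cdot> v \<in> dual M" using c(1) by (auto simp: dual_def H_scale_left)
next
  fix \<phi> assume \<phi>: "Vector_Spaces.linear scale (*) \<phi>"
  obtain z where z: "\<forall>y. \<phi> y = H z y" using H_rep[OF \<phi>] by blast
  obtain c where c: "c \<noteq> 0" "c \<cdot> z \<in> M" using M unfolding lat_def by blast
  have "pin val (1 - val c) (\<phi> v)" if v: "v \<in> dual M" for v
  proof -
    have "pin val 1 (H v z * c)" using v c(2) by (auto simp: dual_def H_scale_right)
    moreover have "pin val (- val c) (inverse c)" using discrete_valuation_inverse[OF dv c(1)] by (simp add: pin_def)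
    ultimately have "pin val (1 + - val c) (H v z * c * inverse c)" by (rule pin_mult[OF dv])
    then have "pin val (1 - val c) (H v z)" using c(1) by (simp add: mult.assoc)
    then show ?thesis using H_sym z by simp
  qed
  then show "\<exists>N. \<forall>v\<in>dual M. pin val N (\<phi> v)" by blast
qed

lemma lat_sandwich:
  assumes "lat A" "lat B" "A \<subseteq> X" "X \<subseteq> B" "submod X"
  shows "lat X"
  using assms unfolding lat_def by (meson subsetD)

lemma plus_setI: "a \<in> A \<Longrightarrow> b \<in> B \<Longrightarrow> a + b \<in> plus_set A B"
  by (auto simp: plus_set_def)

lemma plus_setE:
  assumes "z \<in> plus_set A B"
  obtains a b where "a \<in> A" "b \<in> B" "z = a + b"
  using assms by (auto simp: plus_set_def)

lemma submod_plus:
  assumes A: "submod A" and B: "submod B"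
  shows "submod (plus_set A B)"
  unfolding submod_def
proof (intro conjI ballI allI impI)
  show "0 \<in> plus_set A B"
    using plus_setI[OF submod_zero[OF A] submod_zero[OF B]] by simp
  fix v assume "v \<in> plus_set A B"
  then obtain a b where v: "a \<in> A" "b \<in> B" "v = a + b" by (rule plus_setE)
  show "v + z \<in> plus_set A B" if zz: "z \<in> plus_set A B" for z
  proof -
    obtain a' b' where z: "a' \<in> A" "b' \<in> B" "z = a' + b'" using zz by (rule plus_setE)
    have "(a + a') + (b + b') \<in> plus_set A B"
      by (intro plus_setI submod_add A B v z)
    then show ?thesis by (simp add: v(3) z(3) add_ac)
  qed
  show "c \<cdot> v \<in> plus_set A B" if "pin val 0 c" for c
    using plus_setI[OF submod_scale[OF A that v(1)] submod_scale[OF B that v(2)]]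
    by (simp add: v(3) scale_right_distrib)
qed

lemma plus_subset: "submod A \<Longrightarrow> submod B \<Longrightarrow> A \<subseteq> plus_set A B \<and> B \<subseteq> plus_set A B"
  using plus_setI[OF _ submod_zero, of _ A B] plus_setI[OF submod_zero, of A _ B] by auto

lemma plus_least: "submod C \<Longrightarrow> A \<subseteq> C \<Longrightarrow> B \<subseteq> C \<Longrightarrow> plus_set A B \<subseteq> C"
  unfolding plus_set_def using submod_add by blast

lemma dual_plus: "submod A \<Longrightarrow> submod B \<Longrightarrow> dual (plus_set A B) = dual A \<inter> dual B"
proof
  assume "submod A" "submod B"
  then show "dual (plus_set A B) \<subseteq> dual A \<inter> dual B"
    using plus_subset dual_anti by blast
  show "dual A \<inter> dual B \<subseteq> dual (plus_set A B)"
    by (auto simp: dual_def plus_set_def H_add_right pin_add[OF dv])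
qed

lemma dual_Int:
  assumes A: "lat A" and B: "lat B" and D: "lat (plus_set (dual A) (dual B))"
  shows "dual (A \<inter> B) = plus_set (dual A) (dual B)"
proof -
  have "dual (plus_set (dual A) (dual B)) = A \<inter> B"
    by (simp add: dual_plus dual_submod dual_dual A B)
  then show ?thesis using dual_dual[OF D] by simp
qed

end

section \<open>Hermitian forms and residual isotropy\<close>

locale herm =
  fixes val :: "'k::field \<Rightarrow> int" and \<rho> :: "'k \<Rightarrow> 'k" and \<epsilon> :: 'k and h :: "'k^'n \<Rightarrow> 'k^'n \<Rightarrow> 'k"
  assumes val: "discrete_valuation val" and inv: "field_involution val \<rho>" and form: "eps_hermitian \<rho> \<epsilon> h"
begin

lemma rho: "\<rho> (x + y) = \<rho> x + \<rho> y" "\<rho> (x * y) = \<rho> x * \<rho> y" "\<rho> 1 = 1" "\<rho> (\<rho> x) = x"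
    "x \<noteq> 0 \<Longrightarrow> val (\<rho> x) = val x"
  using inv by (simp_all add: field_involution_def)

lemma rho_0 [simp]: "\<rho> 0 = 0"
  using rho(1)[of 0 0] by (metis add.left_neutral add_cancel_right_right)

lemma rho_diff: "\<rho> (x - y) = \<rho> x - \<rho> y"
  using rho(1)[of "x - y" y] by simp

lemma rho_eq_0: "\<rho> x = 0 \<longleftrightarrow> x = 0"
  using rho(4)[of x] by auto

lemma pin_rho: "pin val n (\<rho> x) \<longleftrightarrow> pin val n x"
  using rho(5)[of x] by (cases "x = 0") (auto simp: pin_def rho_eq_0)

lemma half:
  assumes two: "(2::'k) \<noteq> 0" "val 2 = 0"
  shows "\<exists>c. pin val 0 c \<and> c + c = 1 \<and> \<rho> c = c"
proof -
  define c :: 'k where "c = inverse 2"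
  have c: "pin val 0 c" "c + c = 1"
    using two discrete_valuation_inverse[OF val two(1)] by (auto simp: c_def pin_def field_simps)
  then have "\<rho> c + \<rho> c = 1" using rho(1)[of c c] rho(3) by simp
  then have "(1 + 1) * \<rho> c = (1 + 1) * c" using c(2) by (simp add: distrib_right)
  then have "\<rho> c = c" using two(1) by simp
  then show ?thesis using c by blast
qed

lemma eps: "\<epsilon> = 1 \<or> \<epsilon> = -1"
  using form by (simp add: eps_hermitian_def)

lemma h_add: "h (v + v') w = h v w + h v' w" "h v (w + w') = h v w + h v w'"
  using form by (simp_all add: eps_hermitian_def)

lemma h_both: "h (x *s v) (y *s w) = \<rho> x * \<epsilon> * \<rho> (h w v) * y"
  using form unfolding eps_hermitian_def by blast

lemma h_sym: "h v w = \<epsilon> * \<rho> (h w v)"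
  using h_both[of 1 v 1 w] by (simp add: rho)

lemma h_scale: "h (c *s v) w = \<rho> c * h v w" "h v (c *s w) = h v w * c"
  using h_both[of c v 1 w] h_both[of 1 v c w] h_sym[of v w] by (simp_all add: rho mult.assoc)

lemma h_zero [simp]: "h 0 w = 0" "h v 0 = 0"
  using h_scale(1)[of 0 0 w] h_scale(2)[of v 0 0] by simp_all

lemma h_minus: "h (- v) w = - h v w" "h v (- w) = - h v w"
  using h_add(1)[of v "- v" w] h_add(2)[of v w "- w"] by (simp_all add: eq_neg_iff_add_eq_0 add.commute)

lemma h_diff: "h (v - v') w = h v w - h v' w" "h v (w - w') = h v w - h v w'"
  using h_add(1)[of v "- v'" w] h_add(2)[of v w "- w'"] by (simp_all add: h_minus)

lemma h_nondeg: "(\<And>w. h v w = 0) \<Longrightarrow> v = 0"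
  using form by (simp add: eps_hermitian_def)

lemma h_nondeg_right: "(\<And>v. h v w = 0) \<Longrightarrow> w = 0"
  by (rule h_nondeg) (subst h_sym, simp)

lemma h_cancel_right: "(\<And>v. h v w = h v w') \<Longrightarrow> w = w'"
  using h_nondeg_right[of "w - w'"] by (simp add: h_diff)

lemma pin_eps: "pin val n (\<epsilon> * x) \<longleftrightarrow> pin val n x"
  using eps pin_uminus[OF val] by auto

lemma pin_h_sym: "pin val n (h v w) \<longleftrightarrow> pin val n (h w v)"
  by (subst h_sym) (simp add: pin_eps pin_rho)

lemma h_sum_left: "h (\<Sum>i\<in>I. f i) w = (\<Sum>i\<in>I. h (f i) w)"
  by (induction I rule: infinite_finite_induct) (simp_all add: h_add)

lemma h_sum_right: "h v (\<Sum>i\<in>I. f i) = (\<Sum>i\<in>I. h v (f i))"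
  by (induction I rule: infinite_finite_induct) (simp_all add: h_add)

lemma h_rep:
  assumes "Vector_Spaces.linear (*s) (*) \<phi>"
  shows "\<exists>v. \<forall>w. \<phi> w = h v w"
proof -
  interpret l: Vector_Spaces.linear "(*s)" "(*)" \<phi> by (rule assms)
  define A :: "'k^'n^'n" where "A = (\<chi> i j. h (axis j 1) (axis i 1))"
  \<comment> \<open>Conjugating the coordinates undoes the \<open>\<rho>\<close>-semilinearity of
    \<open>h\<close> in its first argument, so that the Gram matrix \<open>A\<close> acts
    linearly.\<close>
  define R where "R u = (\<Sum>j\<in>UNIV. \<rho> (u $ j) *s axis j 1)" for u :: "'k^'n"
  have R_comp: "R u $ j = \<rho> (u $ j)" for u j
    by (simp add: R_def axis_def if_distrib if_distribR sum.delta' cong: if_cong)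
  have A: "(A *v u) $ i = h (R u) (axis i 1)" for u i
    by (simp add: A_def R_def matrix_vector_mult_def h_sum_left h_scale rho mult.commute)
  have expand: "w = (\<Sum>i\<in>UNIV. (w $ i) *s axis i 1)" for w :: "'k^'n"
    by (simp add: basis_expansion)
  have h_exp: "h v w = (\<Sum>i\<in>UNIV. h v (axis i 1) * (w $ i))" for v w
    by (subst expand[of w]) (simp add: h_sum_right h_scale)
  have "u = 0" if "A *v u = 0" for u
  proof -
    have "h (R u) (axis i 1) = 0" for i using A[of u i] that by simp
    then have "h (R u) w = 0" for w by (subst h_exp) simp
    then have "R u = 0" by (rule h_nondeg)
    then have "\<rho> (u $ j) = 0" for j using R_comp[of u j] by simp
    then show ?thesis by (simp add: rho_eq_0 vec_eq_iff)
  qed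
  then have "\<exists>B. B ** A = mat 1" unfolding matrix_left_invertible_ker by blast
  then obtain B where "B ** A = mat 1" ..
  then have AB: "A ** B = mat 1" by (rule matrix_left_right_inverse[THEN iffD1])
  define y where "y = (\<chi> i. \<phi> (axis i 1))"
  have "A *v (B *v y) = y" using AB by (simp flip: matrix_vector_ring(5))
  then have "h (R (B *v y)) (axis i 1) = \<phi> (axis i 1)" for i
    using A[of "B *v y" i] by (simp add: y_def)
  then have "\<phi> w = h (R (B *v y)) w" for w
    by (subst h_exp, subst (1) expand[of w]) (simp add: l.sum l.scale mult.commute)
  then show ?thesis by blast
qed

lemma adj_exists: "\<exists>a'. \<forall>v w. h (a *v v) w = h v (a' *v w)"
proof -
  have "\<exists>t. \<forall>v. h w (a *v v) = h t v" for w
    by (rule h_rep) (unfold_locales, simp_all add: matrix_vector_ring h_add h_scale algebra_simps)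
  then obtain t where t: "\<And>w v. h w (a *v v) = h (t w) v" by metis
  have t': "h (a *v v) w = h v (t w)" for v w
    using t[of w v] h_sym[of "a *v v" w] h_sym[of v "t w"] by simp
  have "Vector_Spaces.linear (*s) (*s) t"
  proof (rule Vector_Spaces.linear.intro[OF _ _ module_hom.intro[OF _ _ module_hom_axioms.intro]])
    show "t (x + y) = t x + t y" for x y
      by (rule h_cancel_right) (simp add: t'[symmetric] h_add)
    show "t (c *s x) = c *s t x" for c x
      by (rule h_cancel_right) (simp add: t'[symmetric] h_scale)
  qed unfold_locales
  then have "matrix t *v w = t w" for w by (rule matrix_works)
  then show ?thesis using t' by (intro exI[of _ "matrix t"]) simp
qed

text \<open>The adjoint anti-involution \<open>\<sigma>\<close> of the form.\<close>

definition adj :: "'k^'n^'n \<Rightarrow> 'k^'n^'n" where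
  "adj a = (SOME a'. \<forall>v w. h (a *v v) w = h v (a' *v w))"

lemma adj: "h (a *v v) w = h v (adj a *v w)"
  using someI_ex[OF adj_exists[of a]] unfolding adj_def by blast

lemma adj': "h v (a *v w) = h (adj a *v v) w"
  using adj[of a w v] h_sym[of v "a *v w"] h_sym[of "adj a *v v" w] by simp

lemma adj_unique: "(\<And>v w. h (a *v v) w = h v (a' *v w)) \<Longrightarrow> adj a = a'"
  unfolding matrix_eq by (intro allI h_cancel_right) (simp add: adj[symmetric])

lemma adj_adj: "adj (adj a) = a"
  by (rule adj_unique) (simp add: adj')

lemma adj_add: "adj (a + c) = adj a + adj c"
  by (rule adj_unique) (simp add: matrix_vector_ring h_add adj)

lemma adj_diff: "adj (a - c) = adj a - adj c"
  by (rule adj_unique) (simp add: matrix_vector_ring h_diff adj)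

lemma adj_mult: "adj (a ** c) = adj c ** adj a"
  by (rule adj_unique) (simp add: matrix_vector_ring adj)

lemma adj_mat: "adj (mat c) = mat (\<rho> c)"
  by (rule adj_unique) (simp add: mat_mult_vector h_scale mult.commute)

sublocale D: dualspace "(*s)" val \<rho> h
proof unfold_locales
  show "\<exists>B. finite B \<and> vec.span B = (UNIV :: ('k^'n) set)"
    using finite_cart_basis span_cart_basis by blast
qed (use val rho rho_eq_0 h_add h_scale pin_h_sym h_rep in auto)

end

lemma (in latseq) latseq_lat:
  fixes h :: "'k^'n \<Rightarrow> 'k^'n \<Rightarrow> 'k"
  assumes "dualspace (*s) val \<rho> h"
  shows "dualspace.lat (*s) val (\<Lambda> s)"
proof -
  interpret D: dualspace "(*s)" val \<rho> h by (rule assms)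
  have deep: "\<exists>c. c \<noteq> 0 \<and> (\<forall>v\<in>\<Lambda> t. c *s v \<in> \<Lambda> s')" for t s'
  proof -
    obtain c where c: "c \<noteq> 0" "val c = \<bar>s'\<bar> + \<bar>t\<bar>" using discrete_valuation_power_int_ex[OF dv] by blast
    have "s' \<le> t + e * val c"
    proof -
      have "1 * val c \<le> e * val c" using e_pos c by (intro mult_right_mono) auto
      then show ?thesis using c by simp
    qed
    then have "\<forall>v\<in>\<Lambda> t. c *s v \<in> \<Lambda> s'" using L_scale[OF c(1)] L_mono by blast
    then show ?thesis using c(1) by blast
  qed
  show ?thesis
    unfolding D.lat_def D.submod_def
  proof (intro conjI allI ballI impI L_zero)
    show "\<exists>c. c \<noteq> 0 \<and> c *s v \<in> \<Lambda> s" for v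
    proof -
      obtain t where "v \<in> \<Lambda> t" using L_exh by blast
      then show ?thesis using deep[of t s] by blast
    qed
    show "\<exists>N. \<forall>v\<in>\<Lambda> s. pin val N (\<phi> v)" if lin: "Vector_Spaces.linear (*s) (*) \<phi>" for \<phi>
    proof -
      interpret l: Vector_Spaces.linear "(*s)" "(*)" \<phi> by (rule lin)
      obtain N where N: "\<forall>v\<in>\<Lambda> N. pin val 1 (\<phi> v)" using L_bdd[OF lin] by blast
      obtain c where c: "c \<noteq> 0" "\<forall>v\<in>\<Lambda> s. c *s v \<in> \<Lambda> N" using deep by blast
      have "pin val (- val c + 1) (\<phi> v)" if v: "v \<in> \<Lambda> s" for v
      proof -
        have "pin val 1 (c * \<phi> v)" using N c(2) v by (auto simp: l.scale[symmetric])
        moreover have "pin val (- val c) (inverse c)" using discrete_valuation_inverse[OF dv c(1)] by (simp add: pin_def)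
        ultimately have "pin val (- val c + 1) (inverse c * (c * \<phi> v))" by (intro pin_mult[OF dv])
        then show ?thesis using c(1) by (simp add: mult.assoc[symmetric])
      qed
      then show ?thesis by blast
    qed
  qed (use L_add L_int in auto)
qed

text \<open>\<open>R\<close> is a filtered ring of operators whose associated graded ring is a graded field; \<open>J (n + 1)\<close> is
  the part of \<open>R n\<close> acting trivially on the graded pieces.\<close>

locale wittone = herm val \<rho> \<epsilon> h + latseq val e \<Lambda>
  for val :: "'k::field \<Rightarrow> int" and \<rho> \<epsilon> and h :: "'k^'n \<Rightarrow> 'k^'n \<Rightarrow> 'k" and e and \<Lambda> :: "int \<Rightarrow> ('k^'n) set" +
  fixes u :: int and R J :: "int \<Rightarrow> ('k^'n^'n) set"
  assumes sd: "v \<in> \<Lambda> (u - s) \<longleftrightarrow> (\<forall>z\<in>\<Lambda> s. pin val 1 (h v z))"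
    and two: "(2::'k) \<noteq> 0" "val 2 = 0"
    and R_zero: "0 \<in> R n" and R_add: "a \<in> R n \<Longrightarrow> c \<in> R n \<Longrightarrow> a + c \<in> R n"
    and R_int: "pin val 0 k \<Longrightarrow> a \<in> R n \<Longrightarrow> mat k ** a \<in> R n"
    and R_filt: "a \<in> R n \<Longrightarrow> a \<in> filt \<Lambda> n" and J_filt: "a \<in> J n \<Longrightarrow> a \<in> filt \<Lambda> n"
    and R_mult: "a \<in> R n \<Longrightarrow> c \<in> R m \<Longrightarrow> a ** c \<in> R (n + m)"
    and R_adj: "a \<in> R n \<Longrightarrow> adj a \<in> R n" and J_adj: "a \<in> J n \<Longrightarrow> adj a \<in> J n"
    and R_inv: "a \<in> R n \<Longrightarrow> a \<notin> J (n + 1) \<Longrightarrow> \<exists>c\<in>R (- n). a ** c - mat 1 \<in> J 1"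
begin

lemma pairing: "v \<in> \<Lambda> s \<Longrightarrow> z \<in> \<Lambda> t \<Longrightarrow> u \<le> s + t \<Longrightarrow> pin val 1 (h v z)"
  using sd[of v t] L_mono[of v s "u - t"] by auto

lemma dual_eq: "D.dual (\<Lambda> s) = \<Lambda> (u - s)"
  using sd by (auto simp: D.dual_def)

lemma lat_L: "D.lat (\<Lambda> s)"
  by (rule latseq_lat) unfold_locales

lemma submod_L: "D.submod (\<Lambda> s)"
  using lat_L by (simp add: D.lat_def)

definition orb :: "'k^'n \<Rightarrow> int \<Rightarrow> ('k^'n) set" where
  "orb v n = {a *v v |a. a \<in> R n}"

lemma submod_orb: "D.submod (orb v n)"
  unfolding D.submod_def orb_def
proof (intro conjI ballI allI impI)
  show "0 \<in> {a *v v |a. a \<in> R n}" using R_zero[of n] by (auto intro!: exI[of _ 0])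
  fix x assume "x \<in> {a *v v |a. a \<in> R n}"
  then obtain a where a: "x = a *v v" "a \<in> R n" by auto
  show "x + y \<in> {a *v v |a. a \<in> R n}" if y: "y \<in> {a *v v |a. a \<in> R n}" for y
  proof -
    obtain c where c: "y = c *v v" "c \<in> R n" using y by auto
    have "x + y = (a + c) *v v" by (simp add: a c matrix_vector_ring)
    then show ?thesis using R_add[OF a(2) c(2)] by auto
  qed
  show "k *s x \<in> {a *v v |a. a \<in> R n}" if "pin val 0 k" for k
  proof -
    have "k *s x = (mat k ** a) *v v" by (simp add: a matrix_vector_ring mat_mult_vector)
    then show ?thesis using R_int[OF that a(2)] by auto
  qed
qed

text \<open>Outside \<open>J (n + 1)\<close> an element of \<open>R n\<close> is a residual unit,
  and so is its adjoint. With \<open>c\<close> an approximate inverse of \<open>adj a\<close>, the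
  value \<open>h v z\<close> agrees with \<open>h (a *v v) (c *v z)\<close> modulo the maximal
  ideal.\<close>

lemma unit_pairing:
  assumes a: "a \<in> R n" "a \<notin> J (n + 1)" and v: "v \<in> \<Lambda> s" and z: "z \<in> \<Lambda> (u - 1 - s)"
    and vz: "\<And>c. c \<in> R (- n) \<Longrightarrow> pin val 1 (h (a *v v) (c *v z))"
  shows "pin val 1 (h v z)"
proof -
  have "adj a \<notin> J (n + 1)" using J_adj[of "adj a"] a(2) by (auto simp: adj_adj)
  then obtain c where c: "c \<in> R (- n)" "adj a ** c - mat 1 \<in> J 1" using R_inv[OF R_adj[OF a(1)]] by blast
  have "h v z = h (a *v v) (c *v z) - h v ((adj a ** c - mat 1) *v z)"
    by (simp add: adj matrix_vector_ring h_diff)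
  moreover have "pin val 1 (h v ((adj a ** c - mat 1) *v z))"
    by (rule pairing[OF v filtD[OF J_filt[OF c(2)] z refl]]) simp
  ultimately show ?thesis using vz[OF c(1)] pin_diff[OF val] by metis
qed

text \<open>Completes a residually isotropic vector to a hyperbolic pair. Isotropy is asked along
  the whole \<open>R\<close>-orbit, since \<open>h\<close> has values in the base field and not in
  the residual field of \<open>R\<close>. A partner \<open>j\<close> exists by nondegeneracy; it is
  corrected by half of a multiple \<open>b *v i\<close> for which \<open>j - b *v i\<close> is
  orthogonal to the orbit of \<open>j\<close>.\<close>

lemma isotropic_partner:
  assumes i: "i \<in> \<Lambda> s" "i \<notin> \<Lambda> (s + 1)" and iso: "\<And>c. c \<in> R (u - 1 - 2 * s) \<Longrightarrow> pin val 1 (h i (c *v i))"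
  shows "\<exists>j\<in>\<Lambda> (u - 1 - s). \<not> pin val 1 (h i j) \<and> (\<forall>a\<in>R (2 * s + 1 - u). pin val 1 (h j (a *v j)))"
proof -
  define t where "t = u - 1 - s"
  define m where "m = 2 * s + 1 - u"
  have "\<not> (\<forall>z\<in>\<Lambda> t. pin val 1 (h i z))" using sd[of i t] i(2) by (simp add: t_def add.commute)
  then obtain j where j: "j \<in> \<Lambda> t" "\<not> pin val 1 (h i j)" by blast
  \<comment> \<open>\<open>X\<close> and \<open>Y\<close> are the residual lines through
    \<open>i\<close> and through \<open>j\<close>, taken in the complementary degrees
    \<open>t\<close> and \<open>s\<close>.\<close>
  define X where "X = D.plus_set (orb i (- m)) (\<Lambda> (t + 1))"
  define Y where "Y = D.plus_set (orb j m) (\<Lambda> (s + 1))"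
  have "a *v i \<in> \<Lambda> t" if "a \<in> R (- m)" for a
    by (rule filtD[OF R_filt[OF that] i(1)]) (simp add: m_def t_def)
  then have orbX: "orb i (- m) \<subseteq> \<Lambda> t" by (auto simp: orb_def)
  have "a *v j \<in> \<Lambda> s" if "a \<in> R m" for a
    by (rule filtD[OF R_filt[OF that] j(1)]) (simp add: m_def t_def)
  then have orbY: "orb j m \<subseteq> \<Lambda> s" by (auto simp: orb_def)
  have X: "D.submod X" "X \<subseteq> \<Lambda> t" "\<Lambda> (t + 1) \<subseteq> X" "orb i (- m) \<subseteq> X"
    using D.submod_plus[OF submod_orb submod_L] D.plus_least[OF submod_L orbX L_step]
      D.plus_subset[OF submod_orb submod_L] by (auto simp: X_def)
  have Y: "D.submod Y" "Y \<subseteq> \<Lambda> s" "\<Lambda> (s + 1) \<subseteq> Y" "orb j m \<subseteq> Y"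
    using D.submod_plus[OF submod_orb submod_L] D.plus_least[OF submod_L orbY L_step]
      D.plus_subset[OF submod_orb submod_L] by (auto simp: Y_def)
  have lX: "D.lat X" by (rule D.lat_sandwich[OF lat_L lat_L X(3) X(2) X(1)])
  have lY: "D.lat Y" by (rule D.lat_sandwich[OF lat_L lat_L Y(3) Y(2) Y(1)])
  have dXs: "\<Lambda> (s + 1) \<subseteq> D.dual X" using D.dual_anti[OF X(2)] dual_eq[of t] by (simp add: t_def add.commute)
  have dYt: "\<Lambda> (t + 1) \<subseteq> D.dual Y" "D.dual Y \<subseteq> \<Lambda> t"
    using D.dual_anti[OF Y(2)] D.dual_anti[OF Y(3)] dual_eq[of s] dual_eq[of "s + 1"]
    by (simp_all add: t_def algebra_simps)
  \<comment> \<open>The two lines pair perfectly because \<open>h i j\<close> is not in the maximal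
    ideal; dualizing this inclusion decomposes \<open>\<Lambda> t\<close> and produces
    \<open>b\<close>.\<close>
  have small: "D.dual X \<inter> Y \<subseteq> \<Lambda> (s + 1)"
  proof
    fix y assume y: "y \<in> D.dual X \<inter> Y"
    then obtain a l where al: "a \<in> R m" "l \<in> \<Lambda> (s + 1)" "y = a *v j + l"
      by (auto simp: Y_def D.plus_set_def orb_def)
    have "a *v j = y - l" using al by simp
    then have ajX: "a *v j \<in> D.dual X"
      using D.submod_diff[OF D.dual_submod] y al(2) dXs by auto
    have aJ: "a \<in> J (m + 1)"
    proof (rule ccontr)
      assume aJ: "a \<notin> J (m + 1)"
      have iL: "i \<in> \<Lambda> (u - 1 - t)" using i(1) by (simp add: t_def)
      have "pin val 1 (h j i)"
      proof (rule unit_pairing[OF al(1) aJ j(1) iL])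
        fix c assume "c \<in> R (- m)"
        then have "c *v i \<in> X" using X(4) by (auto simp: orb_def)
        then show "pin val 1 (h (a *v j) (c *v i))" using ajX by (simp add: D.dual_def)
      qed
      then show False using j(2) pin_h_sym by blast
    qed
    have "a *v j \<in> \<Lambda> (s + 1)"
      by (rule filtD[OF J_filt[OF aJ] j(1)]) (simp add: m_def t_def)
    then show "y \<in> \<Lambda> (s + 1)" using al L_add by simp
  qed
  have "D.lat (D.plus_set (D.dual (D.dual X)) (D.dual Y))"
    unfolding D.dual_dual[OF lX]
  proof (rule D.lat_sandwich[OF lat_L[of "t + 1"] lat_L[of t]])
    show "\<Lambda> (t + 1) \<subseteq> D.plus_set X (D.dual Y)"
      using X(3) D.plus_subset[OF X(1) D.dual_submod, of Y] by blast
  qed (rule D.plus_least[OF submod_L X(2) dYt(2)] D.submod_plus[OF X(1) D.dual_submod])+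
  then have "D.dual (D.dual X \<inter> Y) = D.plus_set X (D.dual Y)"
    using D.dual_Int[OF D.lat_dual[OF lX] lY] D.dual_dual[OF lX] by simp
  moreover have "\<Lambda> t \<subseteq> D.dual (D.dual X \<inter> Y)"
    using D.dual_anti[OF small] dual_eq[of "s + 1"] by (simp add: t_def algebra_simps)
  ultimately obtain xx d where xd: "xx \<in> X" "d \<in> D.dual Y" "j = xx + d"
    using j(1) by (auto simp: D.plus_set_def)
  obtain b l where bl: "b \<in> R (- m)" "l \<in> \<Lambda> (t + 1)" "xx = b *v i + l"
    using xd(1) by (auto simp: X_def D.plus_set_def orb_def)
  have jb: "j - b *v i \<in> D.dual Y"
    using D.submod_add[OF D.dual_submod] dYt(1) bl xd by auto
  have perp: "pin val 1 (h (a *v j) (j - b *v i))" "pin val 1 (h (j - b *v i) (a *v j))" if "a \<in> R m" for a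
    using jb Y(4) that pin_h_sym by (auto simp: D.dual_def orb_def)
  obtain k where k: "pin val 0 k" "k + k = 1" and rk: "\<rho> k = k" using half[OF two] by blast
  define j1 where "j1 = j - k *s (b *v i)"
  have bi: "b *v i \<in> \<Lambda> t" using orbX bl(1) by (auto simp: orb_def)
  have j1L: "j1 \<in> \<Lambda> t" unfolding j1_def by (intro L_diff j(1) L_int k(1) bi)
  have ibi: "pin val 1 (h i (b *v i))" by (rule iso) (use bl(1) in \<open>simp add: m_def algebra_simps\<close>)
  have "\<not> pin val 1 (h i j1)"
  proof
    assume neg: "pin val 1 (h i j1)"
    have "h i j = h i j1 + h i (b *v i) * k" by (simp add: j1_def h_diff h_scale)
    moreover have "pin val 1 (h i (b *v i) * k)" using pin_mult[OF val ibi k(1)] by simp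
    ultimately show False using j(2) neg pin_add[OF val] by metis
  qed
  moreover have "pin val 1 (h j1 (a *v j1))" if a: "a \<in> R m" for a
  proof -
    define y where "y = b *v i"
    have 1: "pin val 1 (h (j - y) (a *v j))" using perp(2)[OF a] by (simp add: y_def)
    have 2: "pin val 1 (h j (a *v (j - y)))"
      using perp(1)[OF R_adj[OF a]] by (simp add: y_def adj adj_adj)
    have 3: "pin val 1 (h y (a *v y))"
    proof -
      have "adj b ** (a ** b) \<in> R (- m + (m + - m))"
        by (intro R_mult R_adj bl(1) a)
      then have "pin val 1 (h i ((adj b ** (a ** b)) *v i))"
        by (intro iso) (simp add: m_def algebra_simps)
      then show ?thesis by (simp add: y_def adj matrix_vector_ring)
    qed
    \<comment> \<open>Half of \<open>h j (a *v j)\<close> is given to each mixed term; what remains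
      is small by orthogonality, or by isotropy of \<open>i\<close> in the last term.\<close>
    have "h j1 (a *v j1) = k * h (j - y) (a *v j) + h j (a *v (j - y)) * k + k * h y (a *v y) * k"
    proof -
      have "h j1 (a *v j1) = h j (a *v j) - h j (a *v y) * k - k * h y (a *v j) + k * h y (a *v y) * k"
        by (simp add: j1_def y_def[symmetric] matrix_vector_ring h_diff h_scale rk algebra_simps)
      also have "h j (a *v j) = k * h j (a *v j) + h j (a *v j) * k"
        using k(2) by (metis distrib_left mult.commute mult.right_neutral)
      finally show ?thesis by (simp add: matrix_vector_ring h_diff algebra_simps)
    qed
    moreover have "pin val 1 (k * h (j - y) (a *v j))" using pin_mult[OF val k(1) 1] by simp
    moreover have "pin val 1 (h j (a *v (j - y)) * k)" using pin_mult[OF val 2 k(1)] by simp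
    moreover have "pin val 1 (k * h y (a *v y) * k)" using pin_mult[OF val pin_mult[OF val k(1) 3] k(1)] by simp
    ultimately show ?thesis using pin_add[OF val] by metis
  qed
  ultimately show ?thesis using j1L by (auto simp: t_def m_def)
qed

end

section \<open>Residual isometries from Lagrangians\<close>

context herm
begin

definition psc :: "'k \<Rightarrow> ('k^'n) \<times> ('k^'n) \<Rightarrow> ('k^'n) \<times> ('k^'n)" where
  "psc c p = (c *s fst p, c *s snd p)"

text \<open>The orthogonal difference of two copies of the form: the graph of a linear map is
  totally isotropic for it exactly when the map preserves \<open>h\<close>.\<close>

definition HH :: "('k^'n) \<times> ('k^'n) \<Rightarrow> ('k^'n) \<times> ('k^'n) \<Rightarrow> 'k" where
  "HH p q = h (fst p) (fst q) - h (snd p) (snd q)"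

definition act :: "'k^'n^'n \<Rightarrow> ('k^'n) \<times> ('k^'n) \<Rightarrow> ('k^'n) \<times> ('k^'n)" where
  "act a p = (a *v fst p, a *v snd p)"

lemma psc_vector_space: "vector_space psc"
  by unfold_locales (simp_all add: psc_def prod_eq_iff vec.scale_right_distrib vec.scale_left_distrib)

lemma psc_fst_snd_linear:
  assumes "Vector_Spaces.linear psc (*) \<phi>"
  shows "Vector_Spaces.linear (*s) (*) (\<lambda>v. \<phi> (v, 0))" "Vector_Spaces.linear (*s) (*) (\<lambda>v. \<phi> (0, v))"
    "\<phi> p = \<phi> (fst p, 0) + \<phi> (0, snd p)"
proof -
  interpret l: Vector_Spaces.linear psc "(*)" \<phi> by (rule assms)
  have s: "(c *s v, 0) = psc c (v, 0)" "(0, c *s v) = psc c (0, v)" for c and v :: "'k^'n"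
    by (simp_all add: psc_def)
  have a: "(v + z, 0 :: 'k^'n) = (v, 0) + (z, 0)" "(0 :: 'k^'n, v + z) = (0, v) + (0, z)" for v z :: "'k^'n" by simp_all
  show "Vector_Spaces.linear (*s) (*) (\<lambda>v. \<phi> (v, 0))" "Vector_Spaces.linear (*s) (*) (\<lambda>v. \<phi> (0, v))"
    by (unfold_locales; simp only: s a l.add l.scale)+
  show "\<phi> p = \<phi> (fst p, 0) + \<phi> (0, snd p)" by (simp add: l.add[symmetric])
qed

sublocale E: dualspace psc val \<rho> HH
proof (rule dualspace.intro[OF psc_vector_space dualspace_axioms.intro])
  interpret V: vector_space psc by (rule psc_vector_space)
  show "\<exists>B. finite B \<and> V.span B = UNIV"
  proof (intro exI conjI)
    define B :: "(('k^'n) \<times> ('k^'n)) set" where "B = (\<lambda>v. (v, 0)) ` cart_basis \<union> (\<lambda>v. (0, v)) ` cart_basis"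
    show "finite B" by (simp add: B_def finite_cart_basis)
    have 1: "(v, 0) \<in> V.span B" for v
    proof -
      have "v \<in> vec.span cart_basis" by (simp add: span_cart_basis)
      then show ?thesis
      proof (induction rule: vec.span_induct_alt)
        case base
        show ?case using V.span_zero by (simp add: zero_prod_def)
      next
        case (step c x y)
        have "(c *s x + y, 0) = psc c (x, 0) + (y, 0)" by (simp add: psc_def)
        moreover have "(x, 0) \<in> V.span B" using step by (intro V.span_base) (simp add: B_def)
        ultimately show ?case using step V.span_add V.span_scale by metis
      qed
    qed
    have 2: "(0, v) \<in> V.span B" for v
    proof -
      have "v \<in> vec.span cart_basis" by (simp add: span_cart_basis)
      then show ?thesis
      proof (induction rule: vec.span_induct_alt)
        case base
        show ?case using V.span_zero by (simp add: zero_prod_def)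
      next
        case (step c x y)
        have "(0, c *s x + y) = psc c (0, x) + (0, y)" by (simp add: psc_def)
        moreover have "(0, x) \<in> V.span B" using step by (intro V.span_base) (simp add: B_def)
        ultimately show ?case using step V.span_add V.span_scale by metis
      qed
    qed
    show "V.span B = UNIV"
    proof (intro equalityI subsetI UNIV_I)
      fix p :: "('k^'n) \<times> ('k^'n)"
      have "p = (fst p, 0) + (0, snd p)" by simp
      then show "p \<in> V.span B" using V.span_add[OF 1[of "fst p"] 2[of "snd p"]] by simp
    qed
  qed
  show "pin val n (HH v z) = pin val n (HH z v)" for n v z
  proof -
    have "HH v z = \<epsilon> * \<rho> (HH z v)"
      by (simp add: HH_def rho_diff right_diff_distrib h_sym[of "fst v" "fst z"] h_sym[of "snd v" "snd z"])
    then show ?thesis by (simp add: pin_eps pin_rho)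
  qed
  show "\<exists>v. \<forall>z. \<phi> z = HH v z" if \<phi>: "Vector_Spaces.linear psc (*) \<phi>" for \<phi>
  proof -
    obtain v1 where v1: "\<forall>w. \<phi> (w, 0) = h v1 w" using h_rep[OF psc_fst_snd_linear(1)[OF \<phi>]] by blast
    obtain v2 where v2: "\<forall>w. \<phi> (0, w) = h v2 w" using h_rep[OF psc_fst_snd_linear(2)[OF \<phi>]] by blast
    have "\<phi> z = HH (v1, - v2) z" for z
      using psc_fst_snd_linear(3)[OF \<phi>, of z] v1 v2 by (simp add: HH_def h_minus)
    then show ?thesis by blast
  qed
qed (use val rho rho_eq_0 in \<open>auto simp: HH_def psc_def h_add h_scale algebra_simps\<close>)

lemma HH_adj: "HH (act a p) q = HH p (act (adj a) q)"
  by (simp add: HH_def act_def adj)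

lemma act_simps: "act a (p + q) = act a p + act a q" "act (a + c) p = act a p + act c p"
    "act (a ** c) p = act a (act c p)" "act (mat k) p = psc k p" "act a (p - q) = act a p - act a q"
  by (simp_all add: act_def psc_def matrix_vector_ring mat_mult_vector prod_eq_iff)

end

locale witt = herm val \<rho> \<epsilon> h + A: wittone val \<rho> \<epsilon> h e \<Lambda> u R J + B: wittone val \<rho> \<epsilon> h e \<Lambda>' u R J
  for val :: "'k::field \<Rightarrow> int" and \<rho> \<epsilon> and h :: "'k^'n \<Rightarrow> 'k^'n \<Rightarrow> 'k" and e
    and \<Lambda> \<Lambda>' :: "int \<Rightarrow> ('k^'n) set" and u R J +
  assumes R_scalar: "k \<noteq> 0 \<Longrightarrow> mat k \<in> R (e * val k)"
    and quot_fin: "finite ((\<lambda>v. {z. z - v \<in> \<Lambda> (s + 1)}) ` \<Lambda> s)"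
    and quot_card: "card ((\<lambda>v. {z. z - v \<in> \<Lambda>' (s + 1)}) ` \<Lambda>' s) = card ((\<lambda>v. {z. z - v \<in> \<Lambda> (s + 1)}) ` \<Lambda> s)"
    and quot_fin': "finite ((\<lambda>v. {z. z - v \<in> \<Lambda>' (s + 1)}) ` \<Lambda>' s)"
begin

section \<open>Lagrangians in the residual difference space\<close>

definition M :: "int \<Rightarrow> (('k^'n) \<times> ('k^'n)) set" where
  "M s = \<Lambda> s \<times> \<Lambda>' s"

lemma M_iff: "p \<in> M s \<longleftrightarrow> fst p \<in> \<Lambda> s \<and> snd p \<in> \<Lambda>' s"
  by (cases p) (simp add: M_def)

lemma M_mono: "p \<in> M t \<Longrightarrow> s \<le> t \<Longrightarrow> p \<in> M s"
  using A.L_mono B.L_mono by (auto simp: M_iff)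

lemma M_submod: "E.submod (M s)"
  unfolding E.submod_def
  by (auto simp: M_iff psc_def A.L_zero B.L_zero A.L_add B.L_add A.L_int B.L_int)

lemma M_lat: "E.lat (M s)"
  unfolding E.lat_def
proof (intro conjI allI impI M_submod)
  fix p :: "('k^'n) \<times> ('k^'n)"
  obtain c1 where c1: "c1 \<noteq> 0" "c1 *s fst p \<in> \<Lambda> s" using A.lat_L[of s] unfolding D.lat_def by blast
  obtain c2 where c2: "c2 \<noteq> 0" "c2 *s snd p \<in> \<Lambda>' s" using B.lat_L[of s] unfolding D.lat_def by blast
  obtain c where c: "c \<noteq> 0" "val c = max (val c1) (val c2)" using discrete_valuation_power_int_ex[OF val] by blast
  have q: "pin val 0 (c * inverse d)" if d: "d \<noteq> 0" "val d \<le> val c" for d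
    using discrete_valuation_mult[OF val c(1), of "inverse d"] discrete_valuation_inverse[OF val d(1)] d
    by (simp add: pin_def)
  have "c *s fst p \<in> \<Lambda> s" using A.L_int[OF q[OF c1(1)] c1(2)] c c1(1) by (simp add: vector_smult_assoc mult.assoc)
  moreover have "c *s snd p \<in> \<Lambda>' s" using B.L_int[OF q[OF c2(1)] c2(2)] c c2(1) by (simp add: vector_smult_assoc mult.assoc)
  ultimately show "\<exists>c. c \<noteq> 0 \<and> psc c p \<in> M s" using c(1) by (auto simp: psc_def M_iff)
next
  fix \<phi> assume \<phi>: "Vector_Spaces.linear psc (*) \<phi>"
  obtain N1 where N1: "\<forall>v\<in>\<Lambda> s. pin val N1 (\<phi> (v, 0))"
    using A.lat_L[of s] psc_fst_snd_linear(1)[OF \<phi>] unfolding D.lat_def by blast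
  obtain N2 where N2: "\<forall>v\<in>\<Lambda>' s. pin val N2 (\<phi> (0, v))"
    using B.lat_L[of s] psc_fst_snd_linear(2)[OF \<phi>] unfolding D.lat_def by blast
  have "pin val (min N1 N2) (\<phi> p)" if p: "p \<in> M s" for p
  proof -
    have "pin val (min N1 N2) (\<phi> (fst p, 0))" "pin val (min N1 N2) (\<phi> (0, snd p))"
      using N1 N2 p pin_mono by (auto simp: M_iff intro: pin_mono)
    then show ?thesis by (subst psc_fst_snd_linear(3)[OF \<phi>]) (rule pin_add[OF val])
  qed
  then show "\<exists>N. \<forall>v\<in>M s. pin val N (\<phi> v)" by blast
qed

lemma M_dual: "E.dual (M s) = M (u - s)"
proof
  show "E.dual (M s) \<subseteq> M (u - s)"
  proof
    fix p assume p: "p \<in> E.dual (M s)"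
    have "pin val 1 (h (fst p) z)" if "z \<in> \<Lambda> s" for z
    proof -
      have "(z, 0) \<in> M s" using that B.L_zero by (simp add: M_def)
      then have "pin val 1 (HH p (z, 0))" using p by (simp add: E.dual_def)
      then show ?thesis by (simp add: HH_def)
    qed
    moreover have "pin val 1 (h (snd p) z)" if "z \<in> \<Lambda>' s" for z
    proof -
      have "(0, z) \<in> M s" using that A.L_zero by (simp add: M_def)
      then have "pin val 1 (HH p (0, z))" using p by (simp add: E.dual_def)
      then show ?thesis by (simp add: HH_def pin_uminus[OF val])
    qed
    ultimately show "p \<in> M (u - s)" using A.sd B.sd by (simp add: M_iff)
  qed
  show "M (u - s) \<subseteq> E.dual (M s)"
    using A.sd B.sd by (auto simp: M_iff E.dual_def HH_def intro!: pin_diff[OF val])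
qed

lemma R_act_M: "a \<in> R n \<Longrightarrow> p \<in> M s \<Longrightarrow> t = s + n \<Longrightarrow> act a p \<in> M t"
  using A.filtD[OF A.R_filt] B.filtD[OF B.R_filt] by (auto simp: M_iff act_def)

lemma J_act_M: "a \<in> J n \<Longrightarrow> p \<in> M s \<Longrightarrow> t = s + n \<Longrightarrow> act a p \<in> M t"
  using A.filtD[OF A.J_filt] B.filtD[OF B.J_filt] by (auto simp: M_iff act_def)

text \<open>A Lagrangian of the graded residual space: lying between \<open>M (s + 1)\<close> and
  \<open>M s\<close>, the set \<open>L s\<close> encodes a subspace of a graded piece. Degree
  \<open>s\<close> is paired with degree \<open>u - 1 - s\<close>; the shift by one arises because
  \<open>M (u - s)\<close> is dual to \<open>M s\<close> for values in the maximal ideal.\<close>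

definition Lag :: "(int \<Rightarrow> (('k^'n) \<times> ('k^'n)) set) \<Rightarrow> bool" where
  "Lag L \<longleftrightarrow> (\<forall>s. M (s + 1) \<subseteq> L s \<and> L s \<subseteq> M s \<and> E.dual (L s) = L (u - 1 - s)) \<and>
     (\<forall>n s a p. a \<in> R n \<longrightarrow> p \<in> L s \<longrightarrow> act a p \<in> L (s + n))"

lemma LagD:
  assumes "Lag L"
  shows "M (s + 1) \<subseteq> L s" "L s \<subseteq> M s" "E.dual (L s) = L (u - 1 - s)"
    "a \<in> R n \<Longrightarrow> p \<in> L s \<Longrightarrow> act a p \<in> L (s + n)"
  using assms unfolding Lag_def by blast+

lemma Lag_submod: "Lag L \<Longrightarrow> E.submod (L s)"
  using LagD(3)[of L "u - 1 - s"] E.dual_submod[of "L (u - 1 - s)"] by simp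

lemma Lag_lat: "Lag L \<Longrightarrow> E.lat (L s)"
  by (rule E.lat_sandwich[OF M_lat M_lat LagD(1) LagD(2) Lag_submod])

lemma Lag_pairing: "Lag L \<Longrightarrow> p \<in> L s \<Longrightarrow> q \<in> L (u - 1 - s) \<Longrightarrow> pin val 1 (HH p q)"
  using LagD(3)[of L "u - 1 - s"] by (auto simp: E.dual_def)

definition diag_lag :: "int \<Rightarrow> (('k^'n) \<times> ('k^'n)) set" where
  "diag_lag s = E.plus_set {(v, v) |v. v \<in> \<Lambda> s \<inter> \<Lambda>' s} (M (s + 1))"

text \<open>A pair is orthogonal to the diagonal of \<open>\<Lambda> s \<inter> \<Lambda>' s\<close>
  when its difference lies in the dual of the intersection, which is the sum of the two duals.
  Splitting the difference accordingly moves the pair onto the diagonal of degree \<open>t\<close>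
  modulo \<open>M (t + 1)\<close>.\<close>

lemma diag_lag: "Lag diag_lag"
  unfolding Lag_def
proof (intro conjI allI impI)
  fix s
  define \<Delta> where "\<Delta> = {(v, v) |v. v \<in> \<Lambda> s \<inter> \<Lambda>' s}"
  have sD: "E.submod \<Delta>"
    unfolding E.submod_def \<Delta>_def
    by (auto simp: zero_prod_def psc_def A.L_zero B.L_zero A.L_add B.L_add A.L_int B.L_int)
  show 1: "M (s + 1) \<subseteq> diag_lag s"
    using E.plus_subset[OF sD M_submod] by (auto simp: diag_lag_def \<Delta>_def)
  show 2: "diag_lag s \<subseteq> M s"
    unfolding diag_lag_def
    by (rule E.plus_least[OF M_submod]) (auto simp: M_iff dest: M_mono[of _ "s + 1" s])
  define t where "t = u - 1 - s"
  have ut: "u - s = t + 1" "u - (s + 1) = t" by (simp_all add: t_def)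
  have pl: "D.lat (D.plus_set (\<Lambda> (t + 1)) (\<Lambda>' (t + 1)))"
  proof -
    have absb: "\<exists>c. c \<noteq> 0 \<and> c *s v \<in> D.plus_set (\<Lambda> (t + 1)) (\<Lambda>' (t + 1))" for v
      using A.lat_L[of "t + 1"] D.plus_subset[OF A.submod_L B.submod_L] unfolding D.lat_def by blast
    have bd: "\<exists>N. \<forall>v\<in>D.plus_set (\<Lambda> (t + 1)) (\<Lambda>' (t + 1)). pin val N (\<phi> v)"
      if lin: "Vector_Spaces.linear (*s) (*) \<phi>" for \<phi>
    proof -
      interpret l: Vector_Spaces.linear "(*s)" "(*)" \<phi> by (rule lin)
      obtain N1 where N1: "\<forall>v\<in>\<Lambda> (t + 1). pin val N1 (\<phi> v)" using A.lat_L[of "t + 1"] lin unfolding D.lat_def by blast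
      obtain N2 where N2: "\<forall>v\<in>\<Lambda>' (t + 1). pin val N2 (\<phi> v)" using B.lat_L[of "t + 1"] lin unfolding D.lat_def by blast
      have "pin val (min N1 N2) (\<phi> z)" if z: "z \<in> D.plus_set (\<Lambda> (t + 1)) (\<Lambda>' (t + 1))" for z
      proof -
        obtain a b where ab: "a \<in> \<Lambda> (t + 1)" "b \<in> \<Lambda>' (t + 1)" "z = a + b" using z by (rule D.plus_setE)
        have "pin val (min N1 N2) (\<phi> a)" by (rule pin_mono[of val N1]) (use N1 ab in auto)
        moreover have "pin val (min N1 N2) (\<phi> b)" by (rule pin_mono[of val N2]) (use N2 ab in auto)
        ultimately show ?thesis unfolding ab(3) l.add by (rule pin_add[OF val])
      qed
      then show ?thesis by blast
    qed
    show ?thesis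
      unfolding D.lat_def using D.submod_plus[OF A.submod_L B.submod_L] absb bd by blast
  qed
  have dI: "D.dual (\<Lambda> s \<inter> \<Lambda>' s) = D.plus_set (\<Lambda> (t + 1)) (\<Lambda>' (t + 1))"
    using D.dual_Int[OF A.lat_L[of s] B.lat_L[of s]] pl by (simp add: A.dual_eq B.dual_eq ut)
  have dd: "p \<in> E.dual \<Delta> \<longleftrightarrow> fst p - snd p \<in> D.dual (\<Lambda> s \<inter> \<Lambda>' s)" for p
    by (auto simp: E.dual_def D.dual_def \<Delta>_def HH_def h_diff)
  have "E.dual (diag_lag s) = E.dual \<Delta> \<inter> M t"
    unfolding diag_lag_def \<Delta>_def[symmetric] E.dual_plus[OF sD M_submod] M_dual by (simp add: t_def algebra_simps)
  also have "\<dots> = diag_lag t"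
  proof (intro equalityI subsetI)
    fix p assume p: "p \<in> E.dual \<Delta> \<inter> M t"
    then obtain b b' where b: "b \<in> \<Lambda> (t + 1)" "b' \<in> \<Lambda>' (t + 1)" "fst p - snd p = b + b'"
      using dd dI by (auto simp: D.plus_set_def)
    define y where "y = fst p - b"
    have "y \<in> \<Lambda> t" using p b A.L_mono[OF b(1), of t] by (auto simp: y_def M_iff A.L_diff)
    moreover have "y = snd p + b'" using b(3) by (simp add: y_def algebra_simps)
    then have "y \<in> \<Lambda>' t" using p b B.L_mono[OF b(2), of t] by (auto simp: M_iff B.L_add)
    moreover have "p = (y, y) + (b, - b')"
    proof (rule prod_eqI)
      show "fst p = fst ((y, y) + (b, - b'))" by (simp add: y_def)
      show "snd p = snd ((y, y) + (b, - b'))" using \<open>y = snd p + b'\<close> by simp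
    qed
    moreover have "(b, - b') \<in> M (t + 1)" using b B.L_uminus by (simp add: M_def)
    ultimately show "p \<in> diag_lag t"
      unfolding diag_lag_def E.plus_set_def by blast
  next
    fix p assume "p \<in> diag_lag t"
    then obtain y q where y: "y \<in> \<Lambda> t" "y \<in> \<Lambda>' t" "q \<in> M (t + 1)" "p = (y, y) + q"
      unfolding diag_lag_def E.plus_set_def by blast
    have "fst p - snd p = fst q + - snd q" using y(4) by simp
    moreover have "fst q + - snd q \<in> D.plus_set (\<Lambda> (t + 1)) (\<Lambda>' (t + 1))"
      by (rule D.plus_setI) (use y(3) B.L_uminus in \<open>auto simp: M_iff\<close>)
    ultimately have "p \<in> E.dual \<Delta>" using dd dI by simp
    moreover have "p \<in> M t" using y M_mono[OF y(3), of t] by (auto simp: M_iff A.L_add B.L_add)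
    ultimately show "p \<in> E.dual \<Delta> \<inter> M t" by blast
  qed
  finally show "E.dual (diag_lag s) = diag_lag (u - 1 - s)" by (simp add: t_def)
next
  fix n s a p assume a: "a \<in> R n" and "p \<in> diag_lag s"
  then obtain v q where v: "v \<in> \<Lambda> s" "v \<in> \<Lambda>' s" "q \<in> M (s + 1)" "p = (v, v) + q"
    unfolding diag_lag_def E.plus_set_def by blast
  have "a *v v \<in> \<Lambda> (s + n)" "a *v v \<in> \<Lambda>' (s + n)"
    using A.filtD[OF A.R_filt[OF a] v(1)] B.filtD[OF B.R_filt[OF a] v(2)] by auto
  moreover have "act a q \<in> M (s + n + 1)" by (rule R_act_M[OF a v(3)]) simp
  moreover have "act a p = (a *v v, a *v v) + act a q" by (simp add: v(4) act_simps) (simp add: act_def)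
  ultimately show "act a p \<in> diag_lag (s + n)"
    unfolding diag_lag_def E.plus_set_def by blast
qed

text \<open>The part in degree \<open>s\<close> of the residual line generated by \<open>n\<close>,
  an element of degree \<open>t\<close>.\<close>

definition K :: "('k^'n) \<times> ('k^'n) \<Rightarrow> int \<Rightarrow> int \<Rightarrow> (('k^'n) \<times> ('k^'n)) set" where
  "K n t s = E.plus_set {act a n |a. a \<in> R (s - t)} (M (s + 1))"

lemma K_E:
  assumes "p \<in> K n t s"
  obtains a m where "a \<in> R (s - t)" "m \<in> M (s + 1)" "p = act a n + m"
  using assms unfolding K_def E.plus_set_def by blast

lemma submod_orbit: "E.submod {act a n |a. a \<in> R k}"
  unfolding E.submod_def
proof (intro conjI ballI allI impI)
  show "0 \<in> {act a n |a. a \<in> R k}"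
    using A.R_zero[of k] by (auto simp: act_def zero_prod_def intro!: exI[of _ 0])
  fix x assume "x \<in> {act a n |a. a \<in> R k}"
  then obtain a where a: "x = act a n" "a \<in> R k" by auto
  show "x + y \<in> {act a n |a. a \<in> R k}" if y: "y \<in> {act a n |a. a \<in> R k}" for y
  proof -
    obtain c where c: "y = act c n" "c \<in> R k" using y by auto
    have "x + y = act (a + c) n" by (simp add: a c act_simps)
    then show ?thesis using A.R_add[OF a(2) c(2)] by auto
  qed
  show "psc c x \<in> {act a n |a. a \<in> R k}" if "pin val 0 c" for c
  proof -
    have "psc c x = act (mat c ** a) n" by (simp add: a act_simps)
    then show ?thesis using A.R_int[OF that a(2)] by auto
  qed
qed

lemma K_facts:
  assumes n: "n \<in> M t"
  shows "E.submod (K n t s)" "M (s + 1) \<subseteq> K n t s" "K n t s \<subseteq> M s" "E.lat (K n t s)"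
    "a \<in> R m \<Longrightarrow> p \<in> K n t s \<Longrightarrow> act a p \<in> K n t (s + m)" "a \<in> R (s - t) \<Longrightarrow> act a n \<in> K n t s"
proof -
  show 1: "E.submod (K n t s)" unfolding K_def by (rule E.submod_plus[OF submod_orbit M_submod])
  show 2: "M (s + 1) \<subseteq> K n t s"
    unfolding K_def using E.plus_subset[OF submod_orbit M_submod] by blast
  show 6: "act a n \<in> K n t s" if "a \<in> R (s - t)" for a
    unfolding K_def using E.plus_subset[OF submod_orbit M_submod] that by blast
  show 3: "K n t s \<subseteq> M s"
    unfolding K_def
  proof (rule E.plus_least[OF M_submod])
    show "{act a n |a. a \<in> R (s - t)} \<subseteq> M s" using R_act_M[OF _ n, of _ "s - t" s] by auto
    show "M (s + 1) \<subseteq> M s" using M_mono[of _ "s + 1" s] by auto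
  qed
  show "E.lat (K n t s)" by (rule E.lat_sandwich[OF M_lat M_lat 2 3 1])
  show "act a p \<in> K n t (s + m)" if a: "a \<in> R m" and p: "p \<in> K n t s" for a p
  proof -
    obtain c q where c: "c \<in> R (s - t)" "q \<in> M (s + 1)" "p = act c n + q"
      using p by (rule K_E)
    have "act a p = act (a ** c) n + act a q" by (simp add: c(3) act_simps)
    moreover have "a ** c \<in> R (s + m - t)" using A.R_mult[OF a c(1)] by (simp add: algebra_simps)
    moreover have "act a q \<in> M (s + m + 1)" by (rule R_act_M[OF a c(2)]) simp
    ultimately show ?thesis unfolding K_def by (auto intro!: E.plus_setI)
  qed
qed

text \<open>The classical neighbour of a Lagrangian along an isotropic line: intersect with the
  orthogonal of the line, then add the line.\<close>

definition nb where
  "nb L n t s = E.plus_set (L s \<inter> E.dual (K n t (u - 1 - s))) (K n t s)"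

text \<open>The dual of the neighbour is the sum of \<open>L\<close> and the line, cut with the
  orthogonal of the line. As the isotropic line lies in its own orthogonal, the modular law
  identifies this with the neighbour in the complementary degree.\<close>

lemma neighbour:
  assumes L: "Lag L" and n: "n \<in> M t" and iso: "\<And>a. a \<in> R (u - 1 - 2 * t) \<Longrightarrow> pin val 1 (HH n (act a n))"
  shows "Lag (nb L n t)"
proof -
  note K = K_facts[OF n]
  have dM: "M (s + 1) \<subseteq> E.dual (K n t (u - 1 - s))" "E.dual (K n t (u - 1 - s)) \<subseteq> M s" for s
    using E.dual_anti[OF K(3)[of "u - 1 - s"]] E.dual_anti[OF K(2)[of "u - 1 - s"]]
    by (simp_all add: M_dual algebra_simps)
  have KK: "K n t s \<subseteq> E.dual (K n t (u - 1 - s))" for s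
  proof
    fix p assume p: "p \<in> K n t s"
    have "pin val 1 (HH p q)" if q: "q \<in> K n t (u - 1 - s)" for q
    proof -
      obtain a m where a: "a \<in> R (s - t)" "m \<in> M (s + 1)" "p = act a n + m"
        using p by (rule K_E)
      obtain c m' where c: "c \<in> R (u - 1 - s - t)" "m' \<in> M (u - 1 - s + 1)" "q = act c n + m'"
        using q by (rule K_E)
      have "adj a ** c \<in> R (u - 1 - 2 * t)"
        using A.R_mult[OF A.R_adj[OF a(1)] c(1)] by (simp add: algebra_simps)
      then have 1: "pin val 1 (HH (act a n) (act c n))"
        unfolding HH_adj act_simps(3)[symmetric] by (rule iso)
      have 2: "pin val 1 (HH (act a n) m')"
      proof -
        have "act a n \<in> M (u - (u - 1 - s + 1))" by (rule R_act_M[OF a(1) n]) simp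
        then show ?thesis using c(2) unfolding M_dual[symmetric] by (simp add: E.dual_def)
      qed
      have 3: "pin val 1 (HH m q)"
      proof -
        have "q \<in> M (u - 1 - s)" using q K(3) by blast
        moreover have "m \<in> M (u - (u - 1 - s))" using a(2) by (simp add: algebra_simps)
        ultimately show ?thesis unfolding M_dual[symmetric] by (simp add: E.dual_def)
      qed
      have "HH p q = HH (act a n) (act c n) + HH (act a n) m' + HH m q"
        by (simp add: a(3) c(3) E.H_add_left E.H_add_right)
      then show ?thesis using 1 2 3 pin_add[OF val] by simp
    qed
    then show "p \<in> E.dual (K n t (u - 1 - s))" by (simp add: E.dual_def)
  qed
  have sI: "E.submod (L s \<inter> E.dual (K n t (u - 1 - s)))" for s
    using Lag_submod[OF L, of s] E.dual_submod[of "K n t (u - 1 - s)"] by (auto simp: E.submod_def)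
  show ?thesis
    unfolding Lag_def
  proof (intro conjI allI impI)
    fix s
    show "M (s + 1) \<subseteq> nb L n t s"
      unfolding nb_def using E.plus_subset[OF sI K(1)] K(2) by blast
    show "nb L n t s \<subseteq> M s"
      unfolding nb_def by (rule E.plus_least[OF M_submod]) (use LagD(2)[OF L] K(3) in blast)+
    have stab: "u - 1 - (u - 1 - s) = s" by simp
    have "E.dual (nb L n t s) = E.dual (L s \<inter> E.dual (K n t (u - 1 - s))) \<inter> E.dual (K n t s)"
      unfolding nb_def by (rule E.dual_plus[OF sI K(1)])
    also have "E.dual (L s \<inter> E.dual (K n t (u - 1 - s))) = E.plus_set (L (u - 1 - s)) (K n t (u - 1 - s))"
    proof -
      have "E.lat (E.plus_set (L (u - 1 - s)) (K n t (u - 1 - s)))"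
      proof (rule E.lat_sandwich[OF M_lat M_lat])
        show "M (u - 1 - s + 1) \<subseteq> E.plus_set (L (u - 1 - s)) (K n t (u - 1 - s))"
          using E.plus_subset[OF Lag_submod[OF L] K(1)] K(2) by blast
      qed (rule E.plus_least[OF M_submod LagD(2)[OF L] K(3)] E.submod_plus[OF Lag_submod[OF L] K(1)])+
      then show ?thesis
        using E.dual_Int[OF Lag_lat[OF L, of s] E.lat_dual[OF K(4)[of "u - 1 - s"]]]
        by (simp add: LagD(3)[OF L] E.dual_dual[OF K(4)])
    qed
    also have "E.plus_set (L (u - 1 - s)) (K n t (u - 1 - s)) \<inter> E.dual (K n t s) = nb L n t (u - 1 - s)"
    proof (intro equalityI subsetI)
      fix p assume p: "p \<in> E.plus_set (L (u - 1 - s)) (K n t (u - 1 - s)) \<inter> E.dual (K n t s)"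
      then obtain z k where zk: "z \<in> L (u - 1 - s)" "k \<in> K n t (u - 1 - s)" "p = z + k"
        unfolding E.plus_set_def by blast
      have "k \<in> E.dual (K n t s)" using KK[of "u - 1 - s"] zk(2) by (auto simp: stab)
      then have "z \<in> E.dual (K n t s)" using E.submod_diff[OF E.dual_submod, of p "K n t s" k] p zk(3) by auto
      then show "p \<in> nb L n t (u - 1 - s)"
        unfolding nb_def stab zk(3) using zk by (intro E.plus_setI) auto
    next
      fix p assume "p \<in> nb L n t (u - 1 - s)"
      then obtain z k where zk: "z \<in> L (u - 1 - s)" "z \<in> E.dual (K n t s)" "k \<in> K n t (u - 1 - s)" "p = z + k"
        unfolding nb_def E.plus_set_def stab by blast
      have "k \<in> E.dual (K n t s)" using KK[of "u - 1 - s"] zk(3) by (auto simp: stab)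
      then have "p \<in> E.dual (K n t s)" using E.submod_add[OF E.dual_submod] zk by auto
      then show "p \<in> E.plus_set (L (u - 1 - s)) (K n t (u - 1 - s)) \<inter> E.dual (K n t s)"
        using zk by (auto intro: E.plus_setI)
    qed
    finally show "E.dual (nb L n t s) = nb L n t (u - 1 - s)" .
  next
    fix m s a p assume a: "a \<in> R m" and "p \<in> nb L n t s"
    then obtain z k where zk: "z \<in> L s" "z \<in> E.dual (K n t (u - 1 - s))" "k \<in> K n t s" "p = z + k"
      unfolding nb_def E.plus_set_def by blast
    have "act a z \<in> E.dual (K n t (u - 1 - (s + m)))"
    proof -
      have "pin val 1 (HH (act a z) q)" if q: "q \<in> K n t (u - 1 - (s + m))" for q
      proof -
        have "act (adj a) q \<in> K n t (u - 1 - (s + m) + m)" by (rule K(5)[OF A.R_adj[OF a] q])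
        then show ?thesis using zk(2) by (simp add: HH_adj E.dual_def algebra_simps)
      qed
      then show ?thesis by (simp add: E.dual_def)
    qed
    moreover have "act a z \<in> L (s + m)" by (rule LagD(4)[OF L a zk(1)])
    moreover have "act a k \<in> K n t (s + m)" by (rule K(5)[OF a zk(3)])
    ultimately show "act a p \<in> nb L n t (s + m)"
      unfolding nb_def zk(4) act_simps(1) by (intro E.plus_setI) auto
  qed
qed

end

lemma (in latseq) coset_eq_iff: "{z. z - v \<in> \<Lambda> s} = {z. z - y \<in> \<Lambda> s} \<longleftrightarrow> v - y \<in> \<Lambda> s"
proof
  assume "{z. z - v \<in> \<Lambda> s} = {z. z - y \<in> \<Lambda> s}"
  moreover have "v \<in> {z. z - v \<in> \<Lambda> s}" by (simp add: L_zero)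
  ultimately show "v - y \<in> \<Lambda> s" by auto
next
  assume vy: "v - y \<in> \<Lambda> s"
  have "z - v \<in> \<Lambda> s \<longleftrightarrow> z - y \<in> \<Lambda> s" for z
    using L_add_cancel[OF vy, of "z - v"] by simp
  then show "{z. z - v \<in> \<Lambda> s} = {z. z - y \<in> \<Lambda> s}" by simp
qed

section \<open>Reducing the kernel of a Lagrangian\<close>

context witt
begin

lemma one_in_R: "mat 1 \<in> R 0"
  using R_scalar[of 1] discrete_valuation_one[OF val] by simp

lemma Lag_fst_isotropic:
  assumes L: "Lag L" and i: "(i, 0) \<in> L s" and c: "c \<in> R (u - 1 - 2 * s)"
  shows "pin val 1 (h i (c *v i))"
proof -
  have "act c (i, 0) \<in> L (s + (u - 1 - 2 * s))" by (rule LagD(4)[OF L c i])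
  then have "pin val 1 (HH (i, 0) (act c (i, 0)))" using Lag_pairing[OF L i] by (simp add: algebra_simps)
  then show ?thesis by (simp add: HH_def act_def)
qed

lemma Lag_snd_isotropic:
  assumes L: "Lag L" and i: "(0, i) \<in> L s" and c: "c \<in> R (u - 1 - 2 * s)"
  shows "pin val 1 (h i (c *v i))"
proof -
  have "act c (0, i) \<in> L (s + (u - 1 - 2 * s))" by (rule LagD(4)[OF L c i])
  then have "pin val 1 (HH (0, i) (act c (0, i)))" using Lag_pairing[OF L i] by (simp add: algebra_simps)
  then show ?thesis by (simp add: HH_def act_def pin_uminus[OF val])
qed

text \<open>A vector orthogonal to the first projection of \<open>L s\<close> lies in the kernel of
  \<open>L\<close> in the complementary degree. If that kernel is residually trivial, biduality
  makes the projection all of \<open>\<Lambda> s\<close>.\<close>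

lemma Lag_fst_surj:
  assumes L: "Lag L" and z: "\<And>z. (z, 0) \<in> L (u - 1 - s) \<Longrightarrow> z \<in> \<Lambda> (u - s)" and v: "v \<in> \<Lambda> s"
  shows "\<exists>v'. (v, v') \<in> L s"
proof -
  define U where "U = fst ` L s"
  have sm: "D.submod U"
    using Lag_submod[OF L, of s] unfolding D.submod_def E.submod_def U_def
    by (auto simp: image_iff psc_def zero_prod_def) (metis fst_conv fst_add)+
  have "\<Lambda> (s + 1) \<subseteq> U"
  proof
    fix y assume "y \<in> \<Lambda> (s + 1)"
    then have "(y, 0) \<in> L s" using LagD(1)[OF L, of s] B.L_zero by (auto simp: M_def)
    then show "y \<in> U" unfolding U_def by force
  qed
  moreover have "U \<subseteq> \<Lambda> s" using LagD(2)[OF L, of s] by (auto simp: U_def M_def)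
  ultimately have lU: "D.lat U" using D.lat_sandwich[OF A.lat_L A.lat_L] sm by blast
  have "D.dual U \<subseteq> \<Lambda> (u - s)"
  proof
    fix y assume y: "y \<in> D.dual U"
    have "pin val 1 (HH (y, 0) p)" if "p \<in> L s" for p
      using y that by (auto simp: D.dual_def U_def HH_def)
    then have "(y, 0) \<in> L (u - 1 - s)" using LagD(3)[OF L, of s] by (auto simp: E.dual_def)
    then show "y \<in> \<Lambda> (u - s)" by (rule z)
  qed
  then have "\<Lambda> s \<subseteq> U" using D.dual_anti[of "D.dual U" "\<Lambda> (u - s)"] D.dual_dual[OF lU] A.dual_eq[of "u - s"] by simp
  then show ?thesis using v by (force simp: U_def)
qed

lemma Lag_snd_surj:
  assumes L: "Lag L" and z: "\<And>z. (0, z) \<in> L (u - 1 - s) \<Longrightarrow> z \<in> \<Lambda>' (u - s)" and v: "v \<in> \<Lambda>' s"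
  shows "\<exists>v'. (v', v) \<in> L s"
proof -
  define U where "U = snd ` L s"
  have sm: "D.submod U"
    using Lag_submod[OF L, of s] unfolding D.submod_def E.submod_def U_def
    by (auto simp: image_iff psc_def zero_prod_def) (metis snd_conv snd_add)+
  have "\<Lambda>' (s + 1) \<subseteq> U"
  proof
    fix y assume "y \<in> \<Lambda>' (s + 1)"
    then have "(0, y) \<in> L s" using LagD(1)[OF L, of s] A.L_zero by (auto simp: M_def)
    then show "y \<in> U" unfolding U_def by force
  qed
  moreover have "U \<subseteq> \<Lambda>' s" using LagD(2)[OF L, of s] by (auto simp: U_def M_def)
  ultimately have lU: "D.lat U" using D.lat_sandwich[OF B.lat_L B.lat_L] sm by blast
  have "D.dual U \<subseteq> \<Lambda>' (u - s)"
  proof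
    fix y assume y: "y \<in> D.dual U"
    have "pin val 1 (HH (0, y) p)" if "p \<in> L s" for p
      using y that by (auto simp: D.dual_def U_def HH_def pin_uminus[OF val])
    then have "(0, y) \<in> L (u - 1 - s)" using LagD(3)[OF L, of s] by (auto simp: E.dual_def)
    then show "y \<in> \<Lambda>' (u - s)" by (rule z)
  qed
  then have "\<Lambda>' s \<subseteq> U" using D.dual_anti[of "D.dual U" "\<Lambda>' (u - s)"] D.dual_dual[OF lU] B.dual_eq[of "u - s"] by simp
  then show ?thesis using v by (force simp: U_def)
qed

text \<open>Otherwise the Lagrangian would induce an injection of \<open>\<Lambda>' s / \<Lambda>' (s + 1)\<close> into \<open>\<Lambda> s / \<Lambda> (s + 1)\<close>
  missing the class of \<open>i\<close>.\<close>

lemma Lag_kernel_transfer: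
  assumes L: "Lag L" and i: "(i, 0) \<in> L s" "i \<notin> \<Lambda> (s + 1)"
  shows "(\<exists>i'. (0, i') \<in> L s \<and> i' \<notin> \<Lambda>' (s + 1)) \<or> (\<exists>i'. (0, i') \<in> L (u - 1 - s) \<and> i' \<notin> \<Lambda>' (u - s))"
proof (rule ccontr)
  assume neg: "\<not> ?thesis"
  have F: "z \<in> \<Lambda>' (s + 1)" if "(0, z) \<in> L s" for z using neg that by blast
  have surj: "\<exists>v. (v, v') \<in> L s" if "v' \<in> \<Lambda>' s" for v'
    by (rule Lag_snd_surj[OF L _ that]) (use neg in blast)
  define co where "co v = {z. z - v \<in> \<Lambda> (s + 1)}" for v
  define co' where "co' v = {z. z - v \<in> \<Lambda>' (s + 1)}" for v
  define W where "W = co ` \<Lambda> s"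
  define W' where "W' = co' ` \<Lambda>' s"
  have fin: "finite W" "finite W'" "card W' = card W"
    using quot_fin[of s] quot_fin'[of s] quot_card[of s] by (simp_all add: W_def W'_def co_def[abs_def] co'_def[abs_def])
  define pick where "pick C = (SOME p. p \<in> L s \<and> co' (snd p) = C)" for C
  have pick: "pick C \<in> L s" "co' (snd (pick C)) = C" if CW: "C \<in> W'" for C
  proof -
    obtain v' where v': "v' \<in> \<Lambda>' s" "C = co' v'" using CW by (auto simp: W'_def)
    obtain v where "(v, v') \<in> L s" using surj[OF v'(1)] by blast
    then have "\<exists>p. p \<in> L s \<and> co' (snd p) = C" using v' by (intro exI[of _ "(v, v')"]) simp
    from someI_ex[OF this] show "pick C \<in> L s" "co' (snd (pick C)) = C" unfolding pick_def by blast+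
  qed
  define f where "f C = co (fst (pick C))" for C
  have sm: "E.submod (L s)" by (rule Lag_submod[OF L])
  have diffL: "snd p - snd q \<in> \<Lambda>' (s + 1)" if pq: "p \<in> L s" "q \<in> L s" "co (fst p) = co (fst q)" for p q
  proof -
    have "fst p - fst q \<in> \<Lambda> (s + 1)" using pq(3) by (simp add: co_def A.coset_eq_iff)
    then have "(fst p - fst q, 0) \<in> L s" using LagD(1)[OF L, of s] B.L_zero by (auto simp: M_def)
    then have "p - q - (fst p - fst q, 0) \<in> L s" using E.submod_diff[OF sm] pq by blast
    moreover have "p - q - (fst p - fst q, 0) = (0, snd p - snd q)" by (simp add: prod_eq_iff)
    ultimately show ?thesis using F by simp
  qed
  have "inj_on f W'"
  proof (rule inj_onI)
    fix C C' assume C: "C \<in> W'" "C' \<in> W'" "f C = f C'"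
    then have "snd (pick C) - snd (pick C') \<in> \<Lambda>' (s + 1)" using diffL pick by (simp add: f_def)
    then have "co' (snd (pick C)) = co' (snd (pick C'))" by (simp add: co'_def B.coset_eq_iff)
    then show "C = C'" using pick C by simp
  qed
  moreover have "f ` W' \<subseteq> W"
  proof
    fix X assume "X \<in> f ` W'"
    then obtain C where C: "C \<in> W'" "X = co (fst (pick C))" by (auto simp: f_def)
    then have "fst (pick C) \<in> \<Lambda> s" using pick(1)[OF C(1)] LagD(2)[OF L, of s] M_iff by blast
    then show "X \<in> W" using C(2) by (simp add: W_def)
  qed
  \<comment> \<open>Equal cardinality makes the injection onto, so the classes of \<open>i\<close>
    and of 0 are both hit. Their preimages coincide, as both have representatives in
    \<open>\<Lambda>' (s + 1)\<close>, and this forces \<open>i\<close> into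
    \<open>\<Lambda> (s + 1)\<close>.\<close>
  ultimately have "f ` W' = W" using fin by (metis card_image card_subset_eq)
  moreover have "co i \<in> W" "co 0 \<in> W" using i(1) LagD(2)[OF L, of s] A.L_zero by (auto simp: W_def M_def)
  ultimately obtain C C' where C: "C \<in> W'" "f C = co i" "C' \<in> W'" "f C' = co 0" by (metis imageE)
  have "snd (pick C) - snd (i, 0::'k^'n) \<in> \<Lambda>' (s + 1)" by (rule diffL) (use C pick i f_def in auto)
  moreover have "(0, 0) \<in> L s" using E.submod_zero[OF sm] by (simp add: zero_prod_def)
  then have "snd (pick C') - snd (0::'k^'n, 0::'k^'n) \<in> \<Lambda>' (s + 1)" by (intro diffL) (use C pick f_def in auto)
  ultimately have "snd (pick C) - snd (pick C') \<in> \<Lambda>' (s + 1)" using B.L_diff by fastforce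
  then have "co' (snd (pick C)) = co' (snd (pick C'))" by (simp add: co'_def B.coset_eq_iff)
  then have "co i = co 0" using pick C by simp
  then have "i - 0 \<in> \<Lambda> (s + 1)" unfolding co_def by (rule A.coset_eq_iff[THEN iffD1])
  then show False using i(2) by simp
qed

lemma nb_E:
  assumes "p \<in> nb L n t r"
  obtains z a m where "z \<in> L r" "z \<in> E.dual (K n t (u - 1 - r))" "a \<in> R (r - t)" "m \<in> M (r + 1)" "p = z + act a n + m"
proof -
  obtain z k where zk: "z \<in> L r" "z \<in> E.dual (K n t (u - 1 - r))" "k \<in> K n t r" "p = z + k"
    using assms unfolding nb_def E.plus_set_def by blast
  obtain a m where "a \<in> R (r - t)" "m \<in> M (r + 1)" "k = act a n + m" using zk(3) by (rule K_E)
  then show thesis using that[OF zk(1,2)] zk(4) by (simp add: add.assoc)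
qed

text \<open>The vector \<open>(0, i')\<close> of \<open>L\<close> detects the coefficient of
  \<open>(n0, j')\<close>: pairing with it shows that this coefficient is residually zero. So the
  neighbour acquires no new elements \<open>(v, 0)\<close>, and those that remain are orthogonal to
  the orbit of \<open>n0\<close>.\<close>

lemma nb_kernel:
  assumes L: "Lag L" and n: "(n0, j') \<in> M t" and i': "(0, i') \<in> L (u - 1 - t)" "\<not> pin val 1 (h j' i')"
    and v: "(v, 0) \<in> nb L (n0, j') t r"
  shows "(v, 0) \<in> L r" "c \<in> R (u - 1 - r - t) \<Longrightarrow> pin val 1 (h v (c *v n0))"
proof -
  note K = K_facts[OF n]
  obtain z a m where z: "z \<in> L r" "z \<in> E.dual (K (n0, j') t (u - 1 - r))" "a \<in> R (r - t)" "m \<in> M (r + 1)"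
    "(v, 0) = z + act a (n0, j') + m"
    using v by (rule nb_E)
  have "snd z + (a *v j' + snd m) = 0" using z(5) by (simp add: act_def prod_eq_iff add.assoc)
  then have zs: "snd z = - (a *v j' + snd m)" by (simp only: eq_neg_iff_add_eq_0)
  have j'L: "j' \<in> \<Lambda>' t" and i'L: "i' \<in> \<Lambda>' (u - 1 - t)"
    using n i'(1) LagD(2)[OF L, of "u - 1 - t"] by (auto simp: M_def)
  have "a \<in> J (r - t + 1)"
  proof (rule ccontr)
    assume aJ: "a \<notin> J (r - t + 1)"
    have "pin val 1 (h j' i')"
    proof (rule B.unit_pairing[OF z(3) aJ j'L i'L])
      fix c assume c: "c \<in> R (- (r - t))"
      have "act c (0, i') \<in> L (u - 1 - t + - (r - t))" by (rule LagD(4)[OF L c i'(1)])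
      then have 1: "pin val 1 (HH z (act c (0, i')))" using Lag_pairing[OF L z(1)] by (simp add: algebra_simps)
      have 2: "pin val 1 (h (snd m) (c *v i'))"
        by (rule B.pairing[OF _ B.filtD[OF B.R_filt[OF c] i'L refl], of _ "r + 1"]) (use z(4) in \<open>auto simp: M_iff\<close>)
      have "HH z (act c (0, i')) = h (a *v j') (c *v i') + h (snd m) (c *v i')"
        by (simp add: HH_def act_def zs h_minus h_add h_diff)
      then have "h (a *v j') (c *v i') = HH z (act c (0, i')) - h (snd m) (c *v i')" by simp
      then show "pin val 1 (h (a *v j') (c *v i'))" using 1 2 pin_diff[OF val] by simp
    qed
    then show False using i'(2) by blast
  qed
  then have an: "act a (n0, j') \<in> M (r + 1)" by (rule J_act_M[OF _ n]) simp
  have dM: "M (r + 1) \<subseteq> E.dual (K (n0, j') t (u - 1 - r))"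
    using E.dual_anti[OF K(3)[of "u - 1 - r"]] by (simp add: M_dual algebra_simps)
  have rest: "act a (n0, j') + m \<in> M (r + 1)" by (rule E.submod_add[OF M_submod an z(4)])
  have eq: "(v, 0) = z + (act a (n0, j') + m)" using z(5) by (simp add: add.assoc)
  show "(v, 0) \<in> L r"
    unfolding eq using E.submod_add[OF Lag_submod[OF L] z(1)] rest LagD(1)[OF L, of r] by blast
  have vd: "(v, 0) \<in> E.dual (K (n0, j') t (u - 1 - r))"
    unfolding eq using E.submod_add[OF E.dual_submod z(2)] rest dM by blast
  show "pin val 1 (h v (c *v n0))" if "c \<in> R (u - 1 - r - t)"
  proof -
    have "act c (n0, j') \<in> K (n0, j') t (u - 1 - r)" by (rule K(6)[OF that])
    then have "pin val 1 (HH (v, 0) (act c (n0, j')))" using vd by (simp add: E.dual_def)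
    then show ?thesis by (simp add: HH_def act_def)
  qed
qed

text \<open>One step of Witt cancellation. The kernel vector \<open>i\<close> on the first side is
  accompanied by a kernel vector on the second, in the same or in the complementary degree;
  neighbours built from hyperbolic partners of the two expel \<open>i\<close> and add nothing to the
  kernel.\<close>

lemma Lag_reduce:
  assumes L: "Lag L" and i: "(i, 0) \<in> L s" "i \<notin> \<Lambda> (s + 1)"
  shows "\<exists>L'. Lag L' \<and> (\<forall>r v. (v, 0) \<in> L' r \<longrightarrow> (v, 0) \<in> L r) \<and> (i, 0) \<notin> L' s"
proof -
  define t where "t = u - 1 - s"
  have t: "u - 1 - t = s" "u - 1 - s = t" "2 * s + 1 - u = u - 1 - 2 * t" "2 * t + 1 - u = u - 1 - 2 * s"
    "u - s = t + 1"
    by (simp_all add: t_def)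
  have iL: "i \<in> \<Lambda> s" using i(1) LagD(2)[OF L, of s] by (auto simp: M_def)
  obtain j where j: "j \<in> \<Lambda> t" "\<not> pin val 1 (h i j)" and jiso: "\<And>a. a \<in> R (u - 1 - 2 * t) \<Longrightarrow> pin val 1 (h j (a *v j))"
    using A.isotropic_partner[OF iL i(2) Lag_fst_isotropic[OF L i(1)]] unfolding t by blast
  from Lag_kernel_transfer[OF L i] consider
    (a) i' where "(0, i') \<in> L s" "i' \<notin> \<Lambda>' (s + 1)" | (b) i' where "(0, i') \<in> L t" "i' \<notin> \<Lambda>' (t + 1)"
    unfolding t by blast
  then show ?thesis
  proof cases
    case a
    have i'L: "i' \<in> \<Lambda>' s" using a(1) LagD(2)[OF L, of s] by (auto simp: M_def)
    obtain j' where j': "j' \<in> \<Lambda>' t" "\<not> pin val 1 (h i' j')" and j'iso: "\<And>a. a \<in> R (u - 1 - 2 * t) \<Longrightarrow> pin val 1 (h j' (a *v j'))"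
      using B.isotropic_partner[OF i'L a(2) Lag_snd_isotropic[OF L a(1)]] unfolding t by blast
    \<comment> \<open>Both partners have degree \<open>t\<close>, so one neighbour along
      \<open>(j, j')\<close> suffices. It excludes \<open>(i, 0)\<close> because \<open>i\<close> is
      not orthogonal to \<open>j\<close>.\<close>
    have n: "(j, j') \<in> M t" using j j' by (simp add: M_def)
    have N: "Lag (nb L (j, j') t)"
      by (rule neighbour[OF L n]) (simp add: HH_def act_def jiso j'iso pin_diff[OF val])
    have i'2: "(0, i') \<in> L (u - 1 - t)" "\<not> pin val 1 (h j' i')" using a(1) j'(2) pin_h_sym by (simp_all only: t(1)) blast
    note ker = nb_kernel[OF L n i'2]
    have "(i, 0) \<notin> nb L (j, j') t s"
    proof
      assume "(i, 0) \<in> nb L (j, j') t s"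
      then have "pin val 1 (h i (mat 1 *v j))" by (rule ker(2)) (simp add: t_def one_in_R)
      then show False using j(2) by simp
    qed
    then show ?thesis using N ker(1) by blast
  next
    case b
    have i'L: "i' \<in> \<Lambda>' t" using b(1) LagD(2)[OF L, of t] by (auto simp: M_def)
    note i'iso = Lag_snd_isotropic[OF L b(1)]
    obtain j' where j': "j' \<in> \<Lambda>' s" "\<not> pin val 1 (h i' j')" and j'iso: "\<And>a. a \<in> R (u - 1 - 2 * s) \<Longrightarrow> pin val 1 (h j' (a *v j'))"
      using B.isotropic_partner[OF i'L b(2) i'iso] unfolding t by blast
    \<comment> \<open>Here \<open>j\<close> has degree \<open>t\<close> but \<open>j'\<close> has
      degree \<open>s\<close>, so the pair of partners is not homogeneous. The pairs
      \<open>(j, i')\<close> and \<open>(i, j')\<close> are, and two successive neighbours are taken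
      along them.\<close>
    define n1 where "n1 = (j, i')"
    define L1 where "L1 = nb L n1 t"
    have n1: "n1 \<in> M t" using j i'L by (simp add: M_def n1_def)
    have N1: "Lag L1"
      unfolding L1_def
      by (rule neighbour[OF L n1]) (simp add: HH_def act_def n1_def jiso i'iso pin_diff[OF val])
    have i'L1: "(0, i') \<in> L1 t"
    proof -
      have "pin val 1 (HH (0, i') q)" if "q \<in> K n1 t (u - 1 - t)" for q
      proof -
        obtain c m where c: "c \<in> R (u - 1 - t - t)" "m \<in> M (u - 1 - t + 1)" "q = act c n1 + m" using \<open>q \<in> _\<close> by (rule K_E)
        have "pin val 1 (h i' (c *v i'))" using i'iso[of c] c(1) by simp
        moreover have "pin val 1 (h i' (snd m))" by (rule B.pairing[OF i'L, of _ "u - 1 - t + 1"]) (use c(2) in \<open>auto simp: M_iff\<close>)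
        moreover have "HH (0, i') q = - (h i' (c *v i') + h i' (snd m))"
          by (simp add: HH_def c(3) act_def n1_def h_add)
        ultimately show ?thesis using pin_add[OF val] pin_uminus[OF val] by metis
      qed
      then have "(0, i') \<in> L t \<inter> E.dual (K n1 t (u - 1 - t))" using b(1) by (simp add: E.dual_def)
      moreover have "0 \<in> K n1 t t" using E.submod_zero[OF K_facts(1)[OF n1]] .
      ultimately have "(0, i') + 0 \<in> nb L n1 t t" unfolding nb_def by (rule E.plus_setI)
      then show ?thesis by (simp add: L1_def)
    qed
    have n2: "(i, j') \<in> M s" using iL j' by (simp add: M_def)
    define L2 where "L2 = nb L1 (i, j') s"
    have N2: "Lag L2"
      unfolding L2_def
      by (rule neighbour[OF N1 n2]) (simp add: HH_def act_def Lag_fst_isotropic[OF L i(1)] j'iso pin_diff[OF val])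
    have ker: "(v, 0) \<in> L r \<and> (r = s \<longrightarrow> pin val 1 (h v j))" if v: "(v, 0) \<in> L2 r" for v r
    proof -
      have v2: "(v, 0) \<in> nb L1 (i, j') s r" using v by (simp add: L2_def)
      have i'2: "(0, i') \<in> L1 (u - 1 - s)" "\<not> pin val 1 (h j' i')" using i'L1 j'(2) pin_h_sym by (simp_all only: t(2)) blast
      have v1: "(v, 0) \<in> nb L n1 t r" using nb_kernel(1)[OF N1 n2 i'2 v2] by (simp add: L1_def)
      have vi: "pin val 1 (h v (c *v i))" if "c \<in> R (u - 1 - r - s)" for c
        using nb_kernel(2)[OF N1 n2 i'2 v2 that] .
      obtain z a m where z: "z \<in> L r" "z \<in> E.dual (K n1 t (u - 1 - r))" "a \<in> R (r - t)" "m \<in> M (r + 1)"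
        "(v, 0) = z + act a n1 + m"
        using v1 by (rule nb_E)
      have "snd z + (a *v i' + snd m) = 0" using z(5) by (simp add: act_def n1_def prod_eq_iff add.assoc)
      then have zs: "snd z = - (a *v i' + snd m)" by (simp only: eq_neg_iff_add_eq_0)
      have zf: "v = fst z + a *v j + fst m" using z(5) by (simp add: act_def n1_def prod_eq_iff)
      have "(fst z, 0) = z + (act a (0, i') + (0, snd m))" by (simp add: prod_eq_iff zs act_def)
      moreover have "act a (0, i') \<in> L r" using LagD(4)[OF L z(3) b(1)] by simp
      moreover have "(0, snd m) \<in> L r" using z(4) LagD(1)[OF L, of r] A.L_zero by (auto simp: M_def)
      ultimately have fz: "(fst z, 0) \<in> L r" using E.submod_add[OF Lag_submod[OF L]] z(1) by metis
      \<comment> \<open>The second neighbour makes \<open>v\<close> orthogonal to the orbit of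
        \<open>i\<close>; this kills the coefficient of \<open>j\<close>, which is not orthogonal to
        \<open>i\<close>.\<close>
      have aJ: "a \<in> J (r - t + 1)"
      proof (rule ccontr)
        assume aJ: "a \<notin> J (r - t + 1)"
        have iL': "i \<in> \<Lambda> (u - 1 - t)" using iL by (simp only: t(1))
        have "pin val 1 (h j i)"
        proof (rule A.unit_pairing[OF z(3) aJ j(1) iL'])
          fix c assume c: "c \<in> R (- (r - t))"
          have "act c (i, 0) \<in> L (s + - (r - t))" by (rule LagD(4)[OF L c i(1)])
          then have "pin val 1 (HH (fst z, 0) (act c (i, 0)))" using Lag_pairing[OF L fz] by (simp add: t_def algebra_simps)
          then have 1: "pin val 1 (h (fst z) (c *v i))" by (simp add: HH_def act_def)
          have 2: "pin val 1 (h (fst m) (c *v i))"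
            by (rule A.pairing[OF _ A.filtD[OF A.R_filt[OF c] iL refl], of _ "r + 1"]) (use z(4) t_def in \<open>auto simp: M_iff\<close>)
          have 3: "pin val 1 (h v (c *v i))" by (rule vi) (use c in \<open>simp add: t_def algebra_simps\<close>)
          have "h (a *v j) (c *v i) = h v (c *v i) - h (fst z) (c *v i) - h (fst m) (c *v i)"
            by (simp add: zf h_add)
          then show "pin val 1 (h (a *v j) (c *v i))" using 1 2 3 pin_diff[OF val] by metis
        qed
        then show False using j(2) pin_h_sym by blast
      qed
      have aj: "a *v j \<in> \<Lambda> (r + 1)" by (rule A.filtD[OF A.J_filt[OF aJ] j(1)]) simp
      have ai': "a *v i' \<in> \<Lambda>' (r + 1)" by (rule B.filtD[OF B.J_filt[OF aJ] i'L]) simp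
      have l: "a *v j + fst m \<in> \<Lambda> (r + 1)" by (rule A.L_add[OF aj]) (use z(4) in \<open>simp add: M_iff\<close>)
      then have "(a *v j + fst m, 0) \<in> L r" using LagD(1)[OF L, of r] B.L_zero by (auto simp: M_def)
      then have "(fst z, 0) + (a *v j + fst m, 0) \<in> L r" using E.submod_add[OF Lag_submod[OF L] fz] by blast
      then have "(v, 0) \<in> L r" by (simp add: zf add.assoc)
      moreover have "pin val 1 (h v j)" if r: "r = s"
      proof -
        have "act (mat 1) n1 \<in> K n1 t (u - 1 - r)" by (rule K_facts(6)[OF n1]) (simp add: r t one_in_R)
        then have "pin val 1 (HH z (act (mat 1) n1))" using z(2) by (simp add: E.dual_def)
        then have 1: "pin val 1 (h (fst z) j - h (snd z) i')" by (simp add: HH_def act_def n1_def)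
        have "snd z \<in> \<Lambda>' (r + 1)" unfolding zs by (intro B.L_uminus B.L_add ai') (use z(4) in \<open>simp add: M_iff\<close>)
        then have 2: "pin val 1 (h (snd z) i')" by (rule B.pairing[OF _ i'L]) (simp add: r t_def)
        have 3: "pin val 1 (h (a *v j + fst m) j)" by (rule A.pairing[OF l j(1)]) (simp add: r t_def)
        have "h v j = (h (fst z) j - h (snd z) i') + h (snd z) i' + h (a *v j + fst m) j"
          by (simp add: zf h_add)
        then show ?thesis using 1 2 3 pin_add[OF val] by metis
      qed
      ultimately show ?thesis by blast
    qed
    have "(i, 0) \<notin> L2 s" using ker[of i s] j(2) by blast
    then show ?thesis using N2 ker by blast
  qed
qed

text \<open>\<open>\<mu>\<close> counts kernel classes over one period. By \<open>Lag_reduce\<close>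
  a Lagrangian minimizing it has residually trivial kernel on the first side, and hence projects
  onto the first factor.\<close>

lemma residual_isometry: "\<exists>L. Lag L \<and> (\<forall>s v. v \<in> \<Lambda> s \<longrightarrow> (\<exists>v'. (v, v') \<in> L s))"
proof -
  define co where "co s v = {z. z - v \<in> \<Lambda> (s + 1)}" for s v
  define ker where "ker L s = {v. (v, 0) \<in> L s}" for L :: "int \<Rightarrow> (('k^'n) \<times> ('k^'n)) set" and s
  define \<mu> where "\<mu> L = (\<Sum>s\<in>{0..<e}. card (co s ` ker L s))" for L
  have fin: "finite (co s ` ker L s)" if "Lag L" for L s
    using finite_subset[OF image_mono quot_fin[of s], of "ker L s"] LagD(2)[OF that, of s]
    by (auto simp: co_def[abs_def] ker_def M_def)
  have descent: "\<exists>L'. Lag L' \<and> \<mu> L' < \<mu> L" if L: "Lag L" and i: "(i, 0) \<in> L s" "i \<notin> \<Lambda> (s + 1)" for L i s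
  proof -
    obtain L' where L': "Lag L'" "\<And>r v. (v, 0) \<in> L' r \<Longrightarrow> (v, 0) \<in> L r" "(i, 0) \<notin> L' s"
      using Lag_reduce[OF L i] by blast
    have le: "card (co r ` ker L' r) \<le> card (co r ` ker L r)" for r
      by (rule card_mono[OF fin[OF L]]) (use L'(2) in \<open>auto simp: ker_def\<close>)
    \<comment> \<open>Scaling by an element of valuation \<open>- k\<close> moves the degree
      \<open>s\<close> into the period over which \<open>\<mu>\<close> sums.\<close>
    define k where "k = s div e"
    define r where "r = s mod e"
    have sr: "s = r + e * k" by (simp add: k_def r_def)
    have r: "r \<in> {0..<e}" using A.e_pos by (simp add: r_def)
    obtain c where c: "c \<noteq> 0" "val c = k" using discrete_valuation_power_int_ex[OF val] by blast
    define i0 where "i0 = inverse c *s i"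
    have ii: "i = c *s i0" using c by (simp add: i0_def vector_smult_assoc)
    have vi: "val (inverse c) = - k" using discrete_valuation_inverse[OF val c(1)] c(2) by simp
    have "act (mat (inverse c)) (i, 0) \<in> L (s + e * val (inverse c))"
      by (rule LagD(4)[OF L R_scalar i(1)]) (use c in simp)
    then have i0L: "(i0, 0) \<in> L r" by (simp add: act_simps psc_def i0_def[symmetric] vi sr)
    have i0n: "(v, 0) \<notin> L' r" if "co r v = co r i0" for v
    proof
      assume v: "(v, 0) \<in> L' r"
      have "i0 - v \<in> \<Lambda> (r + 1)" using that A.coset_eq_iff[of i0 "r + 1" v] by (auto simp: co_def)
      then have "(i0 - v, 0) \<in> L' r" using LagD(1)[OF L'(1), of r] B.L_zero by (auto simp: M_def)
      then have "(v, 0) + (i0 - v, 0) \<in> L' r" using E.submod_add[OF Lag_submod[OF L'(1)] v] by blast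
      then have "(i0, 0) \<in> L' r" by simp
      then have "act (mat c) (i0, 0) \<in> L' (r + e * val c)" by (rule LagD(4)[OF L'(1) R_scalar[OF c(1)]])
      then show False using L'(3) by (simp add: act_simps psc_def ii c(2) sr)
    qed
    have "co r ` ker L' r \<subset> co r ` ker L r"
    proof
      show "co r ` ker L' r \<subseteq> co r ` ker L r" using L'(2) by (auto simp: ker_def)
      have "co r i0 \<in> co r ` ker L r" using i0L by (simp add: ker_def)
      moreover have "co r i0 \<notin> co r ` ker L' r"
      proof
        assume "co r i0 \<in> co r ` ker L' r"
        then obtain v where "(v, 0) \<in> L' r" "co r v = co r i0" by (auto simp: ker_def)
        then show False using i0n by blast
      qed
      ultimately show "co r ` ker L' r \<noteq> co r ` ker L r" by blast
    qed
    then have "card (co r ` ker L' r) < card (co r ` ker L r)" by (rule psubset_card_mono[OF fin[OF L]])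
    then have "\<mu> L' < \<mu> L" unfolding \<mu>_def by (intro sum_strict_mono_ex1) (use le r in auto)
    then show ?thesis using L'(1) by blast
  qed
  obtain L where L: "Lag L" "\<forall>L'. Lag L' \<longrightarrow> \<mu> L \<le> \<mu> L'"
    using ex_has_least_nat[of Lag diag_lag \<mu>] diag_lag by blast
  have z: "z \<in> \<Lambda> (r + 1)" if "(z, 0) \<in> L r" for z r
    using descent[OF L(1) that] L(2) by (meson not_le)
  have "\<exists>v'. (v, v') \<in> L s" if "v \<in> \<Lambda> s" for v s
  proof (rule Lag_fst_surj[OF L(1) _ that])
    fix y assume "(y, 0) \<in> L (u - 1 - s)"
    then show "y \<in> \<Lambda> (u - s)" using z[of y "u - 1 - s"] by (simp add: algebra_simps)
  qed
  then show ?thesis using L(1) by blast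
qed

end

section \<open>Lifting residual isometries\<close>

lemma (in herm) adj_filt:
  fixes \<Lambda> :: "int \<Rightarrow> ('k^'n) set"
  assumes sd: "\<And>v s. v \<in> \<Lambda> (u - s) \<longleftrightarrow> (\<forall>z\<in>\<Lambda> s. pin val 1 (h v z))" and a: "a \<in> filt \<Lambda> n"
  shows "adj a \<in> filt \<Lambda> n"
proof -
  have "adj a *v y \<in> \<Lambda> (s + n)" if y: "y \<in> \<Lambda> s" for y s
  proof -
    have "pin val 1 (h (adj a *v y) z)" if z: "z \<in> \<Lambda> (u - (s + n))" for z
    proof -
      have "a *v z \<in> \<Lambda> (u - (s + n) + n)" using a z unfolding filt_def by blast
      then have "a *v z \<in> \<Lambda> (u - s)" by (simp add: algebra_simps)
      then have "pin val 1 (h (a *v z) y)" using sd y by blast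
      then show ?thesis using pin_h_sym adj'[of y a z] by simp
    qed
    then have "adj a *v y \<in> \<Lambda> (u - (u - (s + n)))" using sd[of "adj a *v y" "u - (s + n)"] by blast
    then show ?thesis by simp
  qed
  then show ?thesis by (auto simp: filt_def)
qed

text \<open>With \<open>deep_of_entries\<close> this identifies convergence in the filtration with
  entrywise convergence, so that completeness of the field becomes usable.\<close>

lemma (in latseq) entries_of_deep: "\<exists>n. \<forall>a\<in>filt \<Lambda> n. \<forall>i j. pin val k (a $ i $ j)"
proof -
  obtain N where N: "\<And>v i. v \<in> \<Lambda> N \<Longrightarrow> pin val k (v $ i)" using coordinates_deep by blast
  obtain M0 where M0: "\<And>j::'n. axis j 1 \<in> \<Lambda> M0" using axis_level by blast
  have "pin val k (a $ i $ j)" if a: "a \<in> filt \<Lambda> (N - M0)" for a i j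
  proof -
    have "a *v axis j 1 \<in> \<Lambda> N" by (rule filtD[OF a M0]) simp
    then have "pin val k ((a *v axis j 1) $ i)" by (rule N)
    moreover have "(a *v axis j 1) $ i = a $ i $ j"
      by (simp add: matrix_vector_mult_def axis_def if_distrib sum.delta' cong: if_cong)
    ultimately show ?thesis by simp
  qed
  then show ?thesis by blast
qed

lemma (in latseq) deep_of_entries: "\<exists>k. \<forall>a. (\<forall>i j. pin val k (a $ i $ j)) \<longrightarrow> a \<in> filt \<Lambda> n"
proof -
  obtain N where N: "\<And>v i. v \<in> \<Lambda> N \<Longrightarrow> pin val 0 (v $ i)" using coordinates_deep by blast
  obtain M0 where M0: "\<And>j::'n. axis j 1 \<in> \<Lambda> M0" using axis_level by blast
  \<comment> \<open>Large enough for \<open>N + e - 1 + n \<le> M0 + e * k\<close>; the term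
    \<open>e - 1\<close> absorbs the rounding of the level \<open>s\<close> to a multiple of the
    period above \<open>N\<close>.\<close>
  define k where "k = \<bar>n\<bar> + \<bar>M0\<bar> + \<bar>N\<bar> + 1"
  have ek: "k + e - 1 \<le> e * k"
  proof -
    have "0 \<le> (e - 1) * (k - 1)" using e_pos by (intro mult_nonneg_nonneg) (auto simp: k_def)
    then show ?thesis by (simp add: algebra_simps)
  qed
  have "a \<in> filt \<Lambda> n" if a: "\<forall>i j. pin val k (a $ i $ j)" for a
    unfolding filt_iff
  proof (intro allI impI)
    fix s v assume v: "v \<in> \<Lambda> s"
    define m where "m = (s - N) div e"
    have ms: "N + e * m \<le> s" "s < N + e * m + e"
      using e_pos mult_div_mod_eq[of e "s - N"] pos_mod_sign[of e "s - N"] pos_mod_bound[of e "s - N"]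
      unfolding m_def by linarith+
    obtain c where c: "c \<noteq> 0" "val c = m" using discrete_valuation_power_int_ex[OF dv] by blast
    obtain d where d: "d \<noteq> 0" "val d = k" using discrete_valuation_power_int_ex[OF dv] by blast
    define y where "y = inverse c *s v"
    have vy: "v = c *s y" using c by (simp add: y_def vector_smult_assoc)
    have "c *s y \<in> \<Lambda> (N + e * val c)" using L_mono[OF v ms(1)] vy c(2) by simp
    then have "y \<in> \<Lambda> N" using L_scale[OF c(1)] by simp
    then have yint: "pin val 0 (y $ j)" for j by (rule N)
    have "(\<Sum>i\<in>UNIV. (inverse d * ((a *v y) $ i)) *s axis i 1) \<in> \<Lambda> M0"
    proof (intro L_sum L_int M0)
      fix i
      have "pin val (k + 0) (a $ i $ j * y $ j)" for j using a yint by (intro pin_mult[OF dv]) auto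
      then have "pin val k ((a *v y) $ i)" by (simp add: matrix_vector_mult_def pin_sum[OF dv])
      then have "pin val (- k + k) (inverse d * ((a *v y) $ i))"
        by (intro pin_mult[OF dv]) (simp add: pin_def d discrete_valuation_inverse[OF dv d(1)])
      then show "pin val 0 (inverse d * ((a *v y) $ i))" by simp
    qed
    moreover have "(\<Sum>i\<in>UNIV. (inverse d * ((a *v y) $ i)) *s axis i 1) = inverse d *s (a *v y)"
      using basis_expansion[of "inverse d *s (a *v y)"] by simp
    ultimately have "inverse d *s (a *v y) \<in> \<Lambda> M0" by simp
    then have "d *s (inverse d *s (a *v y)) \<in> \<Lambda> (M0 + e * val d)"
      by (simp only: L_scale[OF d(1)])
    then have "a *v y \<in> \<Lambda> (M0 + e * k)" using d by (simp add: vector_smult_assoc)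
    then have "c *s (a *v y) \<in> \<Lambda> (M0 + e * k + e * val c)" using L_scale[OF c(1)] by simp
    then have "a *v v \<in> \<Lambda> (M0 + e * k + e * m)" using c(2) by (simp add: vy matrix_vector_ring)
    then show "a *v v \<in> \<Lambda> (s + n)"
    proof (rule L_mono)
      have "s + n \<le> N + e * m + e - 1 + n" using ms(2) by simp
      also have "\<dots> \<le> M0 + e * k + e * m" using ek by (simp add: k_def)
      finally show "s + n \<le> M0 + e * k + e * m" .
    qed
  qed
  then show ?thesis by blast
qed

lemma (in latseq) filt_limit:
  assumes compl: "complete_wrt val" and a: "\<And>k. a (Suc k) - a k \<in> filt \<Lambda> (int k + 1)"
  shows "\<exists>l. \<forall>n. \<exists>K. \<forall>k\<ge>K. l - a k \<in> filt \<Lambda> n"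
proof -
  have cau: "a i - a j \<in> filt \<Lambda> (int j)" if "j \<le> i" for i j
    using that
  proof (induction i rule: dec_induct)
    case base
    show ?case by (simp add: filt_zero)
  next
    case (step i)
    have "a (Suc i) - a i \<in> filt \<Lambda> (int j)" using a[of i] by (rule filt_mono) (use step in simp)
    then show ?case using step.IH filt_diff_trans by blast
  qed
  have "\<exists>l. \<forall>n. \<exists>N. \<forall>k\<ge>N. pin val n (a k $ i $ j - l)" for i j
  proof -
    have cauchy: "\<exists>N. \<forall>p\<ge>N. \<forall>q\<ge>N. pin val n (a p $ i $ j - a q $ i $ j)" for n
    proof -
      obtain m where m: "\<And>c i j. c \<in> filt \<Lambda> m \<Longrightarrow> pin val n (c $ i $ j)" using entries_of_deep by blast
      have "pin val n (a p $ i $ j - a q $ i $ j)" if pq: "p \<ge> nat m" "q \<ge> nat m" for p q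
      proof -
        have "a p - a (nat m) \<in> filt \<Lambda> m" "a q - a (nat m) \<in> filt \<Lambda> m"
          using filt_mono[OF cau[OF pq(1)]] filt_mono[OF cau[OF pq(2)]] by auto
        then have "a p - a q \<in> filt \<Lambda> m" using filt_diff_trans filt_diff_sym by blast
        then show ?thesis using m[of "a p - a q" i j] by simp
      qed
      then show ?thesis by blast
    qed
    show ?thesis
      using compl[unfolded complete_wrt_def, THEN spec, of "\<lambda>k. a k $ i $ j"] cauchy by blast
  qed
  then obtain l where l: "\<And>i j n. \<exists>N. \<forall>k\<ge>N. pin val n (a k $ i $ j - l i j)" by metis
  define lim where "lim = (\<chi> i j. l i j)"
  have "\<exists>K. \<forall>k\<ge>K. lim - a k \<in> filt \<Lambda> n" for n
  proof -
    obtain m where m: "\<And>c. (\<forall>i j. pin val m (c $ i $ j)) \<Longrightarrow> c \<in> filt \<Lambda> n" using deep_of_entries by blast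
    obtain N where N: "\<And>i j k. k \<ge> N i j \<Longrightarrow> pin val m (a k $ i $ j - l i j)" using l by metis
    define K where "K = Max (range (\<lambda>(i, j). N i j))"
    have K: "N i j \<le> K" for i j unfolding K_def by (rule Max_ge) auto
    have "lim - a k \<in> filt \<Lambda> n" if "k \<ge> K" for k
    proof (rule m, intro allI)
      fix i j
      have "pin val m (a k $ i $ j - l i j)" using N K[of i j] that by (meson order_trans)
      then have "pin val m (- (a k $ i $ j - l i j))" using pin_uminus[OF dv] by blast
      then show "pin val m ((lim - a k) $ i $ j)" by (simp add: lim_def)
    qed
    then show ?thesis by blast
  qed
  then show ?thesis by blast
qed

text \<open>The Newton iteration \<open>U \<mapsto> U (3 - adj U U) / 2\<close> converges to an exact isometry.\<close>

lemma isometry_lift: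
  fixes \<Lambda> :: "int \<Rightarrow> ('k::field^'n) set"
  assumes "herm val \<rho> \<epsilon> h" and "latseq val e \<Lambda>" and compl: "complete_wrt val"
    and sd: "\<And>v s. v \<in> \<Lambda> (u - s) \<longleftrightarrow> (\<forall>z\<in>\<Lambda> s. pin val 1 (h v z))"
    and two: "(2::'k) \<noteq> 0" "val 2 = 0"
    and b: "b \<in> filt \<Lambda> (- q)" "b' \<in> filt \<Lambda> (- q)" "herm.adj h b = - b" "herm.adj h b' = - b'"
    and G: "G \<in> filt \<Lambda> 0" "herm.adj h G ** G - mat 1 \<in> filt \<Lambda> 1" "G ** b - b' ** G \<in> filt \<Lambda> n"
  shows "\<exists>U\<in>filt \<Lambda> 0. herm.adj h U ** U = mat 1 \<and> U ** b - b' ** U \<in> filt \<Lambda> n"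
proof -
  interpret herm val \<rho> \<epsilon> h by fact
  interpret L: latseq val e \<Lambda> by fact
  obtain c where c: "pin val 0 c" "c + c = 1" "\<rho> c = c" using half[OF two] by blast
  have adjf: "adj a \<in> filt \<Lambda> n" if "a \<in> filt \<Lambda> n" for a n
    by (rule adj_filt[where u = u and \<Lambda> = \<Lambda>, OF _ that]) (rule sd)
  have cmat: "mat c \<in> filt \<Lambda> 0" by (rule L.filt_mat_int[OF c(1)])
  define S where "S U = adj U ** U - mat 1" for U
  define nxt where "nxt U = U ** (mat 1 - mat c ** S U)" for U
  have adjS: "adj (S U) = S U" for U by (simp add: S_def adj_diff adj_mult adj_adj adj_mat rho)
  \<comment> \<open>As \<open>c\<close> is 1/2, the linear term of the new error has coefficient
    \<open>1 - c - c = 0\<close>. The error therefore starts with the square of the old one, and its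
    depth grows at each step.\<close>
  have Ssucc: "S (nxt U) = (- mat (c + c * c)) ** (S U ** S U) + mat (c * c) ** (S U ** S U ** S U)" for U
  proof -
    define m where "m = S U"
    define C where "C = mat 1 - mat c ** m"
    have aC: "adj C = C"
      by (simp add: C_def adj_diff adj_mult adj_mat rho c(3) adjS m_def mat_commutes)
    have "adj (nxt U) ** nxt U = C ** (adj U ** U) ** C"
      unfolding nxt_def m_def[symmetric] C_def[symmetric] adj_mult aC by (simp add: matrix_mult_ring)
    also have "adj U ** U = mat 1 + m" by (simp add: m_def S_def)
    finally have "S (nxt U) = C ** (mat 1 + m) ** C - mat 1" by (simp add: S_def)
    moreover have "C ** (mat 1 + m) ** C *v y - y = (- mat (c + c * c)) ** (m ** m) *v y + mat (c * c) ** (m ** m ** m) *v y" for y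
    proof -
      define m1 m2 m3 where "m1 = m *v y" and "m2 = m *v m1" and "m3 = m *v m2"
      have Cv: "C *v z = z - c *s (m *v z)" for z by (simp add: C_def matrix_vector_ring mat_mult_vector)
      have "C ** (mat 1 + m) ** C *v y = (y - c *s m1) + (m1 - c *s m2) - c *s ((m1 - c *s m2) + (m2 - c *s m3))"
        by (simp add: matrix_vector_ring Cv m1_def m2_def m3_def vec.scale_right_diff_distrib vec.scale_right_distrib
            algebra_simps)
      also have "\<dots> = y + ((1 - c - c) *s m1 - (c + c - c * c) *s m2 + (c * c) *s m3)"
        by (simp add: vec_eq_iff algebra_simps)
      also have "1 - c - c = 0" using c(2) by (simp add: algebra_simps)
      also have "c + c - c * c = c + c * c"
      proof -
        have "c * (c + c) = c" using c(2) by simp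
        then show ?thesis by (simp add: algebra_simps)
      qed
      finally have "C ** (mat 1 + m) ** C *v y - y = - ((c + c * c) *s m2) + (c * c) *s m3" by simp
      then show ?thesis by (simp add: matrix_vector_ring mat_mult_vector m1_def m2_def m3_def)
    qed
    ultimately show ?thesis
      unfolding m_def[symmetric] by (simp add: matrix_eq matrix_vector_ring)
  qed
  define Q where "Q k U \<longleftrightarrow> U \<in> filt \<Lambda> 0 \<and> S U \<in> filt \<Lambda> (int k + 1) \<and> U ** b - b' ** U \<in> filt \<Lambda> n" for k U
  have cc: "mat (c * c) \<in> filt \<Lambda> 0" "- mat (c + c * c) \<in> filt \<Lambda> 0"
  proof -
    have "pin val 0 (c * c)" using pin_mult[OF val c(1) c(1)] by simp
    then show "mat (c * c) \<in> filt \<Lambda> 0" "- mat (c + c * c) \<in> filt \<Lambda> 0"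
      using L.filt_mat_int pin_add[OF val c(1)] L.filt_uminus by blast+
  qed
  have Qnxt: "Q (Suc k) (nxt U) \<and> nxt U - U \<in> filt \<Lambda> (int k + 1)" if QU: "Q k U" for k U
  proof -
    have U: "U \<in> filt \<Lambda> 0" "S U \<in> filt \<Lambda> (int k + 1)" "U ** b - b' ** U \<in> filt \<Lambda> n"
      using QU by (auto simp: Q_def)
    have aU: "adj U \<in> filt \<Lambda> 0" by (rule adjf[OF U(1)])
    have cS: "mat c ** S U \<in> filt \<Lambda> (int k + 1)" using L.filt_mult[OF cmat U(2)] by simp
    have C: "mat 1 - mat c ** S U \<in> filt \<Lambda> 0"
      by (rule L.filt_diff[OF L.filt_one L.filt_mono[OF cS]]) simp
    have 1: "nxt U \<in> filt \<Lambda> 0" unfolding nxt_def using L.filt_mult[OF U(1) C] by simp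
    have 2: "S (nxt U) \<in> filt \<Lambda> (int (Suc k) + 1)"
      unfolding Ssucc
    proof (rule L.filt_add)
      have SS: "S U ** S U \<in> filt \<Lambda> (int (Suc k) + 1)" by (rule L.filt_mult_le[OF U(2) U(2)]) simp
      show "(- mat (c + c * c)) ** (S U ** S U) \<in> filt \<Lambda> (int (Suc k) + 1)"
        using L.filt_mult[OF cc(2) SS] by simp
      have "S U ** S U ** S U \<in> filt \<Lambda> (int (Suc k) + 1)" by (rule L.filt_mult_le[OF SS U(2)]) simp
      then show "mat (c * c) ** (S U ** S U ** S U) \<in> filt \<Lambda> (int (Suc k) + 1)"
        using L.filt_mult[OF cc(1)] by fastforce
    qed
    have adjrel: "adj U ** b' - b ** adj U \<in> filt \<Lambda> n"
    proof -
      have "adj (U ** b - b' ** U) \<in> filt \<Lambda> n" by (rule adjf[OF U(3)])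
      moreover have "adj (U ** b - b' ** U) = adj U ** b' - b ** adj U"
        by (simp add: adj_diff adj_mult b matrix_mult_ring)
      ultimately show ?thesis by simp
    qed
    \<comment> \<open>\<open>U\<close> carries \<open>b\<close> to \<open>b'\<close> and its adjoint
      carries \<open>b'\<close> back to \<open>b\<close>, both up to depth \<open>n\<close>. So the
      error commutes with \<open>b\<close> to that depth, and the correction factor keeps the
      approximate equivariance.\<close>
    have Srel: "S U ** b - b ** S U \<in> filt \<Lambda> n"
    proof -
      have "S U ** b - b ** S U = adj U ** (U ** b - b' ** U) + (adj U ** b' - b ** adj U) ** U"
        by (simp add: S_def matrix_mult_ring)
      moreover have "adj U ** (U ** b - b' ** U) \<in> filt \<Lambda> n" using L.filt_mult[OF aU U(3)] by simp
      moreover have "(adj U ** b' - b ** adj U) ** U \<in> filt \<Lambda> n" using L.filt_mult[OF adjrel U(1)] by simp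
      ultimately show ?thesis by (simp only: L.filt_add)
    qed
    have 3: "nxt U ** b - b' ** nxt U \<in> filt \<Lambda> n"
    proof -
      have "nxt U ** b - b' ** nxt U
        = (U ** b - b' ** U) ** (mat 1 - mat c ** S U) - U ** (mat c ** (S U ** b - b ** S U))"
      proof -
        have "U ** mat c ** b = U ** b ** mat c" by (metis matrix_mul_assoc mat_commutes)
        then show ?thesis by (simp add: nxt_def matrix_mult_ring)
      qed
      moreover have "(U ** b - b' ** U) ** (mat 1 - mat c ** S U) \<in> filt \<Lambda> n" using L.filt_mult[OF U(3) C] by simp
      moreover have "U ** (mat c ** (S U ** b - b ** S U)) \<in> filt \<Lambda> n"
        using L.filt_mult[OF U(1) L.filt_mult[OF cmat Srel]] by simp
      ultimately show ?thesis by (simp only: L.filt_diff)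
    qed
    have "nxt U - U = - (U ** (mat c ** S U))" by (simp add: nxt_def matrix_mult_ring)
    then have "nxt U - U \<in> filt \<Lambda> (int k + 1)" using L.filt_uminus[OF L.filt_mult[OF U(1) cS]] by simp
    then show ?thesis using 1 2 3 by (simp add: Q_def)
  qed
  define a where "a k = (nxt ^^ k) G" for k
  have Qa: "Q k (a k)" for k
  proof (induction k)
    case 0
    show ?case using G by (simp add: a_def Q_def S_def)
  next
    case (Suc k)
    then show ?case using Qnxt by (simp add: a_def)
  qed
  have "a (Suc k) - a k \<in> filt \<Lambda> (int k + 1)" for k using Qnxt[OF Qa[of k]] by (simp add: a_def)
  from L.filt_limit[OF compl this] obtain U where U: "\<And>n. \<exists>K. \<forall>k\<ge>K. U - a k \<in> filt \<Lambda> n" by blast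
  have near: "\<exists>k. U - a k \<in> filt \<Lambda> N \<and> int k \<ge> N" for N
  proof -
    obtain K where "\<forall>k\<ge>K. U - a k \<in> filt \<Lambda> N" using U by blast
    then show ?thesis by (intro exI[of _ "max K (nat N)"]) auto
  qed
  have a0: "a k \<in> filt \<Lambda> 0" and aS: "S (a k) \<in> filt \<Lambda> (int k + 1)" and ab: "a k ** b - b' ** a k \<in> filt \<Lambda> n" for k
    using Qa[of k] by (auto simp: Q_def)
  have U0: "U \<in> filt \<Lambda> 0" using near[of 0] a0 L.filt_congr by blast
  have "S U = 0"
  proof (rule L.filt_separated)
    fix N
    obtain k where k: "U - a k \<in> filt \<Lambda> N" "int k \<ge> N" using near by blast
    have "S U = adj U ** (U - a k) + adj (U - a k) ** a k + S (a k)"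
      by (simp add: S_def adj_diff matrix_mult_ring)
    moreover have "adj U ** (U - a k) \<in> filt \<Lambda> N" using L.filt_mult[OF adjf[OF U0] k(1)] by simp
    moreover have "adj (U - a k) ** a k \<in> filt \<Lambda> N" using L.filt_mult[OF adjf[OF k(1)] a0] by simp
    moreover have "S (a k) \<in> filt \<Lambda> N" using aS[of k] by (rule L.filt_mono) (use k(2) in simp)
    ultimately show "S U \<in> filt \<Lambda> N" by (simp only: L.filt_add)
  qed
  then have "adj U ** U = mat 1" by (simp add: S_def)
  moreover have "U ** b - b' ** U \<in> filt \<Lambda> n"
  proof -
    \<comment> \<open>Depth \<open>n + q\<close> compensates for the factors \<open>b\<close> and
      \<open>b'\<close>, which lower the depth by at most \<open>q\<close>.\<close>
    obtain k where k: "U - a k \<in> filt \<Lambda> (n + q)" using near by blast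
    have "U ** b - b' ** U = (U - a k) ** b - b' ** (U - a k) + (a k ** b - b' ** a k)"
      by (simp add: matrix_mult_ring)
    moreover have "(U - a k) ** b \<in> filt \<Lambda> n" by (rule L.filt_mult_le[OF k b(1)]) simp
    moreover have "b' ** (U - a k) \<in> filt \<Lambda> n" by (rule L.filt_mult_le[OF b(2) k]) simp
    ultimately show ?thesis using ab[of k] by (simp only: L.filt_add L.filt_diff)
  qed
  ultimately show ?thesis using U0 by blast
qed

section \<open>The operator ring of a skew approximate field structure\<close>

locale skew_pair = herm val \<rho> \<epsilon> h + X: apx val e \<Lambda> x P w + Y: apx val e \<Lambda>' x P w
  for val :: "'k::field \<Rightarrow> int" and \<rho> \<epsilon> and h :: "'k^'n \<Rightarrow> 'k^'n \<Rightarrow> 'k" and e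
    and \<Lambda> \<Lambda>' :: "int \<Rightarrow> ('k^'n) set" and x P w +
  fixes u :: int
  assumes sdX: "v \<in> \<Lambda> (u - s) \<longleftrightarrow> (\<forall>z\<in>\<Lambda> s. pin val 1 (h v z))"
    and sdY: "v \<in> \<Lambda>' (u - s) \<longleftrightarrow> (\<forall>z\<in>\<Lambda>' s. pin val 1 (h v z))"
    and two: "(2::'k) \<noteq> 0" "val 2 = 0" and x_skew: "adj x = - x"
    and quot_fin: "finite ((\<lambda>v. {z. z - v \<in> \<Lambda> (s + 1)}) ` \<Lambda> s)"
    and quot_card: "card ((\<lambda>v. {z. z - v \<in> \<Lambda>' (s + 1)}) ` \<Lambda>' s) = card ((\<lambda>v. {z. z - v \<in> \<Lambda> (s + 1)}) ` \<Lambda> s)"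
    and quot_fin': "finite ((\<lambda>v. {z. z - v \<in> \<Lambda>' (s + 1)}) ` \<Lambda>' s)"
begin

definition J :: "int \<Rightarrow> ('k^'n^'n) set" where
  "J n = filt \<Lambda> n \<inter> filt \<Lambda>' n"

text \<open>Matrix lifts of the residual graded field: polynomials of small degree in
  \<open>x\<close>, up to terms one step deeper on both sequences. By \<open>pev_J_iff\<close>, the
  condition on the polynomial part concerns its weight alone.\<close>

definition R :: "int \<Rightarrow> ('k^'n^'n) set" where
  "R n = {pev f x + j |f j. degree f < degree P \<and> pev f x \<in> J n \<and> j \<in> J (n + 1)}"

lemma pev_J_iff: "degree f < degree P \<Longrightarrow> pev f x \<in> J n \<longleftrightarrow> f = 0 \<or> n \<le> w f"
  using X.w_le_iff[of f n] Y.w_le_iff[of f n] by (simp add: J_def)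

lemma J_zero: "0 \<in> J n" and J_add: "a \<in> J n \<Longrightarrow> c \<in> J n \<Longrightarrow> a + c \<in> J n"
  and J_diff: "a \<in> J n \<Longrightarrow> c \<in> J n \<Longrightarrow> a - c \<in> J n"
  and J_mult: "a \<in> J n \<Longrightarrow> c \<in> J m \<Longrightarrow> k \<le> n + m \<Longrightarrow> a ** c \<in> J k"
  and J_mono: "a \<in> J n \<Longrightarrow> m \<le> n \<Longrightarrow> a \<in> J m"
  by (auto simp: J_def X.filt_zero Y.filt_zero X.filt_add Y.filt_add X.filt_diff Y.filt_diff
      X.filt_mult_le Y.filt_mult_le X.filt_mono Y.filt_mono)

lemma J_adj: "a \<in> J n \<Longrightarrow> adj a \<in> J n"
  using adj_filt[where u = u and \<Lambda> = \<Lambda>, of a n] adj_filt[where u = u and \<Lambda> = \<Lambda>', of a n] sdX sdY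
  by (simp add: J_def)

lemma R_I: "degree f < degree P \<Longrightarrow> pev f x \<in> J n \<Longrightarrow> j \<in> J (n + 1) \<Longrightarrow> pev f x + j \<in> R n"
  by (auto simp: R_def)

lemma R_E:
  assumes "a \<in> R n"
  obtains f j where "degree f < degree P" "pev f x \<in> J n" "j \<in> J (n + 1)" "a = pev f x + j"
  using assms by (auto simp: R_def)

lemma R_sub_J: "a \<in> R n \<Longrightarrow> a \<in> J n"
proof -
  assume "a \<in> R n"
  then obtain f j where f: "pev f x \<in> J n" "j \<in> J (n + 1)" "a = pev f x + j" by (auto simp: R_def)
  then show "a \<in> J n" using J_add[OF f(1) J_mono[OF f(2)]] by simp
qed

text \<open>As \<open>x\<close> is skew, the adjoint of a polynomial in \<open>x\<close> has
  \<open>\<rho>\<close>-conjugate coefficients and argument \<open>- x\<close>; its degree does not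
  grow.\<close>

lemma adj_pev: "\<exists>f'. (f = 0 \<longrightarrow> f' = 0) \<and> degree f' \<le> degree f \<and> adj (pev f x) = pev f' x"
proof (induction f)
  case 0
  have "adj 0 = 0" using adj_diff[of 0 0] by simp
  then show ?case by simp
next
  case (pCons c f)
  then obtain f' where f': "f = 0 \<longrightarrow> f' = 0" "degree f' \<le> degree f" "adj (pev f x) = pev f' x" by blast
  have "adj (pev (pCons c f) x) = mat (\<rho> c) + pev f' x ** (- x)"
    by (simp add: adj_add adj_mat adj_mult f'(3) x_skew)
  also have "pev f' x ** (- x) = x ** pev (- f') x"
    using pev_commute[of f' x "[:0, 1:]"] by (simp only: pev_X pev_uminus matrix_mult_ring)
  finally have "adj (pev (pCons c f) x) = pev (pCons (\<rho> c) (- f')) x" by simp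
  moreover have "degree (pCons (\<rho> c) (- f')) \<le> degree (pCons c f)" using f'(1,2) by (cases "f' = 0") auto
  moreover have "pCons c f = 0 \<longrightarrow> pCons (\<rho> c) (- f') = 0" using f'(1) by auto
  ultimately show ?case by blast
qed

sublocale W: witt val \<rho> \<epsilon> h e \<Lambda> \<Lambda>' u R J
proof -
  have z: "0 \<in> R n" for n using R_I[of 0 n 0] X.P_deg J_zero by simp
  have add: "a + c \<in> R n" if ac: "a \<in> R n" "c \<in> R n" for a c n
  proof -
    obtain f j where f: "degree f < degree P" "pev f x \<in> J n" "j \<in> J (n + 1)" "a = pev f x + j" using ac(1) by (rule R_E)
    obtain g k where g: "degree g < degree P" "pev g x \<in> J n" "k \<in> J (n + 1)" "c = pev g x + k" using ac(2) by (rule R_E)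
    have "pev (f + g) x + (j + k) \<in> R n"
      by (rule R_I) (use f g in \<open>auto simp: pev_add degree_add_less J_add\<close>)
    then show ?thesis by (simp add: f(4) g(4) pev_add add_ac)
  qed
  have mc: "mat k \<in> J 0" if "pin val 0 k" for k
    using X.filt_mat_int[OF that] Y.filt_mat_int[OF that] by (simp add: J_def)
  have int: "mat k ** a \<in> R n" if k: "pin val 0 k" and a: "a \<in> R n" for k a n
  proof -
    obtain f j where f: "degree f < degree P" "pev f x \<in> J n" "j \<in> J (n + 1)" "a = pev f x + j" using a by (rule R_E)
    have "pev (smult k f) x + mat k ** j \<in> R n"
      by (rule R_I) (use f in \<open>auto simp: pev_smult intro: le_less_trans[OF degree_smult_le] J_mult[OF mc[OF k]]\<close>)
    then show ?thesis by (simp add: f(4) pev_smult matrix_mult_ring)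
  qed
  have mult: "a ** c \<in> R (n + m)" if a: "a \<in> R n" and c: "c \<in> R m" for a c n m
  proof -
    obtain f j where f: "degree f < degree P" "pev f x \<in> J n" "j \<in> J (n + 1)" "a = pev f x + j" using a by (rule R_E)
    obtain g k where g: "degree g < degree P" "pev g x \<in> J m" "k \<in> J (m + 1)" "c = pev g x + k" using c by (rule R_E)
    define r where "r = (f * g) mod P"
    have d: "pev f x ** pev g x - pev r x \<in> J (n + m + 1)"
    proof (cases "f = 0 \<or> g = 0")
      case True
      then show ?thesis by (auto simp: r_def matrix_mult_ring J_zero)
    next
      case False
      then have "n \<le> w f" "m \<le> w g" using pev_J_iff f g by auto
      moreover have "pev f x ** pev g x - pev r x \<in> J (w f + w g + 1)"
        using X.x_mult[of f g] Y.x_mult[of f g] False f g by (simp add: J_def r_def)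
      ultimately show ?thesis by (elim J_mono) simp
    qed
    have "pev f x ** pev g x \<in> J (n + m)" by (rule J_mult[OF f(2) g(2)]) simp
    then have r: "pev r x \<in> J (n + m)" using J_diff[OF _ J_mono[OF d]] by fastforce
    have "pev r x + (pev f x ** pev g x - pev r x + pev f x ** k + j ** c) \<in> R (n + m)"
    proof (rule R_I[OF _ r])
      show "degree r < degree P" by (simp add: r_def X.mod_deg)
      show "pev f x ** pev g x - pev r x + pev f x ** k + j ** c \<in> J (n + m + 1)"
        by (intro J_add d J_mult[OF f(2) g(3)] J_mult[OF f(3) R_sub_J[OF c]]) simp_all
    qed
    then show ?thesis by (simp add: f(4) g(4) matrix_mult_ring algebra_simps)
  qed
  have adjR: "adj a \<in> R n" if a: "a \<in> R n" for a n
  proof -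
    obtain f j where f: "degree f < degree P" "pev f x \<in> J n" "j \<in> J (n + 1)" "a = pev f x + j" using a by (rule R_E)
    obtain f' where f': "degree f' \<le> degree f" "adj (pev f x) = pev f' x" using adj_pev by blast
    have "pev f' x + adj j \<in> R n"
      by (rule R_I) (use f f' J_adj[OF f(2)] J_adj[OF f(3)] in auto)
    then show ?thesis by (simp add: f(4) adj_add f'(2))
  qed
  have invR: "\<exists>c\<in>R (- n). a ** c - mat 1 \<in> J 1" if a: "a \<in> R n" "a \<notin> J (n + 1)" for a n
  proof -
    obtain f j where f: "degree f < degree P" "pev f x \<in> J n" "j \<in> J (n + 1)" "a = pev f x + j" using a(1) by (rule R_E)
    have "pev f x \<notin> J (n + 1)" using a(2) f(3,4) J_add by blast
    then have f0: "f \<noteq> 0" "w f = n" using pev_J_iff[OF f(1)] f(2) by auto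
    obtain g where g: "g \<noteq> 0" "degree g < degree P" "(f * g) mod P = 1" "w g = - w f"
      using X.field_inverse[OF f0(1) f(1)] by blast
    have gJ: "pev g x \<in> J (- n)" using pev_J_iff[OF g(2)] g(4) f0 by simp
    have "pev g x + 0 \<in> R (- n)" by (rule R_I[OF g(2) gJ J_zero])
    moreover have "pev f x ** pev g x - mat 1 \<in> J 1"
      using X.x_mult[OF f0(1) g(1) f(1) g(2)] Y.x_mult[OF f0(1) g(1) f(1) g(2)] g(3,4) by (simp add: J_def)
    then have "(pev f x ** pev g x - mat 1) + j ** pev g x \<in> J 1"
      by (rule J_add) (rule J_mult[OF f(3) gJ], simp)
    then have "a ** (pev g x + 0) - mat 1 \<in> J 1" by (simp add: f(4) matrix_mult_ring algebra_simps)
    ultimately show ?thesis by blast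
  qed
  have scal: "mat k \<in> R (e * val k)" if "k \<noteq> 0" for k
    using R_I[of "[:k:]" "e * val k" 0] X.filt_mat[OF that] Y.filt_mat[OF that] X.P_deg J_zero
    by (simp add: J_def matrix_mult_ring)
  have RX: "a \<in> filt \<Lambda> n" and RY: "a \<in> filt \<Lambda>' n" if "a \<in> R n" for a n
    using R_sub_J[OF that] by (auto simp: J_def)
  have "wittone val \<rho> \<epsilon> h e \<Lambda> u R J"
    by unfold_locales (use sdX two z add int mult adjR J_adj invR RX in \<open>auto simp: J_def\<close>)
  moreover have "wittone val \<rho> \<epsilon> h e \<Lambda>' u R J"
    by unfold_locales (use sdY two z add int mult adjR J_adj invR RY in \<open>auto simp: J_def\<close>)
  ultimately show "witt val \<rho> \<epsilon> h e \<Lambda> \<Lambda>' u R J"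
    by (intro witt.intro witt_axioms.intro herm_axioms scal quot_fin quot_card quot_fin')
qed

text \<open>Take a splitting basis \<open>v\<close> for \<open>\<Lambda>\<close> and partners
  \<open>v'\<close> under the Lagrangian, and let \<open>T\<close> send
  \<open>pev f x *v v i\<close> to \<open>pev f x *v v' i\<close> for \<open>f\<close> of small
  degree. The graph of \<open>T\<close> lies in the Lagrangian, so \<open>T\<close> is a residual
  isometry. It fails to commute with \<open>x\<close> only through reductions modulo
  \<open>P\<close>, which the depth of \<open>pev P x\<close> on both sequences bounds.\<close>

lemma approximate_isometry:
  assumes om: "\<And>g. lead_coeff g = 1 \<Longrightarrow> degree g = degree P - 1 \<Longrightarrow> w g \<le> om"
    and PX: "pev P x \<in> filt \<Lambda> (om + n)" and PY: "pev P x \<in> filt \<Lambda>' (om + n)"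
  shows "\<exists>T. (\<forall>s p. p \<in> \<Lambda> s \<longrightarrow> T *v p \<in> \<Lambda>' s) \<and>
    (\<forall>s p q. p \<in> \<Lambda> s \<longrightarrow> q \<in> \<Lambda> (u - 1 - s) \<longrightarrow> pin val 1 (h (T *v p) (T *v q) - h p q)) \<and>
    (\<forall>s p. p \<in> \<Lambda> s \<longrightarrow> (T ** x - x ** T) *v p \<in> \<Lambda>' (s + n))"
proof -
  obtain L where L: "W.Lag L" and surj: "\<And>s v. v \<in> \<Lambda> s \<Longrightarrow> \<exists>v'. (v, v') \<in> L s"
    using W.residual_isometry by blast
  obtain m v l where sp: "X.split m v l" and span: "\<And>y. \<exists>F. (\<forall>i. degree (F i) < degree P) \<and> y = X.comb m v F"
    using X.split_basis by metis
  have v: "v i \<in> \<Lambda> (l i)" if "i < m" for i using sp that by (simp add: X.split_def)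
  have "\<forall>i. \<exists>v'. i < m \<longrightarrow> (v i, v') \<in> L (l i)" using surj[OF v] by blast
  then obtain v' where v': "\<And>i. i < m \<Longrightarrow> (v i, v' i) \<in> L (l i)" by metis
  have v'L: "v' i \<in> \<Lambda>' (l i)" if "i < m" for i
    using v'[OF that] W.LagD(2)[OF L, of "l i"] by (auto simp: W.M_def)
  have "\<exists>T. \<forall>F. (\<forall>i<m. degree (F i) < degree P) \<longrightarrow> T *v X.comb m v F = (\<Sum>i<m. pev (F i) x *v v' i)"
    by (rule X.split_linear_map[OF sp span]) (simp_all add: pev_add pev_smult matrix_vector_ring mat_mult_vector)
  then obtain T where T: "\<And>F. (\<forall>i<m. degree (F i) < degree P) \<Longrightarrow> T *v X.comb m v F = (\<Sum>i<m. pev (F i) x *v v' i)"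
    by blast
  have mono: "p \<in> L s" if p: "p \<in> L r" "s \<le> r" for p r s
  proof (cases "s = r")
    case False
    then have "p \<in> W.M (s + 1)" using p W.LagD(2)[OF L, of r] W.M_mono[of p r "s + 1"] by auto
    then show ?thesis using W.LagD(1)[OF L, of s] by blast
  qed (use p in simp)
  have graph: "(p, T *v p) \<in> L s" if p: "p \<in> \<Lambda> s" for p s
  proof -
    obtain F where F: "\<forall>i. degree (F i) < degree P" "p = X.comb m v F" using span by blast
    have summand: "(pev (F i) x *v v i, pev (F i) x *v v' i) \<in> L s" if i: "i < m" for i
    proof (cases "F i = 0")
      case True
      then show ?thesis using E.submod_zero[OF W.Lag_submod[OF L, of s]] by (simp add: zero_prod_def)
    next
      case False
      have "s \<le> w (F i) + l i" using X.splitD[OF sp, of F s i] F p i False by auto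
      moreover have "pev (F i) x + 0 \<in> R (w (F i))"
        by (rule R_I) (use F pev_J_iff J_zero in auto)
      then have "act (pev (F i) x) (v i, v' i) \<in> L (l i + w (F i))"
        using W.LagD(4)[OF L _ v'[OF i]] by simp
      ultimately show ?thesis using mono by (auto simp: act_def)
    qed
    have "(\<Sum>i<k. (pev (F i) x *v v i, pev (F i) x *v v' i)) \<in> L s" if "k \<le> m" for k
      using that
    proof (induction k)
      case 0
      show ?case using E.submod_zero[OF W.Lag_submod[OF L, of s]] by simp
    next
      case (Suc k)
      then show ?case using E.submod_add[OF W.Lag_submod[OF L, of s]] summand[of k] by simp
    qed
    from this[of m] have "((\<Sum>i<m. pev (F i) x *v v i), (\<Sum>i<m. pev (F i) x *v v' i)) \<in> L s"
      by (simp add: sum_prod)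
    then show ?thesis using T[of F] F by (simp add: X.comb_def)
  qed
  have TL: "T *v p \<in> \<Lambda>' s" if "p \<in> \<Lambda> s" for p s
    using graph[OF that] W.LagD(2)[OF L, of s] by (auto simp: W.M_def)
  have iso: "pin val 1 (h (T *v p) (T *v q) - h p q)" if p: "p \<in> \<Lambda> s" and q: "q \<in> \<Lambda> (u - 1 - s)" for p q s
  proof -
    have "pin val 1 (HH (p, T *v p) (q, T *v q))" by (rule W.Lag_pairing[OF L graph[OF p] graph[OF q]])
    then have "pin val 1 (h p q - h (T *v p) (T *v q))" by (simp add: HH_def)
    then show ?thesis using pin_uminus[OF val, of 1 "h p q - h (T *v p) (T *v q)"] by simp
  qed
  have com: "(T ** x - x ** T) *v p \<in> \<Lambda>' (s + n)" if p: "p \<in> \<Lambda> s" for p s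
  proof -
    obtain F where F: "\<forall>i. degree (F i) < degree P" "p = X.comb m v F" using span by blast
    define c where "c i = coeff (F i) (degree P - 1)" for i
    define G where "G i = (pCons 0 (F i)) mod P" for i
    have XF: "x ** pev (F i) x = pev (G i) x + mat (c i) ** pev P x" for i
    proof -
      have "pCons 0 (F i) = G i + smult (c i) P" using X.mult_X_mod[of "F i"] F by (simp add: G_def c_def)
      then have "pev (pCons 0 (F i)) x = pev (G i + smult (c i) P) x" by simp
      then show ?thesis by (simp add: pev_add pev_smult mat_ring)
    qed
    have "x *v p = X.comb m v G + (\<Sum>i<m. c i *s (pev P x *v v i))"
    proof -
      have "x *v p = (\<Sum>i<m. (x ** pev (F i) x) *v v i)" by (simp add: F(2) X.comb_def vec.sum matrix_vector_ring)
      then show ?thesis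
        by (simp only: XF) (simp add: X.comb_def matrix_vector_ring mat_mult_vector sum.distrib)
    qed
    then have "T *v (x *v p) = (\<Sum>i<m. pev (G i) x *v v' i) + (\<Sum>i<m. c i *s (T *v (pev P x *v v i)))"
      using T[of G] by (simp add: matrix_vector_ring vec.sum G_def X.mod_deg)
    moreover have "x *v (T *v p) = (\<Sum>i<m. pev (G i) x *v v' i) + (\<Sum>i<m. c i *s (pev P x *v v' i))"
    proof -
      have "x *v (T *v p) = (\<Sum>i<m. (x ** pev (F i) x) *v v' i)" using T[of F] F by (simp add: vec.sum matrix_vector_ring)
      then show ?thesis
        by (simp only: XF) (simp add: matrix_vector_ring mat_mult_vector sum.distrib)
    qed
    ultimately have eq: "(T ** x - x ** T) *v p = (\<Sum>i<m. c i *s (T *v (pev P x *v v i) - pev P x *v v' i))"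
      by (simp add: matrix_vector_ring vec.scale_right_diff_distrib sum_subtractf)
    show ?thesis
      unfolding eq
    proof (rule Y.L_sum)
      fix i assume "i \<in> {..<m}"
      then have i: "i < m" by simp
      show "c i *s (T *v (pev P x *v v i) - pev P x *v v' i) \<in> \<Lambda>' (s + n)"
      proof (cases "c i = 0")
        case False
        then have Fi: "F i \<noteq> 0" "w (F i) \<le> e * val (c i) + om"
          using X.top_coeff_bound[OF om, of "F i"] F by (auto simp: c_def)
        have s: "s \<le> w (F i) + l i" using X.splitD[OF sp, of F s i] F p i Fi by auto
        have "T *v (pev P x *v v i) - pev P x *v v' i \<in> \<Lambda>' (l i + (om + n))"
          by (intro Y.L_diff TL X.filtD[OF PX v[OF i]] Y.filtD[OF PY v'L[OF i]]) simp_all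
        then have "c i *s (T *v (pev P x *v v i) - pev P x *v v' i) \<in> \<Lambda>' (l i + (om + n) + e * val (c i))"
          by (simp only: Y.L_scale[OF False])
        then show ?thesis by (rule Y.L_mono) (use s Fi(2) in simp)
      qed (simp add: Y.L_zero)
    qed
  qed
  show ?thesis using TL iso com by blast
qed

end

section \<open>Conjugacy of skew-simple strata\<close>

text \<open>The class of a vector modulo the next lattice depends on its coefficients on finitely
  many generators only through their residues.\<close>

lemma finite_quotient:
  fixes \<Lambda> :: "int \<Rightarrow> ('k::field^'n) set"
  assumes L: "latseq val e \<Lambda>" and full: "full_lattice val (\<Lambda> s)" and fin: "finite (residue_field val)"
  shows "finite ((\<lambda>v. {z. z - v \<in> \<Lambda> (s + 1)}) ` \<Lambda> s)"
proof -
  interpret latseq val e \<Lambda> by (rule L)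
  obtain S where S: "finite S" "\<Lambda> s = {(\<Sum>s\<in>S. c s *s s) | c. \<forall>s\<in>S. c s \<in> ring_of_integers val}"
    using full unfolding full_lattice_def by blast
  define rel where "rel = {(x, y). x \<in> ring_of_integers val \<and> y \<in> ring_of_integers val \<and> x - y \<in> max_ideal val}"
  define T where "T = (\<lambda>C. SOME x. x \<in> C) ` residue_field val"
  have T: "finite T" using fin by (simp add: T_def)
  have rep: "\<exists>t\<in>T. pin val 1 (c - t)" if c: "c \<in> ring_of_integers val" for c
  proof -
    define t where "t = (SOME x. x \<in> rel `` {c})"
    have "rel `` {c} \<in> residue_field val" unfolding residue_field_def rel_def[symmetric] using c by (rule quotientI)
    then have "t \<in> T" unfolding T_def t_def by (rule imageI)
    moreover have "c \<in> rel `` {c}" using c by (simp add: rel_def max_ideal_def)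
    then have "t \<in> rel `` {c}" unfolding t_def by (rule someI)
    then have "pin val 1 (c - t)" by (simp add: rel_def max_ideal_def)
    ultimately show ?thesis by blast
  qed
  have gen: "g \<in> \<Lambda> s" if g: "g \<in> S" for g
  proof -
    have "(\<Sum>y\<in>S. (if y = g then 1 else 0) *s y) = (\<Sum>y\<in>S. if y = g then g else 0)"
      by (rule sum.cong) auto
    also have "\<dots> = g" using S(1) g by simp
    finally have eq: "g = (\<Sum>y\<in>S. (if y = g then 1 else 0) *s y)" by simp
    have "\<forall>y\<in>S. (if y = g then 1 else 0) \<in> ring_of_integers val" using pin_one[OF dv, of 0] by (simp add: ring_of_integers_def)
    then show ?thesis unfolding S(2) by (intro CollectI exI[of _ "\<lambda>y. if y = g then 1 else 0"] conjI eq)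
  qed
  have deep: "k *s g \<in> \<Lambda> (s + 1)" if k: "pin val 1 k" and g: "g \<in> \<Lambda> s" for k g
  proof (cases "k = 0")
    case False
    then have "k *s g \<in> \<Lambda> (s + e * val k)" using L_scale g by blast
    moreover have "1 \<le> e * val k" using False k e_pos by (simp add: pin_def int_one_le_iff_zero_less)
    ultimately show ?thesis by (auto elim!: L_mono)
  qed (simp add: L_zero)
  have "(\<lambda>v. {z. z - v \<in> \<Lambda> (s + 1)}) ` \<Lambda> s \<subseteq> (\<lambda>t. {z. z - (\<Sum>g\<in>S. t g *s g) \<in> \<Lambda> (s + 1)}) ` (S \<rightarrow>\<^sub>E T)"
  proof
    fix X assume "X \<in> (\<lambda>v. {z. z - v \<in> \<Lambda> (s + 1)}) ` \<Lambda> s"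
    then obtain v where v: "v \<in> \<Lambda> s" "X = {z. z - v \<in> \<Lambda> (s + 1)}" by blast
    obtain c where c: "v = (\<Sum>s\<in>S. c s *s s)" "\<forall>s\<in>S. c s \<in> ring_of_integers val" using v(1) unfolding S(2) by blast
    have "\<forall>g\<in>S. \<exists>t. t \<in> T \<and> pin val 1 (c g - t)" using rep c(2) by blast
    then obtain t where t: "\<And>g. g \<in> S \<Longrightarrow> t g \<in> T \<and> pin val 1 (c g - t g)" by metis
    define t' where "t' = restrict t S"
    have "v - (\<Sum>g\<in>S. t' g *s g) = (\<Sum>g\<in>S. (c g - t g) *s g)"
      by (simp add: c(1) t'_def vec.scale_left_diff_distrib sum_subtractf)
    also have "\<dots> \<in> \<Lambda> (s + 1)" by (intro L_sum deep gen) (use t in auto)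
    finally have "X = {z. z - (\<Sum>g\<in>S. t' g *s g) \<in> \<Lambda> (s + 1)}" using v(2) coset_eq_iff by simp
    moreover have "t' \<in> S \<rightarrow>\<^sub>E T" using t by (simp add: t'_def)
    ultimately show "X \<in> (\<lambda>t. {z. z - (\<Sum>g\<in>S. t g *s g) \<in> \<Lambda> (s + 1)}) ` (S \<rightarrow>\<^sub>E T)" by blast
  qed
  moreover have "finite (S \<rightarrow>\<^sub>E T)" using S(1) T by (intro finite_PiE) auto
  ultimately show ?thesis by (meson finite_imageI finite_subset)
qed

lemma quotient_transport:
  fixes g gi :: "'k::field^'n^'n" and \<Lambda> :: "int \<Rightarrow> ('k^'n) set"
  assumes g: "g ** gi = mat 1" "gi ** g = mat 1"
  defines "W \<equiv> \<lambda>s. (\<lambda>v. {z. z - v \<in> \<Lambda> (s + 1)}) ` \<Lambda> s"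
    and "W' \<equiv> \<lambda>s. (\<lambda>v. {z. z - v \<in> {v. g *v v \<in> \<Lambda> (s + 1)}}) ` {v. g *v v \<in> \<Lambda> s}"
  assumes fin: "finite (W s)"
  shows "finite (W' s)" "card (W' s) = card (W s)"
proof -
  have ggi: "g *v (gi *v v) = v" for v using g by (simp flip: matrix_vector_ring(5))
  have eq: "W' s = (\<lambda>C. (\<lambda>v. g *v v) -` C) ` W s"
  proof (intro equalityI subsetI)
    fix X assume "X \<in> W' s"
    then obtain v where "g *v v \<in> \<Lambda> s" "X = {z. g *v (z - v) \<in> \<Lambda> (s + 1)}" by (auto simp: W'_def)
    then show "X \<in> (\<lambda>C. (\<lambda>v. g *v v) -` C) ` W s"
      unfolding W_def by (intro image_eqI[of _ _ "{z. z - g *v v \<in> \<Lambda> (s + 1)}"]) (auto simp: matrix_vector_ring)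
  next
    fix X assume "X \<in> (\<lambda>C. (\<lambda>v. g *v v) -` C) ` W s"
    then obtain v where v: "v \<in> \<Lambda> s" "X = {z. g *v z - v \<in> \<Lambda> (s + 1)}" by (auto simp: W_def)
    then show "X \<in> W' s"
      unfolding W'_def by (intro image_eqI[of _ _ "gi *v v"]) (auto simp: matrix_vector_ring ggi)
  qed
  have surj: "surj (\<lambda>v. g *v v)" using ggi by (metis surjI)
  have "inj_on (\<lambda>C. (\<lambda>v. g *v v) -` C) (W s)"
    by (rule inj_onI) (metis surj surj_image_vimage_eq)
  then show "finite (W' s)" "card (W' s) = card (W s)"
    unfolding eq using fin by (simp_all add: card_image)
qed

theorem theorem8p3:
  fixes val :: "'k::field \<Rightarrow> int" and \<rho> :: "'k \<Rightarrow> 'k" and \<epsilon> :: 'k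
    and h :: "'k^'n \<Rightarrow> 'k^'n \<Rightarrow> 'k"
    and \<Lambda> :: "int \<Rightarrow> ('k^'n) set" and q r :: int and b b' :: "'k^'n^'n"
  assumes "nonarch_local_field_odd val"
    and "field_involution val \<rho>"
    and "eps_hermitian \<rho> \<epsilon> h"
    and "skew_simple_stratum val h \<Lambda> q r b"
    and "skew_simple_stratum val h \<Lambda> q r b'"
    and "intertwine_in_G h \<Lambda> r b b'"
  shows "\<exists>g\<in>U h \<Lambda>. \<exists>g'. g ** g' = mat 1 \<and> g' ** g = mat 1 \<and>
           strata_equiv \<Lambda> q r (g ** b ** g') b'"
proof -
  have dv: "discrete_valuation val" and compl: "complete_wrt val" and resfin: "finite (residue_field val)"
    and two0: "(2::'k) \<notin> max_ideal val"
    using assms(1) by (auto simp: nonarch_local_field_odd_def)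
  have two: "(2::'k) \<noteq> 0" "val 2 = 0"
  proof -
    show "(2::'k) \<noteq> 0" using two0 by (auto simp: max_ideal_def pin_def)
    have "pin val 0 (1 + 1)" using pin_add[OF dv] pin_one[OF dv, of 0] by blast
    then show "val 2 = 0" using two0 by (auto simp: max_ideal_def pin_def)
  qed
  have ls: "lattice_seq val \<Lambda>" and sb: "simple_stratum \<Lambda> q r b" and kb: "skew h b" and sdl: "self_dual val h \<Lambda>"
    and sb': "simple_stratum \<Lambda> q r b'" and kb': "skew h b'"
    using assms(4,5) by (auto simp: skew_simple_stratum_def)
  obtain e where L: "latseq val e \<Lambda>" using latseq_of_lattice_seq[OF dv ls] by blast
  have full: "full_lattice val (\<Lambda> s)" for s using ls unfolding lattice_seq_def by blast
  interpret L: latseq val e \<Lambda> by (rule L)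
  interpret herm val \<rho> \<epsilon> h by unfold_locales (rule dv assms(2,3))+
  have herm: "herm val \<rho> \<epsilon> h" ..
  show ?thesis
  proof (cases "q = r")
    case True
    \<comment> \<open>A pure stratum requires \<open>- q < - r\<close>, so both strata are zero here
      and the identity conjugates them.\<close>
    then have "b = 0" "b' = 0"
      using sb sb' by (auto simp: simple_stratum_def zero_stratum_def pure_stratum_def)
    moreover have "mat 1 \<in> U h \<Lambda>"
      unfolding U_def Ut_def isom_group_def using L.filt_one by (auto simp: matrix_mult_ring intro!: exI[of _ "mat 1"])
    ultimately show ?thesis
      by (intro bexI[of _ "mat 1"] exI[of _ "mat 1"]) (simp_all add: matrix_mult_ring L.strata_equiv_iff L.filt_zero)
  next
    case False
    then have pb: "pure_stratum \<Lambda> q r b" and pb': "pure_stratum \<Lambda> q r b'"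
      and mb: "\<And>c. pure_stratum \<Lambda> q r c \<Longrightarrow> strata_equiv \<Lambda> q r b c \<Longrightarrow> deg_Fbeta b \<le> deg_Fbeta c"
      and mb': "\<And>c. pure_stratum \<Lambda> q r c \<Longrightarrow> strata_equiv \<Lambda> q r b' c \<Longrightarrow> deg_Fbeta b' \<le> deg_Fbeta c"
      using sb sb' unfolding simple_stratum_def zero_stratum_def by blast+
    have bq: "b \<in> filt \<Lambda> (- q)" "b' \<in> filt \<Lambda> (- q)"
      using pb pb' unfolding pure_stratum_def by blast+
    obtain u where u: "\<And>s. dual_lattice val h (\<Lambda> s) = \<Lambda> (u - s)" using sdl unfolding self_dual_def by blast
    have sd: "v \<in> \<Lambda> (u - s) \<longleftrightarrow> (\<forall>z\<in>\<Lambda> s. pin val 1 (h v z))" for v s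
      unfolding u[symmetric] dual_lattice_def max_ideal_def by simp
    have adjf: "adj a \<in> filt \<Lambda> n" if "a \<in> filt \<Lambda> n" for a n
      by (rule adj_filt[where u = u and \<Lambda> = \<Lambda>, OF _ that]) (rule sd)
    have ab: "adj b = - b" "adj b' = - b'"
      using kb kb' unfolding skew_def by (blast intro: adj_unique)+
    obtain g a a' where gG: "g \<in> isom_group h" and a: "a \<in> filt \<Lambda> (- r)" "a' \<in> filt \<Lambda> (- r)"
      and ga: "g ** (b + a) = (b' + a') ** g"
      using assms(6) unfolding intertwine_in_G_def by auto
    define x0 y0 where "x0 = b + a" and "y0 = b' + a'"
    have x0: "x0 - b \<in> filt \<Lambda> (- r)" and y0: "y0 - b' \<in> filt \<Lambda> (- r)" and gxy0: "g ** x0 = y0 ** g"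
      using a ga by (simp_all add: x0_def y0_def)
    obtain gi where gi: "g ** gi = mat 1" "gi ** g = mat 1" and gh: "\<And>v w. h (g *v v) (g *v w) = h v w"
      using gG unfolding isom_group_def by blast
    have ag: "adj g = gi"
    proof (rule adj_unique)
      fix v w
      have "w = g *v (gi *v w)" using gi by (simp flip: matrix_vector_ring(5))
      then show "h (g *v v) w = h v (gi *v w)" using gh[of v "gi *v w"] by simp
    qed
    obtain c where c: "pin val 0 c" "c + c = 1" "\<rho> c = c" using half[OF two] by blast
    \<comment> \<open>The skew part. It stays in the coset because \<open>b\<close> and
      \<open>b'\<close> are skew and the filtration is stable under the adjoint, and it keeps the
      intertwining relation because the adjoint of the isometry \<open>g\<close> is its
      inverse.\<close>
    define sk where "sk a = mat c ** (a - adj a)" for a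
    have sk_skew: "adj (sk a) = - sk a" for a
      by (simp add: sk_def adj_mult adj_diff adj_adj adj_mat c(3) matrix_mult_ring mat_commutes)
    have sk_near: "sk a - d \<in> filt \<Lambda> (- r)" if "a - d \<in> filt \<Lambda> (- r)" "adj d = - d" for a d
    proof -
      have "mat c ** d + mat c ** d = d"
        unfolding matrix_mult_ring(1)[symmetric] mat_ring(1)[symmetric] c(2) by (simp add: matrix_mult_ring)
      then have "sk a - d = sk a - (mat c ** d + mat c ** d)" by simp
      also have "\<dots> = mat c ** ((a - d) - adj (a - d))"
        by (simp only: sk_def adj_diff that(2) matrix_mult_ring, simp add: algebra_simps)
      finally have "sk a - d = mat c ** ((a - d) - adj (a - d))" .
      moreover have "mat c ** ((a - d) - adj (a - d)) \<in> filt \<Lambda> (0 + - r)"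
        by (intro L.filt_mult L.filt_mat_int[OF c(1)] L.filt_diff adjf that(1))
      ultimately show ?thesis by simp
    qed
    define x y where "x = sk x0" and "y = sk y0"
    have x: "x - b \<in> filt \<Lambda> (- r)" "adj x = - x" and y: "y - b' \<in> filt \<Lambda> (- r)"
      unfolding x_def y_def using sk_near x0 y0 ab sk_skew by blast+
    have gxy: "g ** x = y ** g"
    proof -
      have "adj x0 ** gi = gi ** adj y0" using arg_cong[OF gxy0, of adj] by (simp add: adj_mult ag)
      then have "g ** (adj x0 ** gi) ** g = g ** (gi ** adj y0) ** g" by simp
      then have "g ** adj x0 ** (gi ** g) = (g ** gi) ** adj y0 ** g" by (simp add: matrix_mult_ring)
      then have "g ** adj x0 = adj y0 ** g" using gi by (simp add: matrix_mult_ring)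
      then have "g ** (x0 - adj x0) = (y0 - adj y0) ** g" using gxy0 by (simp add: matrix_mult_ring)
      then have "mat c ** (g ** (x0 - adj x0)) = mat c ** ((y0 - adj y0) ** g)" by simp
      moreover have "mat c ** (g ** (x0 - adj x0)) = g ** x"
        unfolding x_def sk_def by (metis matrix_mul_assoc mat_commutes)
      ultimately show ?thesis by (simp add: y_def sk_def matrix_mul_assoc)
    qed
    define \<Lambda>' where "\<Lambda>' = (\<lambda>s. {v. g *v v \<in> \<Lambda> s})"
    have L': "latseq val e \<Lambda>'" unfolding \<Lambda>'_def by (rule latseq_transport[OF L gi])
    obtain P where EP: "pure_elt val e \<Lambda> b P" "degree P = deg_Fbeta b" using pure_elt_of_pure_stratum[OF L pb] by blast
    obtain P' where EP': "pure_elt val e \<Lambda> b' P'" "degree P' = deg_Fbeta b'" using pure_elt_of_pure_stratum[OF L pb'] by blast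
    define w where "w = pure_elt.w \<Lambda> b"
    define w' where "w' = pure_elt.w \<Lambda> b'"
    have minb: False if "lead_coeff Q = 1" "0 < degree Q" "degree Q < degree P" "apx val e \<Lambda> b Q w"
      "\<And>g. lead_coeff g = 1 \<Longrightarrow> degree g = degree Q - 1 \<Longrightarrow> w g \<le> om" "pev Q b \<in> filt \<Lambda> (om + - r)" for Q om
      by (rule simple_stratum_minimal[OF L pb mb that(1) that(3)[unfolded EP(2)] that(4,5,6)])
    have minb': False if "lead_coeff Q = 1" "0 < degree Q" "degree Q < degree P'" "apx val e \<Lambda> b' Q w'"
      "\<And>g. lead_coeff g = 1 \<Longrightarrow> degree g = degree Q - 1 \<Longrightarrow> w' g \<le> om" "pev Q b' \<in> filt \<Lambda> (om + - r)" for Q om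
      by (rule simple_stratum_minimal[OF L pb' mb' that(1) that(3)[unfolded EP'(2)] that(4,5,6)])
    note kl = pure_elt.congruence_near[OF EP(1) minb[unfolded w_def] x(1)]
    note kl' = pure_elt.congruence_near[OF EP'(1) minb'[unfolded w'_def] y]
    have AX: "apx val e \<Lambda> x P w" unfolding w_def by (rule pure_elt.near_apx(1)[OF EP(1) kl x(1)])
    have AY: "apx val e \<Lambda> y P' w'" unfolding w'_def by (rule pure_elt.near_apx(1)[OF EP'(1) kl' y])
    obtain g0 where g0c: "lead_coeff g0 = 1 \<and> degree g0 = degree P - 1 \<and>
        (\<forall>k. lead_coeff k = 1 \<longrightarrow> degree k = degree P - 1 \<longrightarrow> w k \<le> w g0) \<and> pev P x \<in> filt \<Lambda> (w g0 + - r)"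
      using pure_elt.near_apx(2)[OF EP(1) kl x(1), folded w_def] by (rule exE)
    then have g0: "lead_coeff g0 = 1" "degree g0 = degree P - 1" and Px: "pev P x \<in> filt \<Lambda> (w g0 + - r)"
      by blast+
    have g0max: "w k \<le> w g0" if "lead_coeff k = 1" "degree k = degree P - 1" for k
      using g0c that by blast
    obtain g1 where g1c: "lead_coeff g1 = 1 \<and> degree g1 = degree P' - 1 \<and>
        (\<forall>k. lead_coeff k = 1 \<longrightarrow> degree k = degree P' - 1 \<longrightarrow> w' k \<le> w' g1) \<and> pev P' y \<in> filt \<Lambda> (w' g1 + - r)"
      using pure_elt.near_apx(2)[OF EP'(1) kl' y, folded w'_def] by (rule exE)
    have g1max: "w' k \<le> w' g1" if "lead_coeff k = 1" "degree k = degree P' - 1" for k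
      using g1c that by blast
    have P'y: "pev P' y \<in> filt \<Lambda> (w' g1 + - r)" using g1c by blast
    \<comment> \<open>On \<open>\<Lambda>'\<close> the element \<open>x\<close> behaves as
      \<open>y\<close> does on \<open>\<Lambda>\<close>, so there it carries the structure coming
      from \<open>b'\<close>.\<close>
    have AX': "apx val e \<Lambda>' x P' w'" unfolding \<Lambda>'_def by (rule apx_transport[OF AY gi gxy])
    have P'x: "pev P' x \<in> filt \<Lambda>' (w' g1 + - r)"
      unfolding \<Lambda>'_def using filt_transport[OF gi pev_conj[OF gxy]] P'y by blast
    have "degree P' \<le> degree P"
      by (rule approximate_degree_le[OF AX AX' g0max Px EP'(1) w'_def minb'])
    moreover have "degree P \<le> degree P'"
      by (rule approximate_degree_le[OF AX' AX g1max P'x EP(1) w_def minb])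
    ultimately have deg: "degree P' = degree P" by simp
    have AP: "apx val e \<Lambda>' x P w" by (rule joint_apx(1)[OF AX AX' deg g0 Px g1max P'x])
    have Px': "pev P x \<in> filt \<Lambda>' (w g0 + - r)" by (rule joint_apx(2)[OF AX AX' deg g0 Px g1max P'x])
    have sd': "v \<in> \<Lambda>' (u - s) \<longleftrightarrow> (\<forall>z\<in>\<Lambda>' s. pin val 1 (h v z))" for v s
    proof -
      have ggi: "g *v (gi *v z) = z" for z using gi by (simp flip: matrix_vector_ring(5))
      have "v \<in> \<Lambda>' (u - s) \<longleftrightarrow> (\<forall>z\<in>\<Lambda> s. pin val 1 (h (g *v v) z))" by (simp add: \<Lambda>'_def sd)
      also have "\<dots> \<longleftrightarrow> (\<forall>z\<in>\<Lambda>' s. pin val 1 (h (g *v v) (g *v z)))"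
      proof
        assume a: "\<forall>z\<in>\<Lambda>' s. pin val 1 (h (g *v v) (g *v z))"
        show "\<forall>z\<in>\<Lambda> s. pin val 1 (h (g *v v) z)"
        proof
          fix z assume "z \<in> \<Lambda> s"
          then have "gi *v z \<in> \<Lambda>' s" by (simp add: \<Lambda>'_def ggi)
          then have "pin val 1 (h (g *v v) (g *v (gi *v z)))" using a by blast
          then show "pin val 1 (h (g *v v) z)" by (simp add: ggi)
        qed
      qed (simp add: \<Lambda>'_def)
      finally show ?thesis by (simp add: gh)
    qed
    have qf: "finite ((\<lambda>v. {z. z - v \<in> \<Lambda> (s + 1)}) ` \<Lambda> s)" for s by (rule finite_quotient[OF L full resfin])
    interpret SP: skew_pair val \<rho> \<epsilon> h e \<Lambda> \<Lambda>' x P w u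
    proof (rule skew_pair.intro[OF herm AX AP skew_pair_axioms.intro])
      show "finite ((\<lambda>v. {z. z - v \<in> \<Lambda>' (s + 1)}) ` \<Lambda>' s)"
        "card ((\<lambda>v. {z. z - v \<in> \<Lambda>' (s + 1)}) ` \<Lambda>' s) = card ((\<lambda>v. {z. z - v \<in> \<Lambda> (s + 1)}) ` \<Lambda> s)" for s
        unfolding \<Lambda>'_def by (rule quotient_transport[where \<Lambda> = \<Lambda> and s = s, OF gi qf])+
    qed (rule sd sd' two x(2) qf)+
    obtain T where T1: "\<And>s p. p \<in> \<Lambda> s \<Longrightarrow> T *v p \<in> \<Lambda>' s"
      and T2: "\<And>s p z. p \<in> \<Lambda> s \<Longrightarrow> z \<in> \<Lambda> (u - 1 - s) \<Longrightarrow> pin val 1 (h (T *v p) (T *v z) - h p z)"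
      and T3: "\<And>s p. p \<in> \<Lambda> s \<Longrightarrow> (T ** x - x ** T) *v p \<in> \<Lambda>' (s + - r)"
      using SP.approximate_isometry[OF g0max Px Px'] by blast
    \<comment> \<open>\<open>T\<close> maps \<open>\<Lambda>\<close> into its preimage
      \<open>\<Lambda>'\<close> under \<open>g\<close>, and \<open>g\<close> maps that back:
      \<open>G\<close> preserves \<open>\<Lambda>\<close> although \<open>g\<close> alone need not,
      and it inherits the approximate isometry property from \<open>T\<close>.\<close>
    define G where "G = g ** T"
    have G0: "G \<in> filt \<Lambda> 0" unfolding L.filt_iff using T1 by (simp add: G_def matrix_vector_ring \<Lambda>'_def)
    have G1: "adj G ** G - mat 1 \<in> filt \<Lambda> 1"
      unfolding L.filt_iff
    proof (intro allI impI)
      fix s p assume p: "p \<in> \<Lambda> s"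
      define d where "d = (adj G ** G - mat 1) *v p"
      have "pin val 1 (h d z)" if z: "z \<in> \<Lambda> (u - 1 - s)" for z
      proof -
        have "h d z = h (adj G *v (G *v p)) z - h p z" by (simp add: d_def matrix_vector_ring h_diff)
        also have "h (adj G *v (G *v p)) z = h (G *v p) (G *v z)" by (rule adj'[symmetric])
        also have "h (G *v p) (G *v z) = h (T *v p) (T *v z)" by (simp add: G_def matrix_vector_ring gh)
        finally show ?thesis using T2[OF p z] by simp
      qed
      then have "d \<in> \<Lambda> (u - (u - 1 - s))" using sd by blast
      then show "(adj G ** G - mat 1) *v p \<in> \<Lambda> (s + 1)" by (simp add: d_def add.commute)
    qed
    have G2: "G ** b - b' ** G \<in> filt \<Lambda> (- r)"
    proof -
      \<comment> \<open>Three errors add up: replacing \<open>b\<close> by \<open>x\<close>,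
        commuting \<open>T\<close> past \<open>x\<close>, and replacing \<open>y\<close> by
        \<open>b'\<close>.\<close>
      have "G ** b - b' ** G = G ** (b - x) + g ** (T ** x - x ** T) + (y - b') ** G"
      proof -
        have "y ** G = g ** x ** T" by (simp add: G_def gxy matrix_mult_ring)
        then show ?thesis by (simp add: G_def matrix_mult_ring)
      qed
      moreover have "G ** (b - x) \<in> filt \<Lambda> (- r)" by (rule L.filt_mult_le[OF G0 L.filt_diff_sym[OF x(1)]]) simp
      moreover have "(y - b') ** G \<in> filt \<Lambda> (- r)" by (rule L.filt_mult_le[OF y G0]) simp
      moreover have "g ** (T ** x - x ** T) \<in> filt \<Lambda> (- r)"
        unfolding L.filt_iff using T3 by (simp add: matrix_vector_ring(5) \<Lambda>'_def)
      ultimately show ?thesis by (simp only: L.filt_add)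
    qed
    obtain V where V: "V \<in> filt \<Lambda> 0" "adj V ** V = mat 1" "V ** b - b' ** V \<in> filt \<Lambda> (- r)"
      using isometry_lift[OF herm L compl sd two bq ab G0 G1 G2] by blast
    have V': "V ** adj V = mat 1" using V(2) by (rule matrix_left_right_inverse[THEN iffD1])
    have aV: "adj V \<in> filt \<Lambda> 0" by (rule adjf[OF V(1)])
    have "h (V *v v) (V *v z) = h v z" for v z
      using V(2) by (simp add: adj flip: matrix_vector_ring(5))
    then have "V \<in> U h \<Lambda>"
      unfolding U_def Ut_def isom_group_def using V V' aV by blast
    moreover have "V ** b ** adj V - b' \<in> filt \<Lambda> (- r)"
    proof -
      have "V ** b ** adj V - b' ** (V ** adj V) = (V ** b - b' ** V) ** adj V" by (simp add: matrix_mult_ring)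
      then have "V ** b ** adj V - b' = (V ** b - b' ** V) ** adj V" using V' by (simp add: matrix_mult_ring)
      then show ?thesis using L.filt_mult[OF V(3) aV] by simp
    qed
    ultimately show ?thesis using V(2) V' L.strata_equiv_iff by blast
  qed
qed

end
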